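(* Suppose that the boundary data $f_0:\Gamma_-\to\mathbb{R}$ is bounded (and Borel measurable) and that it satisfies at least one of the following two conditions: (1) $f_0(x,\cdot)$ is continuous on $\Gamma_{-,x}$ for almost all $x\in\partial\Omega$; (2) $f_0(\cdot,\xi)$ is continuous on $\Gamma_{-,\xi}$ for almost all $\xi\in S^{d-1}$. Then there exists a unique solution $f$ (in the sense defined in the context) to the boundary value problem $$\xi\cdot\nabla_x f(x,\xi)+\mu_t(x)f(x,\xi)=\mu_s(x)\int_{S^{d-1}}p(x,\xi,\xi')f(x,\xi')\,d\sigma_{\xi'},\quad (x,\xi)\in\Omega_0\times S^{d-1},$$ $$f(x,\xi)=f_0(x,\xi),\quad (x,\xi)\in\Gamma_-,$$ and $$\operatorname{disc}(f)=\{(x_*+t\xi_*,\xi_* )\mid (x_*,\xi_* )\in\operatorname{disc}(f_0),\ 0\le t<\tau_+(x_*,\xi_* )\}.$$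
   Context: Let $d\in\{2,3\}$; $S^{d-1}$ is the unit sphere of $\mathbb{R}^d$ and $d\sigma$ is the Lebesgue (surface) measure on it. $\Omega\subset\mathbb{R}^d$ is a bounded convex domain with $C^1$ boundary and outer unit normal $n(x)$ at $x\in\partial\Omega$. $\overline{\Omega}=\bigcup_{j=1}^N\overline{\Omega_j}$, where $\Omega_1,\dots,\Omega_N$ are disjoint open subdomains of $\Omega$ with piecewise $C^1$ boundaries, and $\Omega_0:=\bigcup_{j=1}^N\Omega_j$. Generalized convexity condition (assumed): for every $(x,\xi)\in\Omega\times S^{d-1}$ there are a positive integer $l(x,\xi)$ and reals $0\le t_1(x,\xi)<\dots<t_{l(x,\xi)}(x,\xi)$ such that, for $t\ge0$, $x-t\xi\in\partial\Omega_0$ if and only if $t=t_j(x,\xi)$ for some $j$; moreover $\sup_{(x,\xi)\in\Omega\times S^{d-1}}l(x,\xi)<\infty$. Put $t_0(x,\xi)=0$. Coefficients: $\mu_t,\mu_s$ are nonnegative bounded functions on $\mathbb{R}^d$, continuous on $\Omega_0$, with $\mu_t\ge\mu_s$ on $\Omega_0$ and $\mu_t=\mu_s=0$ on $\mathbb{R}^d\setminus\Omega_0$. $p$ is a nonnegative bounded function on $\mathbb{R}^d\times S^{d-1}\times S^{d-1}$, continuous on $\Omega_0\times S^{d-1}\times S^{d-1}$, zero on $(\mathbb{R}^d\setminus\Omega_0)\times S^{d-1}\times S^{d-1}$, with $\int_{S^{d-1}}p(x,\xi,\xi')\,d\sigma_{\xi'}=1$ for all $(x,\xi)\in\Omega_0\times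 S^{d-1}$. Notation: $\Gamma_\pm:=\{(x,\xi)\in\partial\Omega\times S^{d-1}\mid \pm n(x)\cdot\xi>0\}$; $D:=(\Omega\times S^{d-1})\cup\Gamma_-$; $\overline{D}:=D\cup\Gamma_+$; $\tau_\pm(x,\xi):=\inf\{t>0\mid x\pm t\xi\notin\Omega\}$ for $(x,\xi)\in\overline{D}$; $\Gamma_{-,\xi}:=\{x\in\partial\Omega\mid n(x)\cdot\xi<0\}$ for $\xi\in S^{d-1}$; $\Gamma_{-,x}:=\{\xi\in S^{d-1}\mid n(x)\cdot\xi<0\}$ for $x\in\partial\Omega$. "Almost all" refers to surface measure on $\partial\Omega$, respectively on $S^{d-1}$. For a function $g$, $\operatorname{disc}(g)$ is the set of points of its domain at which $g$ is discontinuous ($f$ has domain $D$, $f_0$ has domain $\Gamma_-$). The directional derivative is $\xi\cdot\nabla_xf(x,\xi):=\frac{d}{dt}f(x+t\xi,\xi)\big|_{t=0}$. A solution to the boundary value problem is a bounded function $f$ on $D$ (for which the integral in the equation is defined) such that: (i) $\xi\cdot\nabla_xf(x,\xi)$ exists at all $(x,\xi)\in\Omega_0\times S^{d-1}$; (ii) $f$ satisfies the equation for all $(x,\xi)\in\Omega_0\times S^{d-1}$ and the boundary condition for all $(x,\xi)\in\Gamma_-$; (iii) $f(\cdot,\xi)$ is continuous along the line $\{x+t\xi\mid t\in\mathbb{R}\}\cap(\Omega\cup\Gamma_{-,\xi})$ for all $(x,\xi)\in D$; (iv) for all $(x,\xi)\in\Omega_0\times S^{d-1}$, $\xi\cdot\nabla_xf(\cdot,\xi)$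 is continuous on the open segments $\{x-t\xi\mid t\in(t_{j-1}(x,\xi),t_j(x,\xi))\}$, $j=1,\dots,l(x,\xi)$. *)

theory Defs
  imports "HOL-Analysis.Analysis"
begin

text \<open>
  Surface measure on a hypersurface of an \<open>d\<close>-dimensional Euclidean space is the
  \<open>(d - 1)\<close>-dimensional Hausdorff measure with the normalisation that makes it agree with
  the classical surface area.  The definitions below are meant for dimension \<open>m \<ge> 1\<close>
  (for \<open>m = 0\<close> the empty set would be charged, since \<open>0 ^ 0 = 1\<close>).  Boundedness of the
  covering sets is required explicitly because \<^const>\<open>diameter\<close> is unspecified on
  unbounded sets.
\<close>

definition hausdorff_pre :: "nat \<Rightarrow> real \<Rightarrow> 'a::metric_space set \<Rightarrow> ennreal" where
  "hausdorff_pre m \<delta> A =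
     (INF C \<in> {C :: nat \<Rightarrow> 'a set. A \<subseteq> (\<Union>i. C i) \<and> (\<forall>i. bounded (C i) \<and> diameter (C i) \<le> \<delta>)}.
        \<Sum>i. ennreal (unit_ball_vol (real m) * (diameter (C i) / 2) ^ m))"

definition hausdorff_outer :: "nat \<Rightarrow> 'a::metric_space set \<Rightarrow> ennreal" where
  "hausdorff_outer m A = (SUP \<delta>\<in>{0<..}. hausdorff_pre m \<delta> A)"

text \<open>
  The measure lives on all Caratheodory-measurable sets, so it is complete (Lebesgue-type, not
  merely Borel).
\<close>

definition hausdorff_measure :: "nat \<Rightarrow> 'a::metric_space measure" where
  "hausdorff_measure m =
     measure_of UNIV (lambda_system UNIV (Pow UNIV) (hausdorff_outer m)) (hausdorff_outer m)"

definition surface_measure :: "'a::euclidean_space measure" where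
  "surface_measure = hausdorff_measure (DIM('a) - 1)"

definition C1_on :: "'a::euclidean_space set \<Rightarrow> ('a \<Rightarrow> real) \<Rightarrow> ('a \<Rightarrow> 'a) \<Rightarrow> bool" where
  "C1_on U g G \<longleftrightarrow> open U \<and> (\<forall>y\<in>U. GDERIV g y :> G y) \<and> continuous_on U G"

text \<open>\<open>g\<close>, with gradient \<open>G\<close>, describes \<open>\<Omega>\<close> near its boundary point \<open>x\<close> as a sublevel set.\<close>

definition C1_defining_function ::
    "'a::euclidean_space set \<Rightarrow> 'a \<Rightarrow> 'a set \<Rightarrow> ('a \<Rightarrow> real) \<Rightarrow> ('a \<Rightarrow> 'a) \<Rightarrow> bool" where
  "C1_defining_function \<Omega> x U g G \<longleftrightarrow>
     x \<in> U \<and> C1_on U g G \<and> (\<forall>y\<in>U. G y \<noteq> 0) \<and>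
     \<Omega> \<inter> U = {y \<in> U. g y < 0} \<and> frontier \<Omega> \<inter> U = {y \<in> U. g y = 0}"

definition C1_boundary :: "'a::euclidean_space set \<Rightarrow> bool" where
  "C1_boundary \<Omega> \<longleftrightarrow> (\<forall>x\<in>frontier \<Omega>. \<exists>U g G. C1_defining_function \<Omega> x U g G)"

text \<open>The normalised gradient at \<open>x\<close> does not depend on the choice of defining function.\<close>

definition outer_normal :: "'a::euclidean_space set \<Rightarrow> 'a \<Rightarrow> 'a" where
  "outer_normal \<Omega> x = (THE v. \<exists>U g G. C1_defining_function \<Omega> x U g G \<and> v = sgn (G x))"

text \<open>Embedded \<open>k\<close>-dimensional \<open>C\<^sup>1\<close> submanifolds, as regular local zero sets.\<close>

definition C1_submanifold :: "nat \<Rightarrow> 'a::euclidean_space set \<Rightarrow> bool" where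
  "C1_submanifold k M \<longleftrightarrow> k \<le> DIM('a) \<and>
     (\<forall>x\<in>M. \<exists>U (g :: nat \<Rightarrow> 'a \<Rightarrow> real) G. open U \<and> x \<in> U \<and>
        (\<forall>i<DIM('a) - k. C1_on U (g i) (G i)) \<and>
        (\<forall>y\<in>U. inj_on (\<lambda>i. G i y) {..<DIM('a) - k} \<and>
                independent ((\<lambda>i. G i y) ` {..<DIM('a) - k})) \<and>
        M \<inter> U = {y \<in> U. \<forall>i<DIM('a) - k. g i y = 0})"

text \<open>
  A boundary is piecewise \<open>C\<^sup>1\<close> if it splits into finitely many connected embedded \<open>C\<^sup>1\<close>
  pieces: faces of dimension \<open>d - 1\<close>, whose union is dense in the boundary, and
  lower-dimensional ones (edges, corners).
\<close>

definition piecewise_C1_boundary :: "'a::euclidean_space set \<Rightarrow> bool" where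
  "piecewise_C1_boundary U \<longleftrightarrow>
     (\<exists>\<M> (k :: 'a set \<Rightarrow> nat). finite \<M> \<and> disjoint \<M> \<and>
        (\<forall>M\<in>\<M>. connected M \<and> k M < DIM('a) \<and> C1_submanifold (k M) M) \<and>
        frontier U = \<Union>\<M> \<and>
        frontier U = closure (\<Union>{M \<in> \<M>. k M = DIM('a) - 1}))"

definition Gamma_minus :: "'a::euclidean_space set \<Rightarrow> ('a \<times> 'a) set" where
  "Gamma_minus \<Omega> = {(x, \<xi>). x \<in> frontier \<Omega> \<and> \<xi> \<in> sphere 0 1 \<and> outer_normal \<Omega> x \<bullet> \<xi> < 0}"

definition Gamma_minus_dir :: "'a::euclidean_space set \<Rightarrow> 'a \<Rightarrow> 'a set" where
  "Gamma_minus_dir \<Omega> \<xi> = {x \<in> frontier \<Omega>. outer_normal \<Omega> x \<bullet> \<xi> < 0}"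

definition Gamma_minus_pt :: "'a::euclidean_space set \<Rightarrow> 'a \<Rightarrow> 'a set" where
  "Gamma_minus_pt \<Omega> x = {\<xi> \<in> sphere 0 1. outer_normal \<Omega> x \<bullet> \<xi> < 0}"

definition phase_domain :: "'a::euclidean_space set \<Rightarrow> ('a \<times> 'a) set" where
  "phase_domain \<Omega> = (\<Omega> \<times> sphere 0 1) \<union> Gamma_minus \<Omega>"

definition tau_plus :: "'a::euclidean_space set \<Rightarrow> 'a \<Rightarrow> 'a \<Rightarrow> real" where
  "tau_plus \<Omega> x \<xi> = Inf {t. t > 0 \<and> x + t *\<^sub>R \<xi> \<notin> \<Omega>}"

definition disc :: "'a::t2_space set \<Rightarrow> ('a \<Rightarrow> 'b::topological_space) \<Rightarrow> 'a set" where
  "disc A g = {z \<in> A. \<not> continuous (at z within A) g}"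

definition convex_C1_domain :: "'a::euclidean_space set \<Rightarrow> bool" where
  "convex_C1_domain \<Omega> \<longleftrightarrow>
     open \<Omega> \<and> \<Omega> \<noteq> {} \<and> bounded \<Omega> \<and> convex \<Omega> \<and> C1_boundary \<Omega>"

definition domain_decomposition ::
    "'a::euclidean_space set \<Rightarrow> nat \<Rightarrow> (nat \<Rightarrow> 'a set) \<Rightarrow> bool" where
  "domain_decomposition \<Omega> N \<Omega>s \<longleftrightarrow>
     N \<ge> 1 \<and> disjoint_family_on \<Omega>s {1..N} \<and>
     (\<forall>j\<in>{1..N}. open (\<Omega>s j) \<and> connected (\<Omega>s j) \<and> \<Omega>s j \<noteq> {} \<and> \<Omega>s j \<subseteq> \<Omega> \<and>
        piecewise_C1_boundary (\<Omega>s j)) \<and>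
     closure \<Omega> = (\<Union>j\<in>{1..N}. closure (\<Omega>s j))"

text \<open>
  For each \<open>(x, \<xi>)\<close> the data \<open>l x \<xi>\<close> and \<open>t x \<xi> 1, \<dots>, t x \<xi> (l x \<xi>)\<close> are uniquely determined by
  these conditions.
\<close>

definition generalized_convexity ::
    "'a::euclidean_space set \<Rightarrow> 'a set \<Rightarrow> ('a \<Rightarrow> 'a \<Rightarrow> nat) \<Rightarrow> ('a \<Rightarrow> 'a \<Rightarrow> nat \<Rightarrow> real) \<Rightarrow> bool" where
  "generalized_convexity \<Omega> \<Omega>0 l t \<longleftrightarrow>
     (\<forall>x\<in>\<Omega>. \<forall>\<xi>\<in>sphere 0 1.
        l x \<xi> \<ge> 1 \<and> t x \<xi> 0 = 0 \<and> 0 \<le> t x \<xi> 1 \<and>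
        strict_mono_on {1..l x \<xi>} (t x \<xi>) \<and>
        (\<forall>s\<ge>0. x - s *\<^sub>R \<xi> \<in> frontier \<Omega>0 \<longleftrightarrow> (\<exists>j\<in>{1..l x \<xi>}. s = t x \<xi> j))) \<and>
     (\<exists>L. \<forall>x\<in>\<Omega>. \<forall>\<xi>\<in>sphere 0 1. l x \<xi> \<le> L)"

definition admissible_coefficients ::
    "'a::euclidean_space set \<Rightarrow> ('a \<Rightarrow> real) \<Rightarrow> ('a \<Rightarrow> real) \<Rightarrow> bool" where
  "admissible_coefficients \<Omega>0 \<mu>t \<mu>s \<longleftrightarrow>
     (\<forall>x. \<mu>t x \<ge> 0 \<and> \<mu>s x \<ge> 0) \<and> bounded (range \<mu>t) \<and> bounded (range \<mu>s) \<and>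
     continuous_on \<Omega>0 \<mu>t \<and> continuous_on \<Omega>0 \<mu>s \<and>
     (\<forall>x\<in>\<Omega>0. \<mu>t x \<ge> \<mu>s x) \<and> (\<forall>x. x \<notin> \<Omega>0 \<longrightarrow> \<mu>t x = 0 \<and> \<mu>s x = 0)"

definition admissible_phase_function ::
    "'a::euclidean_space set \<Rightarrow> ('a \<Rightarrow> 'a \<Rightarrow> 'a \<Rightarrow> real) \<Rightarrow> bool" where
  "admissible_phase_function \<Omega>0 p \<longleftrightarrow>
     (\<forall>x. \<forall>\<xi>\<in>sphere 0 1. \<forall>\<xi>'\<in>sphere 0 1. p x \<xi> \<xi>' \<ge> 0) \<and>
     (\<exists>B. \<forall>x. \<forall>\<xi>\<in>sphere 0 1. \<forall>\<xi>'\<in>sphere 0 1. p x \<xi> \<xi>' \<le> B) \<and>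
     continuous_on (\<Omega>0 \<times> sphere 0 1 \<times> sphere 0 1) (\<lambda>(x, \<xi>, \<xi>'). p x \<xi> \<xi>') \<and>
     (\<forall>x. x \<notin> \<Omega>0 \<longrightarrow> (\<forall>\<xi>\<in>sphere 0 1. \<forall>\<xi>'\<in>sphere 0 1. p x \<xi> \<xi>' = 0)) \<and>
     (\<forall>x\<in>\<Omega>0. \<forall>\<xi>\<in>sphere 0 1. (LINT \<xi>':sphere 0 1|surface_measure. p x \<xi> \<xi>') = 1)"

definition along :: "('a::euclidean_space \<times> 'a \<Rightarrow> real) \<Rightarrow> 'a \<Rightarrow> 'a \<Rightarrow> real \<Rightarrow> real" where
  "along f x \<xi> = (\<lambda>s. f (x + s *\<^sub>R \<xi>, \<xi>))"

definition dir_deriv :: "('a::euclidean_space \<times> 'a \<Rightarrow> real) \<Rightarrow> 'a \<Rightarrow> 'a \<Rightarrow> real" where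
  "dir_deriv f x \<xi> = deriv (along f x \<xi>) 0"

text \<open>Only the values of \<open>f\<close> on \<^term>\<open>phase_domain \<Omega>\<close> matter.\<close>

definition is_solution ::
    "'a::euclidean_space set \<Rightarrow> 'a set \<Rightarrow> ('a \<Rightarrow> 'a \<Rightarrow> nat) \<Rightarrow> ('a \<Rightarrow> 'a \<Rightarrow> nat \<Rightarrow> real) \<Rightarrow>
     ('a \<Rightarrow> real) \<Rightarrow> ('a \<Rightarrow> real) \<Rightarrow> ('a \<Rightarrow> 'a \<Rightarrow> 'a \<Rightarrow> real) \<Rightarrow>
     ('a \<times> 'a \<Rightarrow> real) \<Rightarrow> ('a \<times> 'a \<Rightarrow> real) \<Rightarrow> bool" where
  "is_solution \<Omega> \<Omega>0 l t \<mu>t \<mu>s p f0 f \<longleftrightarrow>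
     bounded (f ` phase_domain \<Omega>) \<and>
     (\<forall>x\<in>\<Omega>0. \<forall>\<xi>\<in>sphere 0 1.
        set_integrable surface_measure (sphere 0 1) (\<lambda>\<xi>'. p x \<xi> \<xi>' * f (x, \<xi>'))) \<and>
     (\<forall>x\<in>\<Omega>0. \<forall>\<xi>\<in>sphere 0 1. along f x \<xi> field_differentiable at 0) \<and>
     (\<forall>x\<in>\<Omega>0. \<forall>\<xi>\<in>sphere 0 1.
        dir_deriv f x \<xi> + \<mu>t x * f (x, \<xi>) =
          \<mu>s x * (LINT \<xi>':sphere 0 1|surface_measure. p x \<xi> \<xi>' * f (x, \<xi>'))) \<and>
     (\<forall>z\<in>Gamma_minus \<Omega>. f z = f0 z) \<and>
     (\<forall>(x, \<xi>)\<in>phase_domain \<Omega>.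
        continuous_on ({x + s *\<^sub>R \<xi> | s. True} \<inter> (\<Omega> \<union> Gamma_minus_dir \<Omega> \<xi>)) (\<lambda>y. f (y, \<xi>))) \<and>
     (\<forall>x\<in>\<Omega>0. \<forall>\<xi>\<in>sphere 0 1. \<forall>j\<in>{1..l x \<xi>}.
        continuous_on {x - s *\<^sub>R \<xi> | s. s \<in> {t x \<xi> (j - 1)<..<t x \<xi> j}} (\<lambda>y. dir_deriv f y \<xi>))"

end

(*
  After division by exp (- B), where B is the optical depth along characteristics, a solution is the
  transported boundary value plus a line integral of the scattering term, and the scattering operator
  composed with this integration is a strict contraction (factor q = 1 - exp (- M R), where \<mu>s \<le> \<mu>t \<le> M and R is the
  diameter of \<Omega>).  The line integral of a
  function that is continuous on \<Omega>0 \<times> sphere is continuous on the whole phase domain, because a ray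
  meets the interfaces in finitely many points.  So every discontinuity comes from the
  transported boundary value, provided that averaging over directions makes the latter continuous.

  For data continuous in x this is dominated convergence.  For data continuous in \<xi> the average is
  rewritten in the boundary point; instead of computing the Jacobian of the change of variables we use
  that moving the viewpoint from x to x' changes directions by a bi-Lipschitz map of the sphere with
  constant close to 1, hence changes Hausdorff measure by a factor close to 1.
*)
theory Submission
  imports Defs
begin

section \<open>Hausdorff measure\<close>

text \<open>The part of \<open>f\<close> that may jump, \<open>exp (- B)\<close> times the
  transported datum, is fixed by \<open>f0\<close>. The iteration therefore runs over bounded
  continuous corrections only, and the discontinuity set can be read off at the end, since
  \<open>exp (- B)\<close> never vanishes. Pure scattering, \<mu>s = \<mu>t, is allowed, so
  strictness of the contraction cannot come from absorption. It comes from the bounded chords: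
  \<mu>t times the attenuation integrates along a ray to \<open>1 - exp (- depth)\<close>. A
  competing solution is known only through its derivative along rays off the interfaces; the
  estimate is hence a differential inequality, which serves existence and uniqueness alike. The
  obstacle for data continuous in the direction: for fixed \<open>a\<close>, replacing
  \<open>x\<close> by \<open>x'\<close> moves the entry point, and nothing is known about
  \<open>f0\<close> in that variable. The direction \<open>sgn (x' - \<pi> x a)\<close> keeps the
  entry point and moves only the direction. Exceptional boundary points do no harm, because
  \<open>y \<mapsto> sgn (x - y)\<close> is Lipschitz on the boundary and carries null sets to null
  sets.\<close>

lemma hausdorff_pre_mono:
  "A \<subseteq> B \<Longrightarrow> hausdorff_pre m \<delta> A \<le> hausdorff_pre m \<delta> B"
  unfolding hausdorff_pre_def by (intro INF_superset_mono) auto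

lemma hausdorff_pre_antimono:
  "\<delta> \<le> \<delta>' \<Longrightarrow> hausdorff_pre m \<delta>' A \<le> hausdorff_pre m \<delta> A"
  unfolding hausdorff_pre_def by (intro INF_superset_mono) (auto intro: order_trans)

lemma hausdorff_pre_le:
  assumes "A \<subseteq> (\<Union>i. C i)" "\<And>i. bounded (C i)" "\<And>i. diameter (C i) \<le> \<delta>"
  shows "hausdorff_pre m \<delta> A \<le> (\<Sum>i. ennreal (unit_ball_vol (real m) * (diameter (C i) / 2) ^ m))"
  unfolding hausdorff_pre_def using assms by (intro INF_lower) auto

lemma hausdorff_pre_empty:
  assumes "0 < m" "0 \<le> \<delta>"
  shows "hausdorff_pre m \<delta> ({} :: 'a::metric_space set) = 0"
proof -
  have "hausdorff_pre m \<delta> ({} :: 'a set) \<le> (\<Sum>i::nat. ennreal (unit_ball_vol (real m) * (diameter ({}::'a set) / 2) ^ m))"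
    by (rule hausdorff_pre_le) (use assms in auto)
  also have "\<dots> = 0" using assms by (simp add: power_0_left)
  finally show ?thesis by simp
qed

text \<open>Covers of the \<open>A n\<close> that are optimal up to \<open>e / 2 ^ Suc n\<close> are
  interleaved into one sequence by \<open>prod_decode\<close>; the errors add up to
  \<open>e\<close>.\<close>

lemma hausdorff_pre_UN_le:
  "hausdorff_pre m \<delta> (\<Union>i. A i) \<le> (\<Sum>i. hausdorff_pre m \<delta> (A i))"
proof (rule ennreal_le_epsilon)
  fix e :: real assume "0 < e" and fin: "(\<Sum>i. hausdorff_pre m \<delta> (A i)) < top"
  let ?g = "\<lambda>B :: 'a set. ennreal (unit_ball_vol (real m) * (diameter B / 2) ^ m)"
  have "\<exists>C. A n \<subseteq> (\<Union>i. C i) \<and> (\<forall>i. bounded (C i) \<and> diameter (C i) \<le> \<delta>) \<and>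
        (\<Sum>i. ?g (C i)) \<le> hausdorff_pre m \<delta> (A n) + ennreal (e * (1/2) ^ Suc n)" for n
  proof -
    have "hausdorff_pre m \<delta> (A n) < hausdorff_pre m \<delta> (A n) + ennreal (e * (1/2) ^ Suc n)"
      using \<open>0 < e\<close> ennreal_suminf_lessD[OF fin, of n]
      by (simp add: ennreal_zero_less_mult_iff less_top)
    then show ?thesis
      unfolding hausdorff_pre_def[of m \<delta> "A n"] INF_less_iff by (auto intro: less_imp_le)
  qed
  then obtain C where C: "\<And>n. A n \<subseteq> (\<Union>i. C n i)" "\<And>n i. bounded (C n i)" "\<And>n i. diameter (C n i) \<le> \<delta>"
     "\<And>n. (\<Sum>i. ?g (C n i)) \<le> hausdorff_pre m \<delta> (A n) + ennreal (e * (1/2) ^ Suc n)"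
    by metis
  define D where "D = (\<lambda>k. case_prod C (prod_decode k))"
  have "(\<Union>i. A i) \<subseteq> (\<Union>k. D k)"
  proof
    fix x assume "x \<in> (\<Union>i. A i)"
    then obtain n i where "x \<in> C n i" using C(1) by blast
    then have "x \<in> D (prod_encode (n, i))" by (simp add: D_def)
    then show "x \<in> (\<Union>k. D k)" by blast
  qed
  then have "hausdorff_pre m \<delta> (\<Union>i. A i) \<le> (\<Sum>k. ?g (D k))"
    by (rule hausdorff_pre_le) (auto simp: D_def C split: prod.split)
  also have "\<dots> = (\<Sum>n. \<Sum>i. ?g (C n i))"
    using suminf_ennreal_2dimen[of "\<lambda>n. \<Sum>i. ?g (C n i)" "\<lambda>p. ?g (C (fst p) (snd p))"]
    by (simp add: comp_def D_def case_prod_beta)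
  also have "\<dots> \<le> (\<Sum>n. hausdorff_pre m \<delta> (A n) + ennreal (e * (1/2) ^ Suc n))"
    by (intro suminf_le C) auto
  also have "\<dots> = (\<Sum>n. hausdorff_pre m \<delta> (A n)) + (\<Sum>n. ennreal (e * (1/2) ^ Suc n))"
    by (rule suminf_add[symmetric]) auto
  also have "(\<Sum>n. ennreal (e * (1/2) ^ Suc n)) = ennreal e"
    using \<open>0 < e\<close> power_half_series[THEN sums_mult[of _ _ e]]
    by (intro suminf_ennreal_eq) auto
  finally show "hausdorff_pre m \<delta> (\<Union>i. A i) \<le> (\<Sum>i. hausdorff_pre m \<delta> (A i)) + ennreal e" .
qed

lemma hausdorff_pre_le_outer: "0 < \<delta> \<Longrightarrow> hausdorff_pre m \<delta> A \<le> hausdorff_outer m A"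
  unfolding hausdorff_outer_def by (rule SUP_upper) simp

lemma hausdorff_outer_mono: "A \<subseteq> B \<Longrightarrow> hausdorff_outer m A \<le> hausdorff_outer m B"
  unfolding hausdorff_outer_def by (intro SUP_mono') (rule hausdorff_pre_mono)

lemma hausdorff_outer_empty: "0 < m \<Longrightarrow> hausdorff_outer m {} = 0"
  unfolding hausdorff_outer_def by (intro SUP_eq_const) (simp_all add: hausdorff_pre_empty)

lemma hausdorff_outer_UN_le:
  "hausdorff_outer m (\<Union>i. A i) \<le> (\<Sum>i. hausdorff_outer m (A i))"
  unfolding hausdorff_outer_def[of m "\<Union>i. A i"]
proof (rule SUP_least)
  fix \<delta> :: real assume "\<delta> \<in> {0<..}"
  then show "hausdorff_pre m \<delta> (\<Union>i. A i) \<le> (\<Sum>i. hausdorff_outer m (A i))"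
    using hausdorff_pre_UN_le[of m \<delta> A] suminf_le[of "\<lambda>i. hausdorff_pre m \<delta> (A i)" "\<lambda>i. hausdorff_outer m (A i)"]
      hausdorff_pre_le_outer[of \<delta> m] by (auto intro: order_trans)
qed

lemma hausdorff_outer_Un_le:
  assumes "0 < m"
  shows "hausdorff_outer m (A \<union> B) \<le> hausdorff_outer m A + hausdorff_outer m B"
proof -
  have "hausdorff_outer m (\<Union>i. binaryset A B i) \<le> (\<Sum>i. hausdorff_outer m (binaryset A B i))"
    by (rule hausdorff_outer_UN_le)
  then show ?thesis
    using suminf_binaryset_eq[of "hausdorff_outer m" A B, OF hausdorff_outer_empty[OF assms]]
    by (simp add: UN_binaryset_eq)
qed

section \<open>Outer measure axioms, additivity on separated sets, Caratheodory's criterion\<close>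

lemma outer_measure_space_hausdorff:
  assumes "0 < m"
  shows "outer_measure_space (Pow UNIV) (hausdorff_outer m)"
  unfolding outer_measure_space_def positive_def increasing_def countably_subadditive_def
  using hausdorff_outer_mono hausdorff_outer_empty[OF assms] hausdorff_outer_UN_le by auto

text \<open>A set of diameter less than \<open>e\<close> meets at most one of \<open>A\<close> and
  \<open>B\<close>, so a fine cover of the union splits into a cover of \<open>A\<close> and a cover
  of \<open>B\<close> that share no member.\<close>

lemma hausdorff_outer_separated:
  fixes A B :: "'a::metric_space set"
  assumes m: "0 < m" and "0 < e" and sep: "\<And>x y. x \<in> A \<Longrightarrow> y \<in> B \<Longrightarrow> e \<le> dist x y"
  shows "hausdorff_outer m A + hausdorff_outer m B \<le> hausdorff_outer m (A \<union> B)"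
proof -
  let ?g = "\<lambda>B :: 'a set. ennreal (unit_ball_vol (real m) * (diameter B / 2) ^ m)"
  have split: "hausdorff_pre m \<delta> A + hausdorff_pre m \<delta> B \<le> hausdorff_pre m \<delta> (A \<union> B)"
    if \<delta>: "0 < \<delta>" "\<delta> < e" for \<delta>
    unfolding hausdorff_pre_def[of m \<delta> "A \<union> B"]
  proof (rule INF_greatest, safe)
    fix C :: "nat \<Rightarrow> 'a set"
    assume cov: "A \<union> B \<subseteq> (\<Union>i. C i)" and C: "\<forall>i. bounded (C i) \<and> diameter (C i) \<le> \<delta>"
    \<comment> \<open>Members that miss \<open>X\<close> are replaced by the empty set, which keeps
      the index set and contributes \<open>0 ^ m = 0\<close> because \<open>0 < m\<close>.\<close>
    let ?S = "\<lambda>X i. if C i \<inter> X = {} then {} else C i"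
    have cover: "X \<subseteq> (\<Union>i. ?S X i)" if "X \<subseteq> A \<union> B" for X
    proof
      fix x assume "x \<in> X"
      then obtain i where "x \<in> C i" using cov \<open>X \<subseteq> A \<union> B\<close> by blast
      then have "x \<in> ?S X i" using \<open>x \<in> X\<close> by auto
      then show "x \<in> (\<Union>i. ?S X i)" by blast
    qed
    have "hausdorff_pre m \<delta> A \<le> (\<Sum>i. ?g (?S A i))"
      by (rule hausdorff_pre_le[OF cover]) (use cov C \<delta> in auto)
    moreover have "hausdorff_pre m \<delta> B \<le> (\<Sum>i. ?g (?S B i))"
      by (rule hausdorff_pre_le[OF cover]) (use cov C \<delta> in auto)
    ultimately have "hausdorff_pre m \<delta> A + hausdorff_pre m \<delta> B \<le> (\<Sum>i. ?g (?S A i)) + (\<Sum>i. ?g (?S B i))"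
      by (rule add_mono)
    also have "\<dots> = (\<Sum>i. ?g (?S A i) + ?g (?S B i))" by (rule suminf_add) auto
    also have "\<dots> \<le> (\<Sum>i. ?g (C i))"
    proof (rule suminf_le)
      fix i
      have "C i \<inter> A = {} \<or> C i \<inter> B = {}"
      proof (rule ccontr)
        assume "\<not> ?thesis"
        then obtain x y where "x \<in> C i" "x \<in> A" "y \<in> C i" "y \<in> B" by blast
        then have "e \<le> dist x y" "dist x y \<le> diameter (C i)" "diameter (C i) \<le> \<delta>"
          using sep[of x y] diameter_bounded_bound[of "C i" x y] C by auto
        then show False using \<delta> by linarith
      qed
      then show "?g (?S A i) + ?g (?S B i) \<le> ?g (C i)" using m by (auto simp: power_0_left)
    qed auto
    finally show "hausdorff_pre m \<delta> A + hausdorff_pre m \<delta> B \<le> (\<Sum>i. ?g (C i))" .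
  qed
  \<comment> \<open>Two independent sizes \<open>a\<close> and \<open>b\<close> allow the suprema
    over the sizes to be taken one after the other; shrinking both to a common \<delta> below
    \<open>e\<close> only increases the left-hand side.\<close>
  have pre: "hausdorff_pre m a A + hausdorff_pre m b B \<le> hausdorff_outer m (A \<union> B)"
    if "0 < a" "0 < b" for a b
  proof -
    define \<delta> where "\<delta> = min (min a b) (e / 2)"
    have "0 < \<delta>" "\<delta> < e" "\<delta> \<le> a" "\<delta> \<le> b" using that \<open>0 < e\<close> by (auto simp: \<delta>_def)
    then have "hausdorff_pre m a A + hausdorff_pre m b B \<le> hausdorff_pre m \<delta> A + hausdorff_pre m \<delta> B"
      by (intro add_mono hausdorff_pre_antimono)
    also have "\<dots> \<le> hausdorff_pre m \<delta> (A \<union> B)" by (rule split) fact+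
    also have "\<dots> \<le> hausdorff_outer m (A \<union> B)" by (rule hausdorff_pre_le_outer) fact
    finally show ?thesis .
  qed
  have "hausdorff_outer m A + hausdorff_pre m b B \<le> hausdorff_outer m (A \<union> B)" if "0 < b" for b
    unfolding hausdorff_outer_def[of m A]
    by (subst ennreal_SUP_add_left[symmetric]) (use pre that in \<open>auto intro!: SUP_least\<close>)
  then show ?thesis
    unfolding hausdorff_outer_def[of m B]
    by (subst ennreal_SUP_add_right) (auto intro!: SUP_least)
qed

text \<open>\<open>T k\<close> is a layer \<open>a k \<le> d x < b k\<close>, and the layers move
  towards smaller \<open>d\<close>. The gap between \<open>b n\<close> and \<open>a (n - 1)\<close>
  separates the \<open>n\<close>th layer from all earlier ones at once, so additivity on separated
  sets can be iterated.\<close>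

lemma hausdorff_outer_sum_separated:
  fixes T :: "nat \<Rightarrow> 'a::metric_space set" and d :: "'a \<Rightarrow> real"
  assumes m: "0 < m"
    and lip: "\<And>x y. \<bar>d x - d y\<bar> \<le> dist x y"
    and T: "\<And>k x. x \<in> T k \<Longrightarrow> a k \<le> d x" "\<And>k x. x \<in> T k \<Longrightarrow> d x < b k"
    and ab: "\<And>k. b (Suc k) < a k" and dec: "decseq a"
  shows "(\<Sum>k<n. hausdorff_outer m (T k)) \<le> hausdorff_outer m (\<Union>k<n. T k)"
proof (induction n)
  case 0
  then show ?case by simp
next
  case (Suc n)
  have "hausdorff_outer m (\<Union>k<n. T k) + hausdorff_outer m (T n) \<le> hausdorff_outer m ((\<Union>k<n. T k) \<union> T n)"
  proof (cases n)
    case 0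
    then show ?thesis by (simp add: hausdorff_outer_empty[OF m])
  next
    case (Suc n')
    show ?thesis
    proof (rule hausdorff_outer_separated[OF m, of "a n' - b n"])
      fix x y assume "x \<in> (\<Union>k<n. T k)" "y \<in> T n"
      then obtain k where "k < n" "x \<in> T k" by auto
      then have "a n' \<le> d x" using T(1)[of x k] decseqD[OF dec, of k n'] Suc by auto
      moreover have "d y < b n" using T \<open>y \<in> T n\<close> by auto
      ultimately show "a n' - b n \<le> dist x y" using lip[of x y] by linarith
    qed (use ab Suc in auto)
  qed
  also have "(\<Union>k<n. T k) \<union> T n = (\<Union>k<Suc n. T k)" by (auto simp: less_Suc_eq)
  finally have "hausdorff_outer m (\<Union>k<n. T k) + hausdorff_outer m (T n) \<le> hausdorff_outer m (\<Union>k<Suc n. T k)" .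
  with add_right_mono[OF Suc.IH] show ?case unfolding sum.lessThan_Suc by (rule order_trans)
qed

text \<open>Caratheodory's criterion: the shells \<open>R k\<close> around a closed set have summable outer measure,
  since every second one is separated from the previous ones.\<close>

lemma closed_in_hausdorff_lambda_system:
  fixes F :: "'a::metric_space set"
  assumes m: "0 < m" and F: "closed F"
  shows "F \<in> lambda_system UNIV (Pow UNIV) (hausdorff_outer m)"
proof -
  let ?H = "hausdorff_outer m"
  interpret algebra UNIV "Pow UNIV :: 'a set set" by (rule algebra_Pow)
  have le: "?H (A \<inter> F) + ?H (A - F) \<le> ?H A" if fin: "?H A \<noteq> top" and ne: "F \<noteq> {}" for A
  proof -
    define d where "d x = infdist x F" for x
    have lip: "\<bar>d x - d y\<bar> \<le> dist x y" for x y
      using infdist_triangle[of x F y] infdist_triangle[of y F x] by (simp add: d_def dist_commute abs_le_iff)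
    define R where "R k = {x\<in>A. 1 / (real k + 2) \<le> d x \<and> d x < 1 / (real k + 1)}" for k
    define An where "An n = {x\<in>A. 1 / (real n + 1) \<le> d x}" for n
    have RA: "?H (\<Union>k\<in>I. R k) \<le> ?H A" for I by (rule hausdorff_outer_mono) (auto simp: R_def)
    \<comment> \<open>Consecutive shells touch, but shells two apart do not:
      \<open>1 / (2 k + 3) < 1 / (2 k + 2)\<close>. Hence even and odd indices are summed
      separately.\<close>
    have even: "(\<Sum>k<n. ?H (R (2 * k))) \<le> ?H A" for n
      by (rule order_trans[OF hausdorff_outer_sum_separated[OF m lip, of _ "\<lambda>k. 1 / (real (2*k) + 2)" "\<lambda>k. 1 / (real (2*k) + 1)"]])
         (auto simp: R_def decseq_def field_simps intro!: hausdorff_outer_mono)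
    have odd: "(\<Sum>k<n. ?H (R (2 * k + 1))) \<le> ?H A" for n
      by (rule order_trans[OF hausdorff_outer_sum_separated[OF m lip, of _ "\<lambda>k. 1 / (real (2*k+1) + 2)" "\<lambda>k. 1 / (real (2*k+1) + 1)"]])
         (auto simp: R_def decseq_def field_simps intro!: hausdorff_outer_mono)
    have "(\<Sum>k<2*n. ?H (R k)) = (\<Sum>k<n. ?H (R (2 * k))) + (\<Sum>k<n. ?H (R (2 * k + 1)))" for n
      by (induction n) (auto simp: algebra_simps)
    then have two: "(\<Sum>k<2*n. ?H (R k)) \<le> 2 * ?H A" for n
      using add_mono[OF even[of n] odd[of n]] by (simp add: mult_2)
    have "(\<Sum>k<n. ?H (R k)) \<le> 2 * ?H A" for n
      by (rule order_trans[OF sum_mono2 two[of n]]) auto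
    then have "(\<Sum>k. ?H (R k)) \<le> 2 * ?H A" by (intro suminf_le_const) auto
    then have S: "(\<Sum>k. ?H (R k)) \<noteq> top" using fin
      by (auto simp: top_unique ennreal_mult_eq_top_iff)
    have tail: "(\<lambda>n. \<Sum>k. ?H (R (k + n))) \<longlonglongrightarrow> 0"
    proof -
      have "(\<lambda>n. (\<Sum>k. ?H (R k)) - (\<Sum>k<n. ?H (R k))) \<longlonglongrightarrow> (\<Sum>k. ?H (R k)) - (\<Sum>k. ?H (R k))"
        using S by (intro tendsto_diff_ennreal summable_LIMSEQ tendsto_const) auto
      moreover have "(\<Sum>k. ?H (R k)) - (\<Sum>k<n. ?H (R k)) = (\<Sum>k. ?H (R (k + n)))" for n
      proof -
        have "(\<Sum>k. ?H (R k)) = (\<Sum>k. ?H (R (k + n))) + (\<Sum>k<n. ?H (R k))"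
          by (rule suminf_offset) simp
        moreover have "(\<Sum>k<n. ?H (R k)) \<noteq> top"
          using S calculation by (simp add: ennreal_add_eq_top)
        ultimately show ?thesis by simp
      qed
      ultimately show ?thesis using S by (simp add: less_top)
    qed
    \<comment> \<open>\<open>An n\<close> has distance at least \<open>1 / (n + 1)\<close> from
      \<open>F\<close>, so it is additive with \<open>A \<inter> F\<close>; what it misses of
      \<open>A - F\<close> lies in the shells from index \<open>n\<close> on, whose total tends to
      0.\<close>
    have main: "?H (A \<inter> F) + ?H (A - F) \<le> ?H A + (\<Sum>k. ?H (R (k + n)))" for n
    proof -
      have sub: "A - F \<subseteq> An n \<union> (\<Union>k. R (k + n))"
      proof
        fix x assume x: "x \<in> A - F"
        then have "0 < d x" unfolding d_def using F ne by (simp add: infdist_pos_not_in_closed)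
        show "x \<in> An n \<union> (\<Union>k. R (k + n))"
        proof (cases "1 / (real n + 1) \<le> d x")
          case True
          then show ?thesis using x by (simp add: An_def)
        next
          case False
          define P where "P k \<longleftrightarrow> 1 / (real (k + n) + 2) \<le> d x" for k
          obtain j where j: "1 / real (Suc j) < d x" using \<open>0 < d x\<close> nat_approx_posE by blast
          have "1 / (real (j + n) + 2) \<le> 1 / real (Suc j)" by (simp add: field_simps)
          then have "P j" using j by (simp add: P_def)
          define k where "k = (LEAST k. P k)"
          have "P k" unfolding k_def using \<open>P j\<close> by (rule LeastI)
          have "d x < 1 / (real (k + n) + 1)"
          proof (cases k)
            case 0
            then show ?thesis using False by simp
          next
            case (Suc i)
            then have "\<not> P i" using not_less_Least[of i P] by (simp add: k_def)
            then show ?thesis using Suc by (simp add: P_def algebra_simps)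
          qed
          then have "x \<in> R (k + n)" using \<open>P k\<close> x by (simp add: R_def P_def)
          then show ?thesis by blast
        qed
      qed
      have "?H (A - F) \<le> ?H (An n \<union> (\<Union>k. R (k + n)))"
        using sub by (rule hausdorff_outer_mono)
      also have "\<dots> \<le> ?H (An n) + ?H (\<Union>k. R (k + n))"
        by (rule hausdorff_outer_Un_le[OF m])
      also have "\<dots> \<le> ?H (An n) + (\<Sum>k. ?H (R (k + n)))"
        by (intro add_left_mono hausdorff_outer_UN_le)
      finally have 1: "?H (A - F) \<le> ?H (An n) + (\<Sum>k. ?H (R (k + n)))" .
      have "?H (A \<inter> F) + ?H (An n) \<le> ?H (A \<inter> F \<union> An n)"
      proof (rule hausdorff_outer_separated[OF m, of "1 / (real n + 1)"])
        fix x y assume "x \<in> A \<inter> F" "y \<in> An n"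
        then show "1 / (real n + 1) \<le> dist x y"
          using lip[of x y] by (auto simp: An_def d_def)
      qed simp
      also have "\<dots> \<le> ?H A" by (rule hausdorff_outer_mono) (auto simp: An_def)
      finally show ?thesis
        using add_left_mono[OF 1, of "?H (A \<inter> F)"] by (simp only: add.assoc[symmetric]) (blast intro: order_trans add_right_mono)
    qed
    have "(\<lambda>n. ?H A + (\<Sum>k. ?H (R (k + n)))) \<longlonglongrightarrow> ?H A + 0"
      by (intro tendsto_add tail tendsto_const)
    then show ?thesis using main by (intro LIMSEQ_le_const) auto
  qed
  have "?H (A \<inter> F) + ?H (A - F) = ?H A" for A
  proof (rule antisym)
    show "?H (A \<inter> F) + ?H (A - F) \<le> ?H A"
      using le[of A] by (cases "F = {}"; cases "?H A = top") (auto simp: hausdorff_outer_empty[OF m])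
    show "?H A \<le> ?H (A \<inter> F) + ?H (A - F)"
      using hausdorff_outer_Un_le[OF m, of "A \<inter> F" "A - F"] by (simp add: Int_Diff_Un)
  qed
  then show ?thesis unfolding lambda_system_eq by simp
qed

section \<open>The Hausdorff measure: Borel sets, null sets, Lipschitz images\<close>

lemma measure_space_hausdorff:
  "0 < m \<Longrightarrow> measure_space UNIV (lambda_system UNIV (Pow UNIV) (hausdorff_outer m)) (hausdorff_outer m)"
  by (rule sigma_algebra.caratheodory_lemma[OF sigma_algebra_Pow outer_measure_space_hausdorff])

lemma sets_hausdorff_measure:
  assumes "0 < m"
  shows "sets (hausdorff_measure m) = lambda_system UNIV (Pow UNIV) (hausdorff_outer m)"
  unfolding hausdorff_measure_def
  using measure_space_hausdorff[OF assms] unfolding measure_space_def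
  by (intro sigma_algebra.sets_measure_of_eq) blast

lemma space_hausdorff_measure [simp]: "space (hausdorff_measure m) = UNIV"
  unfolding hausdorff_measure_def by (simp add: space_measure_of_conv)

lemma emeasure_hausdorff_measure:
  assumes "0 < m" "A \<in> sets (hausdorff_measure m)"
  shows "emeasure (hausdorff_measure m) A = hausdorff_outer m A"
  using measure_space_hausdorff[OF assms(1)] assms(2)
  unfolding sets_hausdorff_measure[OF assms(1)]
  unfolding hausdorff_measure_def measure_space_def
  by (intro emeasure_measure_of_sigma) auto

lemma borel_subset_hausdorff:
  assumes "0 < m"
  shows "sets borel \<subseteq> sets (hausdorff_measure m :: 'a::metric_space measure)"
proof -
  have "sigma_sets (space (hausdorff_measure m :: 'a measure)) (Collect closed) \<subseteq> sets (hausdorff_measure m :: 'a measure)"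
    by (rule sets.sigma_sets_subset)
       (use closed_in_hausdorff_lambda_system[OF assms] in \<open>auto simp: sets_hausdorff_measure[OF assms]\<close>)
  then show ?thesis by (simp add: borel_eq_closed)
qed

text \<open>Passing to closures changes no diameter. \<open>e k\<close> bounds both the mesh and the
  total content of the \<open>k\<close>th cover, so the intersection of the unions of closures is
  Borel and still null. This is how null sets of unknown measurability, such as Lipschitz images of
  null sets, become negligible for a Borel measure.\<close>

lemma hausdorff_null_borel_cover:
  fixes A :: "'a::metric_space set"
  assumes A: "hausdorff_outer m A = 0"
  obtains G where "G \<in> sets borel" "A \<subseteq> G" "hausdorff_outer m G = 0"
proof -
  let ?g = "\<lambda>B :: 'a set. ennreal (unit_ball_vol (real m) * (diameter B / 2) ^ m)"
  define e where "e k = 1 / real (Suc k)" for k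
  have e: "0 < e k" for k by (simp add: e_def)
  have "\<exists>C. A \<subseteq> (\<Union>i. C i) \<and> (\<forall>i. bounded (C i) \<and> diameter (C i) \<le> e k) \<and> (\<Sum>i. ?g (C i)) \<le> ennreal (e k)" for k
  proof -
    have "hausdorff_pre m (e k) A < ennreal (e k)"
      using hausdorff_pre_le_outer[OF e, of m k A] e[of k] A by simp
    then show ?thesis
      unfolding hausdorff_pre_def INF_less_iff by (auto intro: less_imp_le)
  qed
  then obtain C where C: "\<And>k. A \<subseteq> (\<Union>i. C k i)" "\<And>k i. bounded (C k i)" "\<And>k i. diameter (C k i) \<le> e k"
    "\<And>k. (\<Sum>i. ?g (C k i)) \<le> ennreal (e k)"
    by metis
  define G where "G = (\<Inter>k. \<Union>i. closure (C k i))"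
  have small: "hausdorff_pre m (e k) G \<le> ennreal (e k)" for k
  proof -
    have "hausdorff_pre m (e k) G \<le> (\<Sum>i. ?g (closure (C k i)))"
      by (rule hausdorff_pre_le) (use C in \<open>auto simp: G_def diameter_closure\<close>)
    also have "\<dots> \<le> ennreal (e k)" using C(2,4) by (simp add: diameter_closure)
    finally show ?thesis .
  qed
  have "hausdorff_pre m \<delta> G = 0" if \<delta>: "0 < \<delta>" for \<delta>
  proof -
    have lim: "(\<lambda>k. ennreal (e k)) \<longlonglongrightarrow> 0"
      using tendsto_ennrealI[OF LIMSEQ_inverse_real_of_nat] by (simp add: e_def inverse_eq_divide)
    have "eventually (\<lambda>k. e k < \<delta>) sequentially"
      using order_tendstoD(2)[OF LIMSEQ_inverse_real_of_nat \<delta>] by (simp add: e_def inverse_eq_divide)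
    then have "eventually (\<lambda>k. hausdorff_pre m \<delta> G \<le> ennreal (e k)) sequentially"
      by eventually_elim (meson hausdorff_pre_antimono less_imp_le order_trans small)
    then have "hausdorff_pre m \<delta> G \<le> 0" by (intro tendsto_lowerbound[OF lim]) simp_all
    then show ?thesis by simp
  qed
  then have "hausdorff_outer m G = 0"
    unfolding hausdorff_outer_def by (intro SUP_eq_const) auto
  moreover have "G \<in> sets borel" unfolding G_def by (intro sets.countable_INT sets.countable_UN) auto
  moreover have "A \<subseteq> G"
    unfolding G_def
  proof (intro INT_greatest)
    fix k
    have "(\<Union>i. C k i) \<subseteq> (\<Union>i. closure (C k i))" by (intro UN_mono closure_subset) simp
    then show "A \<subseteq> (\<Union>i. closure (C k i))" using C(1)[of k] by (rule order_trans[rotated])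
  qed
  ultimately show thesis using that by blast
qed

lemma diameter_le_dist:
  assumes "\<And>x y. x \<in> S \<Longrightarrow> y \<in> S \<Longrightarrow> dist x y \<le> d" "0 \<le> d"
  shows "diameter S \<le> d"
  using assms unfolding diameter_def by (auto intro!: cSUP_least)

text \<open>A cover of \<open>A\<close> of mesh \<open>\<delta> / L\<close>, cut down to
  \<open>A\<close> where the Lipschitz bound is available, is mapped to a cover of the image of mesh
  \<delta>, and each term grows by at most the factor \<open>L ^ m\<close>.\<close>

lemma hausdorff_outer_lipschitz_image:
  fixes f :: "'a::metric_space \<Rightarrow> 'b::metric_space"
  assumes m: "0 < m" and L: "0 < L" and lip: "\<And>x y. x \<in> A \<Longrightarrow> y \<in> A \<Longrightarrow> dist (f x) (f y) \<le> L * dist x y"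
  shows "hausdorff_outer m (f ` A) \<le> ennreal (L ^ m) * hausdorff_outer m A"
proof -
  have "hausdorff_pre m \<delta> (f ` A) \<le> ennreal (L ^ m) * hausdorff_pre m (\<delta> / L) A" if "0 < \<delta>" for \<delta>
  proof -
    have "hausdorff_pre m \<delta> (f ` A)
        \<le> ennreal (L ^ m) * (\<Sum>i. ennreal (unit_ball_vol (real m) * (diameter (C i) / 2) ^ m))"
      if cov: "A \<subseteq> (\<Union>i. C i)" and C: "\<And>i. bounded (C i)" "\<And>i. diameter (C i) \<le> \<delta> / L" for C :: "nat \<Rightarrow> 'a set"
    proof -
      have d: "dist (f x) (f y) \<le> L * diameter (C i)" if "x \<in> A \<inter> C i" "y \<in> A \<inter> C i" for x y i
      proof -
        have "dist (f x) (f y) \<le> L * dist x y" using lip that by blast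
        also have "\<dots> \<le> L * diameter (C i)"
          using diameter_bounded_bound[OF C(1)] that L by (intro mult_left_mono) auto
        finally show ?thesis .
      qed
      have diam: "diameter (f ` (A \<inter> C i)) \<le> L * diameter (C i)" for i
        by (rule diameter_le_dist) (use d[of _ i] L diameter_ge_0[OF C(1)] in auto)
      have bd: "bounded (f ` (A \<inter> C i))" for i
        using d[of _ i] by (force simp: bounded_two_points)
      have "hausdorff_pre m \<delta> (f ` A)
         \<le> (\<Sum>i. ennreal (unit_ball_vol (real m) * (diameter (f ` (A \<inter> C i)) / 2) ^ m))"
      proof (rule hausdorff_pre_le)
        show "f ` A \<subseteq> (\<Union>i. f ` (A \<inter> C i))" using cov by blast
        show "diameter (f ` (A \<inter> C i)) \<le> \<delta>" for i
          using diam[of i] C(2)[of i] L by (simp add: field_simps)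
      qed (rule bd)
      also have "\<dots> \<le> (\<Sum>i. ennreal (L ^ m) * ennreal (unit_ball_vol (real m) * (diameter (C i) / 2) ^ m))"
      proof (rule suminf_le)
        fix i
        have "(diameter (f ` (A \<inter> C i)) / 2) ^ m \<le> (L * (diameter (C i) / 2)) ^ m"
          using diam[of i] diameter_ge_0[OF bd] by (intro power_mono) auto
        then have "unit_ball_vol (real m) * (diameter (f ` (A \<inter> C i)) / 2) ^ m
             \<le> unit_ball_vol (real m) * (L * (diameter (C i) / 2)) ^ m"
          by (intro mult_left_mono) auto
        also have "\<dots> = L ^ m * (unit_ball_vol (real m) * (diameter (C i) / 2) ^ m)"
          by (simp add: power_mult_distrib power_divide)
        finally show "ennreal (unit_ball_vol (real m) * (diameter (f ` (A \<inter> C i)) / 2) ^ m)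
           \<le> ennreal (L ^ m) * ennreal (unit_ball_vol (real m) * (diameter (C i) / 2) ^ m)"
          using L diameter_ge_0[OF C(1)] by (subst ennreal_mult[symmetric]) (auto intro!: ennreal_leI)
      qed auto
      also have "\<dots> = ennreal (L ^ m) * (\<Sum>i. ennreal (unit_ball_vol (real m) * (diameter (C i) / 2) ^ m))"
        by simp
      finally show ?thesis .
    qed
    \<comment> \<open>The factor is divided out before the infimum over covers is taken and
      multiplied back afterwards; this is harmless since it is positive and finite.\<close>
    then have "hausdorff_pre m \<delta> (f ` A) / ennreal (L ^ m) \<le> hausdorff_pre m (\<delta> / L) A"
      unfolding hausdorff_pre_def[of m "\<delta> / L"]
      by (intro INF_greatest divide_le_posI_ennreal) (use L in auto)
    then have "ennreal (L ^ m) * (hausdorff_pre m \<delta> (f ` A) / ennreal (L ^ m)) \<le> ennreal (L ^ m) * hausdorff_pre m (\<delta> / L) A"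
      by (rule mult_left_mono) simp
    moreover have "ennreal (L ^ m) * (hausdorff_pre m \<delta> (f ` A) / ennreal (L ^ m)) = hausdorff_pre m \<delta> (f ` A)"
      using L by (simp add: ennreal_times_divide mult_divide_eq_ennreal mult.commute[of "ennreal (L ^ m)"])
    ultimately show ?thesis by simp
  qed
  then have "hausdorff_pre m \<delta> (f ` A) \<le> ennreal (L ^ m) * hausdorff_outer m A" if "0 < \<delta>" for \<delta>
    using that L hausdorff_pre_le_outer[of "\<delta> / L" m A] by (meson divide_pos_pos mult_left_mono order_trans zero_le)
  then show ?thesis unfolding hausdorff_outer_def[of m "f ` A"] by (auto intro: SUP_least)
qed

section \<open>Geometry of convex domains\<close>

text \<open>Two different unit vectors \<open>u\<close>, \<open>w\<close> are told apart by
  \<open>v = u - w\<close>: the product with \<open>u\<close> is positive, the one with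
  \<open>w\<close> negative.\<close>

lemma sgn_eq_sgnI:
  fixes a b :: "'a::real_inner"
  assumes "a \<noteq> 0" "b \<noteq> 0" and eq: "\<And>v. a \<bullet> v < 0 \<longleftrightarrow> b \<bullet> v < 0"
  shows "sgn a = sgn b"
proof (rule ccontr)
  assume ne: "sgn a \<noteq> sgn b"
  define u w where "u = sgn a" and "w = sgn b"
  have n: "norm u = 1" "norm w = 1" using assms by (auto simp: u_def w_def norm_sgn)
  have uv: "u \<bullet> v < 0 \<longleftrightarrow> w \<bullet> v < 0" for v
    using eq[of v] assms by (simp add: u_def w_def sgn_div_norm mult_less_0_iff)
  have "0 < (norm (u - w))\<^sup>2" using ne by (simp add: u_def w_def)
  then have "u \<bullet> w < 1"
    using n by (simp add: power2_norm_eq_inner inner_diff inner_commute norm_eq_1)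
  then have "w \<bullet> (u - w) < 0" "0 < u \<bullet> (u - w)"
    using n by (auto simp: inner_diff_right inner_commute norm_eq_1)
  then show False using uv[of "u - w"] by simp
qed

lemma convex_segment_in_open:
  fixes \<Omega> :: "'a::euclidean_space set"
  assumes "open \<Omega>" "convex \<Omega>" and x: "x \<in> closure \<Omega>" and z: "x + t *\<^sub>R v \<in> \<Omega>" and s: "0 < s" "s \<le> t"
  shows "x + s *\<^sub>R v \<in> \<Omega>"
proof -
  have 1: "x + (t *\<^sub>R v) \<in> interior \<Omega>" using z \<open>open \<Omega>\<close> by (simp add: interior_open)
  have "x - (s / t) *\<^sub>R (x - (x + t *\<^sub>R v)) \<in> interior \<Omega>"
    by (rule mem_interior_closure_convex_shrink[OF \<open>convex \<Omega>\<close> 1 x]) (use s in auto)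
  then show ?thesis using s \<open>open \<Omega>\<close> by (simp add: interior_open)
qed

lemma open_line_nbhd:
  fixes x v :: "'a::real_normed_vector"
  assumes "open S" "x \<in> S"
  obtains e :: real where "0 < e" "\<And>s. \<bar>s\<bar> < e \<Longrightarrow> x + s *\<^sub>R v \<in> S"
proof -
  have "open ((\<lambda>s. x + s *\<^sub>R v) -` S)"
    using assms(1) by (intro continuous_open_vimage continuous_intros) auto
  moreover have "0 \<in> (\<lambda>s. x + s *\<^sub>R v) -` S" using assms(2) by simp
  ultimately obtain e where "0 < e" "\<And>s. dist s 0 < e \<Longrightarrow> s \<in> (\<lambda>s. x + s *\<^sub>R v) -` S"
    unfolding open_dist by blast
  then show thesis by (intro that[of e]) auto
qed

text \<open>Trades the differential notion of an inward direction for a convex one, which is all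
  that is used of the normal later. From left to right, \<open>g\<close> decreases initially.
  Conversely, if \<open>x + t v\<close> lay in \<Omega> although the derivative is not negative,
  tilting that end point slightly along \<open>G x\<close> would keep it in the open set and make
  the derivative positive; then \<open>g > 0\<close> just after \<open>x\<close>, while convexity
  puts that segment into \<Omega>.\<close>

lemma C1_defining_function_inward:
  fixes \<Omega> :: "'a::euclidean_space set"
  assumes \<Omega>: "open \<Omega>" "convex \<Omega>" and x: "x \<in> frontier \<Omega>" and g: "C1_defining_function \<Omega> x U g G"
  shows "G x \<bullet> v < 0 \<longleftrightarrow> (\<exists>t>0. x + t *\<^sub>R v \<in> \<Omega>)"
proof -
  have U: "open U" "x \<in> U" and G: "GDERIV g x :> G x" "G x \<noteq> 0"
    and \<Omega>U: "\<And>y. y \<in> U \<Longrightarrow> y \<in> \<Omega> \<longleftrightarrow> g y < 0" and g0: "g x = 0"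
    using g x unfolding C1_defining_function_def C1_on_def by auto
  have der: "DERIV (\<lambda>s. g (x + s *\<^sub>R w)) 0 :> G x \<bullet> w" for w
  proof -
    have "((\<lambda>s. x + s *\<^sub>R w) has_derivative (\<lambda>s. s *\<^sub>R w)) (at 0)"
      by (auto intro!: derivative_eq_intros)
    moreover have "(g has_derivative (\<lambda>h. h \<bullet> G x)) (at (x + 0 *\<^sub>R w))"
      using G by (simp add: gderiv_def)
    ultimately have "((\<lambda>s. g (x + s *\<^sub>R w)) has_derivative (\<lambda>s. (s *\<^sub>R w) \<bullet> G x)) (at 0)"
      by (rule has_derivative_compose)
    moreover have "(\<lambda>s. (s *\<^sub>R w) \<bullet> G x) = (*) (G x \<bullet> w)"
      by (auto simp: inner_commute)
    ultimately show ?thesis by (simp add: has_field_derivative_def)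
  qed
  show ?thesis
  proof
    assume "G x \<bullet> v < 0"
    then obtain d where d: "d > 0" "\<And>h. 0 < h \<Longrightarrow> h < d \<Longrightarrow> g (x + h *\<^sub>R v) < g x"
      using DERIV_neg_dec_right[OF der[of v]] by auto
    obtain d' where d': "d' > 0" "\<And>s. \<bar>s\<bar> < d' \<Longrightarrow> x + s *\<^sub>R v \<in> U"
      using open_line_nbhd[OF U] by blast
    define h where "h = min d d' / 2"
    have h: "0 < h" "h < d" "h < d'" using d d' by (auto simp: h_def)
    then have "x + h *\<^sub>R v \<in> \<Omega>" using d(2)[of h] d'(2)[of h] \<Omega>U g0 by auto
    then show "\<exists>t>0. x + t *\<^sub>R v \<in> \<Omega>" using h by blast
  next
    assume "\<exists>t>0. x + t *\<^sub>R v \<in> \<Omega>"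
    then obtain t where t: "0 < t" "x + t *\<^sub>R v \<in> \<Omega>" by blast
    show "G x \<bullet> v < 0"
    proof (rule ccontr)
      assume "\<not> G x \<bullet> v < 0"
      obtain e' where e': "e' > 0" "\<And>e. \<bar>e\<bar> < e' \<Longrightarrow> (x + t *\<^sub>R v) + e *\<^sub>R G x \<in> \<Omega>"
        using open_line_nbhd[OF \<Omega>(1) t(2)] by blast
      define e where "e = e' / 2"
      have e: "0 < e" "(x + t *\<^sub>R v) + e *\<^sub>R G x \<in> \<Omega>" using e' by (auto simp: e_def)
      define w where "w = t *\<^sub>R v + e *\<^sub>R G x"
      have w: "x + 1 *\<^sub>R w \<in> \<Omega>" using e by (simp add: w_def algebra_simps)
      have "0 < G x \<bullet> w" using t e G \<open>\<not> G x \<bullet> v < 0\<close>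
        by (auto simp: w_def inner_add_right intro!: add_nonneg_pos)
      then obtain d where d: "d > 0" "\<And>h. 0 < h \<Longrightarrow> h < d \<Longrightarrow> g (x + h *\<^sub>R w) > g x"
        using DERIV_pos_inc_right[OF der[of w]] by auto
      obtain d' where d': "d' > 0" "\<And>s. \<bar>s\<bar> < d' \<Longrightarrow> x + s *\<^sub>R w \<in> U"
      using open_line_nbhd[OF U] by blast
      define h where "h = min (min d d' / 2) 1"
      have h: "0 < h" "h < d" "h < d'" "h \<le> 1" using d d' by (auto simp: h_def)
      have "x + h *\<^sub>R w \<in> \<Omega>"
        by (rule convex_segment_in_open[OF \<Omega> _ w]) (use x h in \<open>auto simp: frontier_def\<close>)
      then show False using d(2)[of h] d'(2)[of h] \<Omega>U[of "x + h *\<^sub>R w"] g0 h by auto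
    qed
  qed
qed

text \<open>The convex condition does not mention the defining function, so the gradients of any two
  of them are negative on the same vectors and have the same direction. This is what makes the
  \<open>THE\<close> in \<open>outer_normal\<close> denote.\<close>

lemma outer_normal_inward:
  fixes \<Omega> :: "'a::euclidean_space set"
  assumes "convex_C1_domain \<Omega>" and x: "x \<in> frontier \<Omega>"
  shows "outer_normal \<Omega> x \<bullet> v < 0 \<longleftrightarrow> (\<exists>t>0. x + t *\<^sub>R v \<in> \<Omega>)"
proof -
  have \<Omega>: "open \<Omega>" "convex \<Omega>" using assms by (auto simp: convex_C1_domain_def)
  obtain U g G where g: "C1_defining_function \<Omega> x U g G"
    using assms unfolding convex_C1_domain_def C1_boundary_def by blast
  note inw = C1_defining_function_inward[OF \<Omega> x]
  have nz: "G x \<noteq> 0" if "C1_defining_function \<Omega> x U g G" for U g G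
    using that by (auto simp: C1_defining_function_def)
  have "outer_normal \<Omega> x = sgn (G x)"
    unfolding outer_normal_def
  proof (rule the_equality)
    show "\<exists>U g Ga. C1_defining_function \<Omega> x U g Ga \<and> sgn (G x) = sgn (Ga x)" using g by blast
  next
    fix v assume "\<exists>U g G. C1_defining_function \<Omega> x U g G \<and> v = sgn (G x)"
    then obtain U' g' G' where g': "C1_defining_function \<Omega> x U' g' G'" "v = sgn (G' x)" by blast
    show "v = sgn (G x)"
      unfolding g'(2) by (rule sgn_eq_sgnI) (use inw[OF g'(1)] inw[OF g] nz[OF g] nz[OF g'(1)] in auto)
  qed
  then show ?thesis using inw[OF g, of v] nz[OF g] by (simp add: sgn_div_norm mult_less_0_iff)
qed

lemma Gamma_minus_iff:
  assumes "convex_C1_domain \<Omega>"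
  shows "(x, \<xi>) \<in> Gamma_minus \<Omega> \<longleftrightarrow> x \<in> frontier \<Omega> \<and> norm \<xi> = 1 \<and> (\<exists>t>0. x + t *\<^sub>R \<xi> \<in> \<Omega>)"
  using outer_normal_inward[OF assms, of x \<xi>] by (auto simp: Gamma_minus_def)

text \<open>Interior points satisfy the forward condition by openness, so both pieces of the phase
  domain take one form, free of normals.\<close>

lemma phase_domain_iff:
  assumes "convex_C1_domain \<Omega>"
  shows "(x, \<xi>) \<in> phase_domain \<Omega> \<longleftrightarrow> x \<in> closure \<Omega> \<and> norm \<xi> = 1 \<and> (\<exists>t>0. x + t *\<^sub>R \<xi> \<in> \<Omega>)"
proof -
  have op: "open \<Omega>" using assms by (simp add: convex_C1_domain_def)
  have "\<exists>t>0. x + t *\<^sub>R \<xi> \<in> \<Omega>" if "x \<in> \<Omega>"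
  proof -
    obtain e where "e > 0" "\<And>t. \<bar>t\<bar> < e \<Longrightarrow> x + t *\<^sub>R \<xi> \<in> \<Omega>"
      using open_line_nbhd[OF op \<open>x \<in> \<Omega>\<close>] by blast
    then show ?thesis by (intro exI[of _ "e/2"]) auto
  qed
  then show ?thesis
    using op closure_subset[of \<Omega>] Gamma_minus_iff[OF assms, of x \<xi>]
    by (auto simp: phase_domain_def frontier_def interior_open)
qed

text \<open>On the phase domain this is the backward exit time \<tau>_-. The supremum over a closed
  bounded set is attained, and it is 0 at inflow points, so interior and boundary points can be
  treated alike.\<close>

definition back_time :: "'a::euclidean_space set \<Rightarrow> 'a \<Rightarrow> 'a \<Rightarrow> real" where
  "back_time \<Omega> x \<xi> = Sup {s. 0 \<le> s \<and> x - s *\<^sub>R \<xi> \<in> closure \<Omega>}"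

definition entry :: "'a::euclidean_space set \<Rightarrow> 'a \<Rightarrow> 'a \<Rightarrow> 'a" where
  "entry \<Omega> x \<xi> = x - back_time \<Omega> x \<xi> *\<^sub>R \<xi>"

text \<open>The sharp constant \<open>1 / r\<close> matters: Lipschitz constants built from it must
  tend to 1 when two viewpoints merge, which the cheap \<open>2 / r\<close> would not allow. It
  rests on \<open>|a| |b| |sgn a - sgn b|^2 = 2 |a| |b| - 2 a \<bullet> b \<le> |a -
  b|^2\<close>.\<close>

lemma dist_sgn_le:
  fixes a b :: "'a::real_inner"
  assumes r: "0 < r" "r \<le> norm a" "r \<le> norm b"
  shows "dist (sgn a) (sgn b) \<le> dist a b / r"
proof -
  have nz: "a \<noteq> 0" "b \<noteq> 0" using r by auto
  have "r\<^sup>2 \<le> norm a * norm b" using r by (auto simp: power2_eq_square intro!: mult_mono)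
  have sab: "(dist (sgn a) (sgn b))\<^sup>2 = 2 - 2 * (a \<bullet> b) / (norm a * norm b)"
  proof -
    have "sgn a \<bullet> sgn a = 1" "sgn b \<bullet> sgn b = 1" using nz unfolding norm_eq_1[symmetric] by (simp_all add: norm_sgn)
    moreover have "sgn a \<bullet> sgn b = (a \<bullet> b) / (norm a * norm b)" by (simp add: sgn_div_norm divide_inverse mult_ac)
    ultimately show ?thesis
      unfolding dist_norm power2_norm_eq_inner by (simp add: inner_diff inner_commute[of "sgn b" "sgn a"])
  qed
  have "r\<^sup>2 * (dist (sgn a) (sgn b))\<^sup>2 \<le> (norm a * norm b) * (dist (sgn a) (sgn b))\<^sup>2"
    by (rule mult_right_mono) (fact, simp)
  also have "\<dots> = 2 * norm a * norm b - 2 * (a \<bullet> b)"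
    unfolding sab using nz by (simp add: field_simps)
  also have "\<dots> \<le> (dist a b)\<^sup>2"
    using zero_le_power2[of "norm a - norm b"]
    unfolding dist_norm power2_norm_eq_inner
    by (simp add: inner_diff inner_commute[of b a] power2_diff power2_norm_eq_inner)
  finally have "(r * dist (sgn a) (sgn b))\<^sup>2 \<le> (dist a b)\<^sup>2" by (simp add: power_mult_distrib)
  then have "r * dist (sgn a) (sgn b) \<le> dist a b" by (rule power2_le_imp_le) simp
  then show ?thesis using r by (simp add: field_simps)
qed

section \<open>Backward rays and entry points\<close>

locale convex_domain =
  fixes \<Omega> :: "'a::euclidean_space set"
  assumes C1: "convex_C1_domain \<Omega>"
begin

abbreviation D where "D \<equiv> phase_domain \<Omega>"
abbreviation \<Gamma> where "\<Gamma> \<equiv> Gamma_minus \<Omega>"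
abbreviation \<tau> where "\<tau> \<equiv> back_time \<Omega>"
abbreviation \<pi> where "\<pi> \<equiv> entry \<Omega>"

lemma op: "open \<Omega>" and cvx: "convex \<Omega>" and bdd: "bounded \<Omega>"
  using C1 by (auto simp: convex_C1_domain_def)

lemmas D_iff = phase_domain_iff[OF C1]
lemmas \<Gamma>_iff = Gamma_minus_iff[OF C1]

lemma D_norm: "(x, \<xi>) \<in> D \<Longrightarrow> norm \<xi> = 1"
  by (simp add: D_iff)

lemma \<Gamma>_subset_D: "\<Gamma> \<subseteq> D"
  by (simp add: phase_domain_def)

lemma D_interior: "x \<in> \<Omega> \<Longrightarrow> norm \<xi> = 1 \<Longrightarrow> (x, \<xi>) \<in> D"
  by (simp add: phase_domain_def)

lemma D_cases: "(x, \<xi>) \<in> D \<Longrightarrow> x \<in> \<Omega> \<or> (x, \<xi>) \<in> \<Gamma>"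
  by (auto simp: phase_domain_def)

lemma frontier_disj: "x \<in> frontier \<Omega> \<Longrightarrow> x \<notin> \<Omega>"
  using op by (simp add: frontier_def interior_open)

lemma frontier_closure: "x \<in> frontier \<Omega> \<Longrightarrow> x \<in> closure \<Omega>"
  by (simp add: frontier_def)

lemma back_set_bound:
  assumes "norm \<xi> = 1" "x \<in> closure \<Omega>" "x - s *\<^sub>R \<xi> \<in> closure \<Omega>"
  shows "\<bar>s\<bar> \<le> diameter \<Omega>"
proof -
  have "dist x (x - s *\<^sub>R \<xi>) \<le> diameter (closure \<Omega>)"
    using assms bdd by (intro diameter_bounded_bound) auto
  then show ?thesis using assms bdd by (simp add: dist_norm diameter_closure)
qed

lemma
  assumes "(x, \<xi>) \<in> D"
  shows back_time_nonneg: "0 \<le> \<tau> x \<xi>"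
    and entry_closure: "x - \<tau> x \<xi> *\<^sub>R \<xi> \<in> closure \<Omega>"
    and back_time_upper: "\<And>s. 0 \<le> s \<Longrightarrow> x - s *\<^sub>R \<xi> \<in> closure \<Omega> \<Longrightarrow> s \<le> \<tau> x \<xi>"
    and back_time_le_diameter: "\<tau> x \<xi> \<le> diameter \<Omega>"
proof -
  let ?T = "{s. 0 \<le> s \<and> x - s *\<^sub>R \<xi> \<in> closure \<Omega>}"
  have x: "x \<in> closure \<Omega>" "norm \<xi> = 1" using assms by (auto simp: D_iff)
  have T0: "0 \<in> ?T" using x by simp
  have bd: "bdd_above ?T"
    using back_set_bound[OF x(2,1)] by (intro bdd_aboveI[of _ "diameter \<Omega>"]) force
  have eq: "?T = {0..} \<inter> (\<lambda>s. x - s *\<^sub>R \<xi>) -` closure \<Omega>" by auto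
  have "closed ?T"
    unfolding eq by (intro closed_Int closed_atLeast continuous_closed_vimage continuous_intros) auto
  then have "\<tau> x \<xi> \<in> ?T"
    unfolding back_time_def using T0 bd by (intro closed_contains_Sup) auto
  then show "0 \<le> \<tau> x \<xi>" "x - \<tau> x \<xi> *\<^sub>R \<xi> \<in> closure \<Omega>" by auto
  then show "\<tau> x \<xi> \<le> diameter \<Omega>" using back_set_bound[OF x(2,1)] by force
  show "s \<le> \<tau> x \<xi>" if "0 \<le> s" "x - s *\<^sub>R \<xi> \<in> closure \<Omega>" for s
    unfolding back_time_def using that bd by (intro cSup_upper) auto
qed

text \<open>These points lie strictly between the entry point, which is in the closure, and a
  forward point of the ray in \<Omega>.\<close>

lemma back_path_interior:
  assumes D: "(x, \<xi>) \<in> D" and s: "s < \<tau> x \<xi>" "0 \<le> s"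
  shows "x - s *\<^sub>R \<xi> \<in> \<Omega>"
proof -
  obtain t where t: "0 < t" "x + t *\<^sub>R \<xi> \<in> \<Omega>" using D by (auto simp: D_iff)
  have "(x - \<tau> x \<xi> *\<^sub>R \<xi>) + (\<tau> x \<xi> - s) *\<^sub>R \<xi> \<in> \<Omega>"
    by (rule convex_segment_in_open[OF op cvx entry_closure[OF D], of "\<tau> x \<xi> + t"])
       (use t s in \<open>auto simp: algebra_simps\<close>)
  then show ?thesis by (simp add: algebra_simps)
qed

lemma back_time_pos:
  assumes "x \<in> \<Omega>" "norm \<xi> = 1"
  shows "0 < \<tau> x \<xi>"
proof -
  obtain e where e: "e > 0" "\<And>t. \<bar>t\<bar> < e \<Longrightarrow> x + t *\<^sub>R (- \<xi>) \<in> \<Omega>"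
    using open_line_nbhd[OF op assms(1)] by blast
  then have "x - (e / 2) *\<^sub>R \<xi> \<in> \<Omega>" using e(2)[of "e / 2"] by simp
  have "x - (e / 2) *\<^sub>R \<xi> \<in> \<Omega>" using e(1) e(2)[of "e / 2"] by simp
  then have "e / 2 \<le> \<tau> x \<xi>"
    using e(1) subsetD[OF closure_subset] by (intro back_time_upper D_interior assms) auto
  then show ?thesis using e by simp
qed

lemma entry_frontier:
  assumes D: "(x, \<xi>) \<in> D"
  shows "\<pi> x \<xi> \<in> frontier \<Omega>"
proof -
  have "\<pi> x \<xi> \<notin> \<Omega>"
  proof
    assume "\<pi> x \<xi> \<in> \<Omega>"
    then have "0 < \<tau> (\<pi> x \<xi>) \<xi>" "(\<pi> x \<xi>, \<xi>) \<in> D" using D_norm[OF D] by (auto intro: back_time_pos D_interior)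
    then have "\<pi> x \<xi> - \<tau> (\<pi> x \<xi>) \<xi> *\<^sub>R \<xi> \<in> closure \<Omega>" by (intro entry_closure)
    then have "x - (\<tau> x \<xi> + \<tau> (\<pi> x \<xi>) \<xi>) *\<^sub>R \<xi> \<in> closure \<Omega>" by (simp add: entry_def algebra_simps)
    then have "\<tau> x \<xi> + \<tau> (\<pi> x \<xi>) \<xi> \<le> \<tau> x \<xi>"
      using \<open>0 < \<tau> (\<pi> x \<xi>) \<xi>\<close> back_time_nonneg[OF D] by (intro back_time_upper[OF D]) auto
    then show False using \<open>0 < \<tau> (\<pi> x \<xi>) \<xi>\<close> by simp
  qed
  then show ?thesis using entry_closure[OF D] op by (simp add: entry_def frontier_def interior_open)
qed

lemma entry_\<Gamma>:
  assumes D: "(x, \<xi>) \<in> D"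
  shows "(\<pi> x \<xi>, \<xi>) \<in> \<Gamma>"
proof -
  obtain t where t: "0 < t" "x + t *\<^sub>R \<xi> \<in> \<Omega>" using D by (auto simp: D_iff)
  then have "\<pi> x \<xi> + (\<tau> x \<xi> + t) *\<^sub>R \<xi> \<in> \<Omega>" by (simp add: entry_def algebra_simps)
  then show ?thesis
    using D_norm[OF D] entry_frontier[OF D] t back_time_nonneg[OF D] unfolding \<Gamma>_iff
    by (auto intro!: exI[of _ "\<tau> x \<xi> + t"])
qed

lemma \<Gamma>_forward:
  assumes y: "(y, \<xi>) \<in> \<Gamma>" and D: "(y + u *\<^sub>R \<xi>, \<xi>) \<in> D" and s: "0 < s" "s < u"
  shows "y + s *\<^sub>R \<xi> \<in> \<Omega>"
proof -
  obtain t where t: "0 < t" "y + u *\<^sub>R \<xi> + t *\<^sub>R \<xi> \<in> \<Omega>" using D by (auto simp: D_iff)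
  show ?thesis
    by (rule convex_segment_in_open[OF op cvx, of _ "u + t"])
       (use y t s in \<open>auto simp: \<Gamma>_iff frontier_def algebra_simps\<close>)
qed

lemma \<Gamma>_forward_D:
  assumes y: "(y, \<xi>) \<in> \<Gamma>" and D: "(y + u *\<^sub>R \<xi>, \<xi>) \<in> D" and s: "0 \<le> s" "s \<le> u"
  shows "(y + s *\<^sub>R \<xi>, \<xi>) \<in> D"
proof (cases "s = 0 \<or> s = u")
  case True
  then show ?thesis using D y \<Gamma>_subset_D by auto
next
  case False
  then show ?thesis using \<Gamma>_forward[OF y D, of s] s D_norm[OF D] by (auto intro: D_interior)
qed

lemma back_time_\<Gamma>_shift:
  assumes y: "(y, \<xi>) \<in> \<Gamma>" and D: "(y + u *\<^sub>R \<xi>, \<xi>) \<in> D" and u: "0 \<le> u"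
  shows "\<tau> (y + u *\<^sub>R \<xi>) \<xi> = u"
proof -
  have fr: "y \<in> frontier \<Omega>" using y by (simp add: \<Gamma>_iff)
  have "u \<le> \<tau> (y + u *\<^sub>R \<xi>) \<xi>"
    using fr u by (intro back_time_upper[OF D]) (auto simp: frontier_def)
  moreover have "\<not> u < \<tau> (y + u *\<^sub>R \<xi>) \<xi>"
    using back_path_interior[OF D, of u] u frontier_disj[OF fr] by auto
  ultimately show ?thesis by simp
qed

lemma entry_\<Gamma>_shift:
  assumes y: "(y, \<xi>) \<in> \<Gamma>" and D: "(y + u *\<^sub>R \<xi>, \<xi>) \<in> D" and u: "0 \<le> u"
  shows "\<pi> (y + u *\<^sub>R \<xi>) \<xi> = y"
  using back_time_\<Gamma>_shift[OF assms] by (simp add: entry_def)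

lemma \<Gamma>_back_time: "(y, \<xi>) \<in> \<Gamma> \<Longrightarrow> \<tau> y \<xi> = 0"
  and \<Gamma>_entry: "(y, \<xi>) \<in> \<Gamma> \<Longrightarrow> \<pi> y \<xi> = y"
  using back_time_\<Gamma>_shift[of y \<xi> 0] entry_\<Gamma>_shift[of y \<xi> 0] \<Gamma>_subset_D by auto

lemma entry_plus: "x = \<pi> x \<xi> + \<tau> x \<xi> *\<^sub>R \<xi>"
  by (simp add: entry_def)

text \<open>By convexity the forward ray leaves \<Omega> once and for all, so the times before the
  exit are those at which it is still in the phase domain; time 0 belongs to them as an inflow
  point. It links the discontinuity set of the theorem to entry points.\<close>

lemma tau_plus_iff:
  assumes y: "(y, \<xi>) \<in> \<Gamma>" and s: "0 \<le> s"
  shows "s < tau_plus \<Omega> y \<xi> \<longleftrightarrow> (y + s *\<^sub>R \<xi>, \<xi>) \<in> D"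
proof -
  let ?S = "{t. t > 0 \<and> y + t *\<^sub>R \<xi> \<notin> \<Omega>}"
  have n: "norm \<xi> = 1" and yc: "y \<in> closure \<Omega>" using y by (auto simp: \<Gamma>_iff frontier_def)
  \<comment> \<open>A point farther away than the diameter is outside, so the set of exit times is
    nonempty and its infimum is meaningful.\<close>
  have "\<bar>- (\<bar>diameter \<Omega>\<bar> + 1)\<bar> \<le> diameter \<Omega>" if "y + (\<bar>diameter \<Omega>\<bar> + 1) *\<^sub>R \<xi> \<in> \<Omega>"
    using subsetD[OF closure_subset that] by (intro back_set_bound[OF n yc]) (simp add: algebra_simps)
  then have "y + (\<bar>diameter \<Omega>\<bar> + 1) *\<^sub>R \<xi> \<notin> \<Omega>" by (auto simp: abs_le_iff)
  then have "\<bar>diameter \<Omega>\<bar> + 1 \<in> ?S" by simp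
  then have Sne: "?S \<noteq> {}" by blast
  have bd: "bdd_below ?S" by (intro bdd_belowI[of _ 0]) auto
  show ?thesis
  proof
    assume less: "s < tau_plus \<Omega> y \<xi>"
    show "(y + s *\<^sub>R \<xi>, \<xi>) \<in> D"
    proof (cases "s = 0")
      case True
      then show ?thesis using y \<Gamma>_subset_D by auto
    next
      case False
      have "y + s *\<^sub>R \<xi> \<in> \<Omega>"
      proof (rule ccontr)
        assume "y + s *\<^sub>R \<xi> \<notin> \<Omega>"
        then have "Inf ?S \<le> s" using False s bd by (intro cInf_lower) auto
        then show False using less by (simp add: tau_plus_def)
      qed
      then show ?thesis using n by (rule D_interior)
    qed
  next
    assume "(y + s *\<^sub>R \<xi>, \<xi>) \<in> D"
    then obtain t where t: "0 < t" "y + s *\<^sub>R \<xi> + t *\<^sub>R \<xi> \<in> \<Omega>" by (auto simp: D_iff)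
    have "s + t \<le> Inf ?S"
    proof (rule cInf_greatest[OF Sne])
      fix r assume r: "r \<in> ?S"
      show "s + t \<le> r"
      proof (rule ccontr)
        assume "\<not> s + t \<le> r"
        moreover have "y + (s + t) *\<^sub>R \<xi> \<in> \<Omega>" using t(2) by (simp add: scaleR_add_left add.assoc)
        ultimately have "y + r *\<^sub>R \<xi> \<in> \<Omega>"
          using r by (auto intro: convex_segment_in_open[OF op cvx yc, of "s + t" _ r])
        then show False using r by simp
      qed
    qed
    then show "s < tau_plus \<Omega> y \<xi>" using t by (simp add: tau_plus_def)
  qed
qed

text \<open>Both semicontinuities are open conditions: a backward point before the exit lies in
  \<Omega>, one beyond it lies outside the closure. The first needs that the ray enters the
  interior, which membership in \<open>D\<close> guarantees; grazing rays are thereby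
  excluded.\<close>

lemma continuous_back_time: "continuous_on D (\<lambda>z. \<tau> (fst z) (snd z))"
  unfolding continuous_on_def
proof (clarify)
  fix x \<xi> assume D: "(x, \<xi>) \<in> D"
  define F where "F = at (x, \<xi>) within D"
  have evD: "eventually (\<lambda>z. z \<in> D) F" unfolding F_def by (simp add: eventually_at_filter)
  have lim: "((\<lambda>z. fst z - s *\<^sub>R snd z) \<longlongrightarrow> x - s *\<^sub>R \<xi>) F" for s
    unfolding F_def by (auto intro!: tendsto_eq_intros)
  have "((\<lambda>z. \<tau> (fst z) (snd z)) \<longlongrightarrow> \<tau> x \<xi>) F"
  proof (rule order_tendstoI)
    fix a assume a: "a < \<tau> x \<xi>"
    show "eventually (\<lambda>z. a < \<tau> (fst z) (snd z)) F"
    proof (cases "a < 0")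
      case True
      then show ?thesis using evD back_time_nonneg by (auto elim!: eventually_mono intro: less_le_trans)
    next
      case False
      obtain b where b: "a < b" "b < \<tau> x \<xi>" using a dense by blast
      have "eventually (\<lambda>z. fst z - b *\<^sub>R snd z \<in> \<Omega>) F"
        by (rule topological_tendstoD[OF lim op]) (use back_path_interior[OF D, of b] b False in auto)
      with evD show ?thesis
      proof eventually_elim
        case (elim z)
        then have "b \<le> \<tau> (fst z) (snd z)"
          using closure_subset[of \<Omega>] b False by (intro back_time_upper) auto
        then show ?case using b by simp
      qed
    qed
  next
    fix a assume a: "\<tau> x \<xi> < a"
    have out: "x - a *\<^sub>R \<xi> \<in> - closure \<Omega>"
      using back_time_upper[OF D, of a] back_time_nonneg[OF D] a by auto
    have "eventually (\<lambda>z. fst z - a *\<^sub>R snd z \<in> - closure \<Omega>) F"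
      by (rule topological_tendstoD[OF lim]) (use out in auto)
    with evD show "eventually (\<lambda>z. \<tau> (fst z) (snd z) < a) F"
    proof eventually_elim
      case (elim z)
      have D': "(fst z, snd z) \<in> D" using elim by simp
      show ?case
      proof (rule ccontr)
        assume "\<not> \<tau> (fst z) (snd z) < a"
        then have "fst z - a *\<^sub>R snd z \<in> closure \<Omega>"
          using back_path_interior[OF D', of a] entry_closure[OF D'] closure_subset[of \<Omega>]
            a back_time_nonneg[OF D] by (cases "a = \<tau> (fst z) (snd z)") auto
        then show False using elim by simp
      qed
    qed
  qed
  then show "((\<lambda>z. \<tau> (fst z) (snd z)) \<longlongrightarrow> \<tau> (fst (x, \<xi>)) (snd (x, \<xi>))) (at (x, \<xi>) within D)"
    by (simp add: F_def)
qed

lemma continuous_entry: "continuous_on D (\<lambda>z. \<pi> (fst z) (snd z))"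
  unfolding entry_def by (intro continuous_intros continuous_back_time)

section \<open>The boundary as seen from an interior point\<close>

lemma back_time_ge:
  assumes "cball x \<delta> \<subseteq> closure \<Omega>" "0 < \<delta>" "x \<in> \<Omega>" "norm \<xi> = 1"
  shows "\<delta> \<le> \<tau> x \<xi>"
  by (rule back_time_upper[OF D_interior]) (use assms in \<open>auto simp: dist_norm\<close>)

text \<open>\<open>inverse (\<tau> x b)\<close> is the Minkowski gauge at \<open>b\<close> of the
  convex set of all \<open>v\<close> with \<open>x - v \<in> closure \<Omega>\<close>. The gauge is
  subadditive, and at most \<open>norm v / \<delta>\<close> because the set contains a ball of
  radius \<delta>; the proof is the convex combination behind subadditivity, for
  \<open>b = a + (b - a)\<close>.\<close>

lemma inverse_back_time_le:
  assumes \<delta>: "cball x \<delta> \<subseteq> closure \<Omega>" "0 < \<delta>" "x \<in> \<Omega>" and ab: "norm a = 1" "norm b = 1"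
  shows "inverse (\<tau> x b) \<le> inverse (\<tau> x a) + dist a b / \<delta>"
proof (cases "a = b")
  case False
  define s s' where "s = inverse (\<tau> x a)" and "s' = dist a b / \<delta>"
  have s: "0 < s" "0 < s'" using back_time_pos[OF \<open>x \<in> \<Omega>\<close> ab(1)] False \<delta> by (auto simp: s_def s'_def)
  have 1: "x - (1 / s) *\<^sub>R a \<in> closure \<Omega>"
    using entry_closure[OF D_interior[OF \<open>x \<in> \<Omega>\<close> ab(1)]] by (simp add: s_def divide_inverse)
  have 2: "x - (1 / s') *\<^sub>R (b - a) \<in> closure \<Omega>"
  proof -
    have "norm ((1 / s') *\<^sub>R (b - a)) = \<delta>" using False \<delta> by (simp add: s'_def dist_norm norm_minus_commute)
    then show ?thesis using \<delta> by (auto simp: dist_norm)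
  qed
  have "(s / (s + s')) *\<^sub>R (x - (1 / s) *\<^sub>R a) + (s' / (s + s')) *\<^sub>R (x - (1 / s') *\<^sub>R (b - a)) \<in> closure \<Omega>"
    by (rule convexD[OF convex_closure[OF cvx] 1 2]) (use s in \<open>auto simp: add_divide_distrib[symmetric]\<close>)
  also have "(s / (s + s')) *\<^sub>R (x - (1 / s) *\<^sub>R a) + (s' / (s + s')) *\<^sub>R (x - (1 / s') *\<^sub>R (b - a))
      = (s / (s + s') + s' / (s + s')) *\<^sub>R x - (1 / (s + s')) *\<^sub>R b"
    using s by (simp add: algebra_simps)
  also have "s / (s + s') + s' / (s + s') = 1" using s by (simp add: add_divide_distrib[symmetric])
  finally have "1 / (s + s') \<le> \<tau> x b"
    using s by (intro back_time_upper[OF D_interior[OF \<open>x \<in> \<Omega>\<close> ab(2)]]) auto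
  then have "inverse (\<tau> x b) \<le> s + s'"
    using s le_imp_inverse_le[of "1 / (s + s')" "\<tau> x b"] by simp
  then show ?thesis by (simp add: s_def s'_def)
qed simp

lemma inverse_back_time_lipschitz:
  assumes "cball x \<delta> \<subseteq> closure \<Omega>" "0 < \<delta>" "x \<in> \<Omega>" and ab: "norm a = 1" "norm b = 1"
  shows "\<bar>inverse (\<tau> x a) - inverse (\<tau> x b)\<bar> \<le> dist a b / \<delta>"
  using inverse_back_time_le[OF assms(1-3) ab] inverse_back_time_le[OF assms(1-3) ab(2,1)]
  by (auto simp: dist_commute abs_le_iff)

text \<open>For fixed interior \<open>x\<close>, \<open>\<pi> x\<close> and
  \<open>\<lambda>y. sgn (x - y)\<close> are inverse bijections between the unit sphere and the
  boundary; \<open>sgn_entry\<close> is the other half.\<close>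

lemma entry_sgn:
  assumes x: "x \<in> \<Omega>" and y: "y \<in> frontier \<Omega>"
  shows "\<pi> x (sgn (x - y)) = y" "(y, sgn (x - y)) \<in> \<Gamma>"
proof -
  have nz: "x - y \<noteq> 0" using x frontier_disj[OF y] by auto
  then have xe: "y + norm (x - y) *\<^sub>R sgn (x - y) = x" by (simp add: sgn_div_norm)
  show \<Gamma>: "(y, sgn (x - y)) \<in> \<Gamma>"
    using x y nz xe unfolding \<Gamma>_iff by (auto simp: norm_sgn intro!: exI[of _ "norm (x - y)"])
  show "\<pi> x (sgn (x - y)) = y"
    using entry_\<Gamma>_shift[OF \<Gamma>, of "norm (x - y)"] x nz D_interior[of x "sgn (x - y)"] unfolding xe
    by (simp add: norm_sgn)
qed

lemma sgn_entry:
  assumes x: "x \<in> \<Omega>" and \<xi>: "norm \<xi> = 1"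
  shows "sgn (x - \<pi> x \<xi>) = \<xi>"
  using back_time_pos[OF assms] \<xi> by (simp add: entry_def sgn_scaleR sgn_div_norm)

text \<open>The boundary keeps distance \<delta> from \<open>x\<close>, so radial projection is
  controlled there. Serves to carry null sets of boundary points to null sets of directions.\<close>

lemma boundary_direction_lipschitz:
  assumes \<delta>: "0 < \<delta>" "ball x \<delta> \<subseteq> \<Omega>" and y: "y \<in> frontier \<Omega>" "y' \<in> frontier \<Omega>"
  shows "dist (sgn (x - y)) (sgn (x - y')) \<le> (1 / \<delta>) * dist y y'"
proof -
  have "\<delta> \<le> norm (x - y)" if "y \<in> frontier \<Omega>" for y
    using frontier_disj[OF that] \<delta>(2) by (force simp: dist_norm)
  then have "dist (sgn (x - y)) (sgn (x - y')) \<le> dist (x - y) (x - y') / \<delta>"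
    using y \<delta> by (intro dist_sgn_le) auto
  also have "dist (x - y) (x - y') = dist y y'" by (simp add: dist_norm norm_minus_commute)
  finally show ?thesis by simp
qed

text \<open>Seen from \<open>x'\<close> instead of \<open>x\<close>, the entry point reached in direction \<open>a\<close> lies in
  direction \<open>sgn (a + (x' - x) / \<tau> x a)\<close>, a small Lipschitz perturbation of \<open>a\<close>.\<close>

lemma
  assumes \<delta>: "cball x \<delta> \<subseteq> closure \<Omega>" "0 < \<delta>" "x \<in> \<Omega>" and x': "dist x' x < \<delta>" and a: "norm a = 1"
  shows change_viewpoint_lipschitz: "\<And>b. norm b = 1 \<Longrightarrow> dist (sgn (x' - \<pi> x a)) (sgn (x' - \<pi> x b))
      \<le> ((\<delta> + dist x' x) / (\<delta> - dist x' x)) * dist a b"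
    and change_viewpoint_near: "dist (sgn (x' - \<pi> x a)) a \<le> dist x' x / (\<delta> - dist x' x)"
proof -
  define v where "v = x' - x"
  have nv: "norm v = dist x' x" by (simp add: v_def dist_norm)
  define q where "q a = a + inverse (\<tau> x a) *\<^sub>R v" for a
  \<comment> \<open>Since \<open>\<tau> x a \<ge> \<delta>\<close>, \<open>q a\<close> differs from
    the unit vector \<open>a\<close> by at most \<open>norm v / \<delta>\<close>, so
    \<open>r\<close> bounds its norm from below. With \<open>1 + norm v / \<delta>\<close> as
    Lipschitz constant of \<open>q\<close> and \<open>1 / r\<close> for the projection, the quotient
    in the claim arises.\<close>
  define r where "r = 1 - norm v / \<delta>"
  have r: "0 < r" "r = (\<delta> - dist x' x) / \<delta>" "r \<le> 1"
    using x' \<delta> by (auto simp: r_def nv field_simps)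
  have eq: "sgn (x' - \<pi> x a) = sgn (q a)" if "norm a = 1" for a
  proof -
    have pos: "0 < \<tau> x a" using \<delta> that by (intro back_time_pos)
    then have "x' - \<pi> x a = \<tau> x a *\<^sub>R q a" by (simp add: q_def v_def entry_def algebra_simps)
    then show ?thesis using pos by (simp add: sgn_scaleR)
  qed
  have inv: "inverse (\<tau> x a) * norm v \<le> norm v / \<delta>" if "norm a = 1" for a
    using le_imp_inverse_le[OF back_time_ge[OF \<delta> that] \<delta>(2)] mult_right_mono[of _ _ "norm v"]
    by (fastforce simp: divide_inverse mult.commute)
  have diff: "dist (q a) a \<le> norm v / \<delta>" if "norm a = 1" for a
    using inv[OF that] back_time_pos[OF \<delta>(3) that] by (simp add: q_def dist_norm)
  have nq: "r \<le> norm (q a)" if "norm a = 1" for a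
    using diff[OF that] norm_triangle_sub[of a "q a"] that by (simp add: r_def dist_norm norm_minus_commute)
  show "dist (sgn (x' - \<pi> x a)) (sgn (x' - \<pi> x b)) \<le> ((\<delta> + dist x' x) / (\<delta> - dist x' x)) * dist a b" if b: "norm b = 1" for b
  proof -
    have "dist (q a) (q b) \<le> dist a b + \<bar>inverse (\<tau> x a) - inverse (\<tau> x b)\<bar> * norm v"
    proof -
      have "q a - q b = (a - b) + (inverse (\<tau> x a) - inverse (\<tau> x b)) *\<^sub>R v"
        by (simp add: q_def algebra_simps)
      then show ?thesis using norm_triangle_ineq[of "a - b"] by (metis dist_norm norm_scaleR)
    qed
    also have "\<dots> \<le> dist a b + dist a b / \<delta> * norm v"
      by (intro add_left_mono mult_right_mono inverse_back_time_lipschitz \<delta> a b) simp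
    also have "\<dots> = dist a b * ((\<delta> + dist x' x) / \<delta>)" using \<delta> by (simp add: nv field_simps)
    finally have 1: "dist (q a) (q b) \<le> dist a b * ((\<delta> + dist x' x) / \<delta>)" .
    have "dist (sgn (q a)) (sgn (q b)) \<le> dist (q a) (q b) / r"
      using r nq a b by (intro dist_sgn_le) auto
    also have "\<dots> \<le> dist a b * ((\<delta> + dist x' x) / \<delta>) / r"
      using 1 r by (intro divide_right_mono) auto
    also have "\<dots> = ((\<delta> + dist x' x) / (\<delta> - dist x' x)) * dist a b"
      using \<delta> x' by (simp add: r(2) field_simps)
    finally show ?thesis using eq a b by simp
  qed
  show "dist (sgn (x' - \<pi> x a)) a \<le> dist x' x / (\<delta> - dist x' x)"
  proof -
    have "sgn a = a" using a by (simp add: sgn_div_norm)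
    have "dist (sgn (q a)) (sgn a) \<le> dist (q a) a / r"
      using r nq a by (intro dist_sgn_le) auto
    also have "\<dots> \<le> (norm v / \<delta>) / r" using diff a r by (intro divide_right_mono) auto
    also have "\<dots> = dist x' x / (\<delta> - dist x' x)" using \<delta> x' by (simp add: r(2) nv)
    finally show ?thesis using eq a \<open>sgn a = a\<close> by simp
  qed
qed

end

section \<open>Integration along characteristics\<close>

text \<open>At the finitely many interface times no derivative is known. The fundamental theorem of
  calculus for continuous functions tolerates them, and the derivative, extended by 0, is
  nonnegative everywhere.\<close>

lemma mono_exceptional_finite:
  fixes k :: "real \<Rightarrow> real"
  assumes "finite S" "a \<le> b" and cont: "continuous_on {a..b} k"
    and der: "\<And>x. x \<in> {a<..<b} - S \<Longrightarrow> \<exists>d\<ge>0. (k has_real_derivative d) (at x)"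
  shows "k a \<le> k b"
proof -
  define k' where "k' x = (if x \<in> {a<..<b} - S then SOME d. 0 \<le> d \<and> (k has_real_derivative d) (at x) else 0)" for x
  have k': "0 \<le> k' x \<and> (k has_real_derivative k' x) (at x)" if "x \<in> {a<..<b} - S" for x
    using someI_ex[OF der[OF that, unfolded Bex_def]] that by (simp add: k'_def)
  have "(k has_vector_derivative k' x) (at x)" if "x \<in> {a<..<b} - S" for x
    using k'[OF that] unfolding has_real_derivative_iff_has_vector_derivative by blast
  then have hi: "(k' has_integral k b - k a) {a..b}"
    by (rule fundamental_theorem_of_calculus_interior_strong[OF assms(1,2) _ cont])
  have nn: "0 \<le> k' x" for x
  proof (cases "x \<in> {a<..<b} - S")
    case True
    then show ?thesis using k' by blast
  next
    case False
    then show ?thesis by (simp only: k'_def if_False order_refl)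
  qed
  have "0 \<le> k b - k a" by (rule has_integral_nonneg[OF hi nn])
  then show ?thesis by simp
qed

locale transport = convex_domain \<Omega> for \<Omega> :: "'a::euclidean_space set" +
  fixes \<Omega>0 :: "'a set" and N :: nat and \<Omega>s :: "nat \<Rightarrow> 'a set"
    and l :: "'a \<Rightarrow> 'a \<Rightarrow> nat" and t :: "'a \<Rightarrow> 'a \<Rightarrow> nat \<Rightarrow> real"
    and \<mu>t \<mu>s :: "'a \<Rightarrow> real" and p :: "'a \<Rightarrow> 'a \<Rightarrow> 'a \<Rightarrow> real"
  assumes dim: "2 \<le> DIM('a)"
    and decomposition: "domain_decomposition \<Omega> N \<Omega>s"
    and \<Omega>0_def: "\<Omega>0 = (\<Union>j\<in>{1..N}. \<Omega>s j)"
    and gconvex: "generalized_convexity \<Omega> \<Omega>0 l t"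
    and coeff: "admissible_coefficients \<Omega>0 \<mu>t \<mu>s"
    and phase: "admissible_phase_function \<Omega>0 p"
begin

lemma open_\<Omega>0: "open \<Omega>0"
  unfolding \<Omega>0_def using decomposition by (intro open_UN) (auto simp: domain_decomposition_def)

lemma \<Omega>0_subset: "\<Omega>0 \<subseteq> \<Omega>"
  unfolding \<Omega>0_def using decomposition by (auto simp: domain_decomposition_def)

lemma closure_\<Omega>0: "closure \<Omega>0 = closure \<Omega>"
proof -
  have "closure (\<Union>j\<in>I. \<Omega>s j) = (\<Union>j\<in>I. closure (\<Omega>s j))" if "finite I" for I
    using that by induction simp_all
  then show ?thesis
    unfolding \<Omega>0_def using decomposition by (simp add: domain_decomposition_def)
qed

lemma frontier_\<Omega>0_iff: "x \<in> frontier \<Omega>0 \<longleftrightarrow> x \<in> closure \<Omega> \<and> x \<notin> \<Omega>0"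
  using open_\<Omega>0 by (simp add: frontier_def closure_\<Omega>0 interior_open)

text \<open>Generalized convexity speaks of interior base points only, so the base point is moved
  forward into \<Omega> by \<open>r\<close> and all times are shifted by \<open>r\<close>.\<close>

lemma finite_back_interfaces:
  assumes D: "(x, \<xi>) \<in> D"
  shows "finite {s. 0 \<le> s \<and> x - s *\<^sub>R \<xi> \<in> frontier \<Omega>0}"
proof -
  obtain r where r: "0 < r" "x + r *\<^sub>R \<xi> \<in> \<Omega>" and \<xi>: "norm \<xi> = 1" using D by (auto simp: D_iff)
  let ?x = "x + r *\<^sub>R \<xi>"
  have iff: "?x - s *\<^sub>R \<xi> \<in> frontier \<Omega>0 \<longleftrightarrow> (\<exists>j\<in>{1..l ?x \<xi>}. s = t ?x \<xi> j)" if "0 \<le> s" for s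
    using gconvex r(2) \<xi> that by (simp add: generalized_convexity_def)
  have "(\<lambda>s. s + r) ` {s. 0 \<le> s \<and> x - s *\<^sub>R \<xi> \<in> frontier \<Omega>0} \<subseteq> t ?x \<xi> ` {1..l ?x \<xi>}"
  proof (rule image_subsetI)
    fix s assume s: "s \<in> {s. 0 \<le> s \<and> x - s *\<^sub>R \<xi> \<in> frontier \<Omega>0}"
    have eq: "?x - (s + r) *\<^sub>R \<xi> = x - s *\<^sub>R \<xi>" by (simp add: scaleR_add_left)
    show "s + r \<in> t ?x \<xi> ` {1..l ?x \<xi>}"
      using iff[of "s + r", unfolded eq] s r(1) unfolding image_iff by simp
  qed
  then have "finite ((\<lambda>s. s + r) ` {s. 0 \<le> s \<and> x - s *\<^sub>R \<xi> \<in> frontier \<Omega>0})"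
    by (rule finite_subset) simp
  then show ?thesis by (rule finite_imageD) (auto simp: inj_on_def)
qed

lemma finite_forward_interfaces:
  assumes \<Gamma>: "(y, \<xi>) \<in> \<Gamma>" and D: "(y + u *\<^sub>R \<xi>, \<xi>) \<in> D"
  shows "finite {s. 0 \<le> s \<and> s \<le> u \<and> y + s *\<^sub>R \<xi> \<notin> \<Omega>0}"
proof -
  have "{s. 0 \<le> s \<and> s \<le> u \<and> y + s *\<^sub>R \<xi> \<notin> \<Omega>0}
      \<subseteq> (\<lambda>s. u - s) ` {s. 0 \<le> s \<and> (y + u *\<^sub>R \<xi>) - s *\<^sub>R \<xi> \<in> frontier \<Omega>0}"
  proof (clarify, rule image_eqI)
    fix s assume s: "0 \<le> s" "s \<le> u" "y + s *\<^sub>R \<xi> \<notin> \<Omega>0"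
    then have "(y + s *\<^sub>R \<xi>, \<xi>) \<in> D" using \<Gamma>_forward_D[OF \<Gamma> D] by auto
    then have "y + s *\<^sub>R \<xi> \<in> frontier \<Omega>0" using s by (simp add: frontier_\<Omega>0_iff D_iff)
    then show "u - s \<in> {s. 0 \<le> s \<and> (y + u *\<^sub>R \<xi>) - s *\<^sub>R \<xi> \<in> frontier \<Omega>0}"
      using s by (simp add: algebra_simps)
  qed simp
  then show ?thesis by (rule finite_subset) (intro finite_imageI finite_back_interfaces D)
qed

section \<open>Sources and their line integrals\<close>

abbreviation R where "R \<equiv> diameter \<Omega>"

lemma R_nonneg: "0 \<le> R"
  by (rule diameter_ge_0[OF bdd])

text \<open>Vanishing off \<Omega>0 and one bound for all positions let a line integral run over a
  whole chord. Both \<mu>t and the scattering term times its integrating factor are of this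
  kind.\<close>

definition source :: "('a \<times> 'a \<Rightarrow> real) \<Rightarrow> bool" where
  "source g \<longleftrightarrow> (\<exists>K. \<forall>x \<xi>. norm \<xi> = 1 \<longrightarrow> \<bar>g (x, \<xi>)\<bar> \<le> K) \<and> continuous_on (\<Omega>0 \<times> sphere 0 1) g \<and>
     (\<forall>x \<xi>. norm \<xi> = 1 \<longrightarrow> x \<notin> \<Omega>0 \<longrightarrow> g (x, \<xi>) = 0)"

text \<open>Solution of the pure transport equation with source \<open>g\<close> and zero inflow.
  Integrating from the entry point fixes the integrand along a ray, so that moving the point only
  changes the upper limit.\<close>

definition \<Lambda> :: "('a \<times> 'a \<Rightarrow> real) \<Rightarrow> 'a \<times> 'a \<Rightarrow> real" where
  "\<Lambda> g = (\<lambda>(x, \<xi>). integral {0..\<tau> x \<xi>} (\<lambda>r. g (\<pi> x \<xi> + r *\<^sub>R \<xi>, \<xi>)))"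

lemma source_continuous: "source g \<Longrightarrow> continuous_on (\<Omega>0 \<times> sphere 0 1) g"
  by (simp add: source_def)

lemma source_measurable:
  assumes g: "source g" and \<xi>: "norm \<xi> = 1"
  shows "(\<lambda>r. g (y + r *\<^sub>R \<xi>, \<xi>)) \<in> borel_measurable borel"
proof -
  let ?V = "(\<lambda>r. y + r *\<^sub>R \<xi>) -` \<Omega>0"
  have "open ?V" using open_\<Omega>0 by (intro continuous_open_vimage continuous_intros) auto
  moreover have "continuous_on ?V (\<lambda>r. g (y + r *\<^sub>R \<xi>, \<xi>))"
    by (rule continuous_on_compose2[OF source_continuous[OF g]]) (auto intro!: continuous_intros simp: \<xi>)
  ultimately have "(\<lambda>r. indicator ?V r *\<^sub>R g (y + r *\<^sub>R \<xi>, \<xi>)) \<in> borel_measurable borel"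
    by (intro borel_measurable_continuous_on_indicator) auto
  also have "(\<lambda>r. indicator ?V r *\<^sub>R g (y + r *\<^sub>R \<xi>, \<xi>)) = (\<lambda>r. g (y + r *\<^sub>R \<xi>, \<xi>))"
    using g \<xi> by (intro ext) (auto simp: source_def indicator_def)
  finally show ?thesis .
qed

lemma source_set_integrable:
  assumes g: "source g" and \<xi>: "norm \<xi> = 1"
  shows "set_integrable lborel {a..b} (\<lambda>r. g (y + r *\<^sub>R \<xi>, \<xi>))"
proof -
  obtain K where K: "\<And>x. \<bar>g (x, \<xi>)\<bar> \<le> K" using g \<xi> by (auto simp: source_def)
  show ?thesis
    unfolding set_integrable_def real_scaleR_def
  proof (rule Bochner_Integration.integrable_bound[of lborel "\<lambda>r. K * indicator {a..b} r"])
    show "(\<lambda>r. indicator {a..b} r * g (y + r *\<^sub>R \<xi>, \<xi>)) \<in> borel_measurable lborel"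
      using source_measurable[OF g \<xi>] by simp
    show "AE r in lborel. norm (indicator {a..b} r * g (y + r *\<^sub>R \<xi>, \<xi>)) \<le> norm (K * indicator {a..b} r)"
      using K order_trans[OF K abs_ge_self] by (intro AE_I2) (simp add: indicator_def)
  qed (intro integrable_mult_right integrable_real_indicator, auto simp: emeasure_lborel_Icc_eq)
qed

lemma \<Lambda>_lebesgue:
  assumes g: "source g" and D: "(x, \<xi>) \<in> D"
  shows "\<Lambda> g (x, \<xi>) = (LINT r|lborel. indicator {0..\<tau> x \<xi>} r * g (\<pi> x \<xi> + r *\<^sub>R \<xi>, \<xi>))"
  using set_borel_integral_eq_integral(2)[OF source_set_integrable[OF g D_norm[OF D]], of 0 "\<tau> x \<xi>" "\<pi> x \<xi>"]
  unfolding \<Lambda>_def set_lebesgue_integral_def real_scaleR_def prod.case by (rule sym)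

lemma \<Lambda>_bound:
  assumes g: "source g" and K: "\<And>x \<xi>. norm \<xi> = 1 \<Longrightarrow> \<bar>g (x, \<xi>)\<bar> \<le> K" and D: "(x, \<xi>) \<in> D"
  shows "\<bar>\<Lambda> g (x, \<xi>)\<bar> \<le> K * R"
proof -
  have "norm (integral (cbox 0 (\<tau> x \<xi>)) (\<lambda>r. g (\<pi> x \<xi> + r *\<^sub>R \<xi>, \<xi>))) \<le> K * measure lborel (cbox 0 (\<tau> x \<xi>))"
    using K[OF D_norm[OF D]] order_trans[OF abs_ge_zero K[OF D_norm[OF D]]]
      set_borel_integral_eq_integral(1)[OF source_set_integrable[OF g D_norm[OF D]]]
    by (intro integrable_bound) auto
  also have "\<dots> \<le> K * R"
    using back_time_nonneg[OF D] back_time_le_diameter[OF D] order_trans[OF abs_ge_zero K[OF D_norm[OF D]]]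
    by (auto intro!: mult_left_mono)
  finally show ?thesis by (simp add: \<Lambda>_def)
qed

lemma continuous_\<Lambda>:
  assumes g: "source g"
  shows "continuous_on D (\<Lambda> g)"
  unfolding continuous_on_sequentially
proof (intro allI ballI impI)
  fix z :: "nat \<Rightarrow> 'a \<times> 'a" and a assume aD: "a \<in> D" and "(\<forall>n. z n \<in> D) \<and> z \<longlonglongrightarrow> a"
  then have zD: "\<And>n. z n \<in> D" and z: "z \<longlonglongrightarrow> a" by auto
  obtain x \<xi> where a: "a = (x, \<xi>)" by force
  define xn \<xi>n where "xn n = fst (z n)" and "\<xi>n n = snd (z n)" for n
  have zn: "z n = (xn n, \<xi>n n)" for n by (simp add: xn_def \<xi>n_def)
  note D = aD[unfolded a] and Dn = zD[unfolded zn]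
  obtain K where K: "\<And>x \<xi>. norm \<xi> = 1 \<Longrightarrow> \<bar>g (x, \<xi>)\<bar> \<le> K" using g by (auto simp: source_def)
  have "0 \<le> K" using order_trans[OF abs_ge_zero K[OF D_norm[OF D]]] .
  have \<xi>: "\<xi>n \<longlonglongrightarrow> \<xi>" using tendsto_snd[OF z] by (simp add: a \<xi>n_def[abs_def])
  have T: "(\<lambda>n. \<tau> (xn n) (\<xi>n n)) \<longlonglongrightarrow> \<tau> x \<xi>"
    using continuous_on_tendsto_compose[OF continuous_back_time z aD] zD by (simp add: a zn)
  have P: "(\<lambda>n. \<pi> (xn n) (\<xi>n n)) \<longlonglongrightarrow> \<pi> x \<xi>"
    using continuous_on_tendsto_compose[OF continuous_entry z aD] zD by (simp add: a zn)
  \<comment> \<open>Interface times, converted from backward to forward time, and in addition the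
    end point \<open>\<tau> x \<xi>\<close>, where the indicators of the varying intervals need not
    converge.\<close>
  let ?S = "(\<lambda>s. \<tau> x \<xi> - s) ` {s. 0 \<le> s \<and> x - s *\<^sub>R \<xi> \<in> frontier \<Omega>0} \<union> {\<tau> x \<xi>}"
  have "finite ?S" using finite_back_interfaces[OF D] by simp
  have "(\<lambda>n. LINT r|lborel. indicator {0..\<tau> (xn n) (\<xi>n n)} r * g (\<pi> (xn n) (\<xi>n n) + r *\<^sub>R \<xi>n n, \<xi>n n))
     \<longlonglongrightarrow> (LINT r|lborel. indicator {0..\<tau> x \<xi>} r * g (\<pi> x \<xi> + r *\<^sub>R \<xi>, \<xi>))"
  proof (rule integral_dominated_convergence[where w="\<lambda>r. K * indicator {0..R} r"])
    show "(\<lambda>r. indicator {0..\<tau> x \<xi>} r * g (\<pi> x \<xi> + r *\<^sub>R \<xi>, \<xi>)) \<in> borel_measurable lborel"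
      using source_measurable[OF g D_norm[OF D]] by simp
    show "(\<lambda>r. indicator {0..\<tau> (xn n) (\<xi>n n)} r * g (\<pi> (xn n) (\<xi>n n) + r *\<^sub>R \<xi>n n, \<xi>n n)) \<in> borel_measurable lborel" for n
      using source_measurable[OF g D_norm[OF Dn]] by simp
    show "integrable lborel (\<lambda>r. K * indicator {0..R} r)"
      by (intro integrable_mult_right integrable_real_indicator) (auto simp: emeasure_lborel_Icc_eq)
    show "AE r in lborel. norm (indicator {0..\<tau> (xn n) (\<xi>n n)} r * g (\<pi> (xn n) (\<xi>n n) + r *\<^sub>R \<xi>n n, \<xi>n n)) \<le> K * indicator {0..R} r" for n
      using K[OF D_norm[OF Dn]] back_time_le_diameter[OF Dn[of n]] \<open>0 \<le> K\<close>
      by (intro AE_I2) (auto simp: indicator_def abs_mult)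
    have "AE r in lborel. r \<notin> ?S" using \<open>finite ?S\<close>
      by (intro AE_not_in finite_imp_null_set_lborel)
    then show "AE r in lborel. (\<lambda>n. indicator {0..\<tau> (xn n) (\<xi>n n)} r * g (\<pi> (xn n) (\<xi>n n) + r *\<^sub>R \<xi>n n, \<xi>n n))
        \<longlonglongrightarrow> indicator {0..\<tau> x \<xi>} r * g (\<pi> x \<xi> + r *\<^sub>R \<xi>, \<xi>)"
    proof (rule AE_mp, intro AE_I2 impI)
      fix r assume r: "r \<notin> ?S"
      consider "r < 0" | "\<tau> x \<xi> < r" | "0 \<le> r" "r < \<tau> x \<xi>" using r by fastforce
      then show "(\<lambda>n. indicator {0..\<tau> (xn n) (\<xi>n n)} r * g (\<pi> (xn n) (\<xi>n n) + r *\<^sub>R \<xi>n n, \<xi>n n))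
        \<longlonglongrightarrow> indicator {0..\<tau> x \<xi>} r * g (\<pi> x \<xi> + r *\<^sub>R \<xi>, \<xi>)"
      proof cases
        case 1
        then show ?thesis by simp
      next
        case 2
        have "eventually (\<lambda>n. \<tau> (xn n) (\<xi>n n) < r) sequentially" using T 2 by (rule order_tendstoD)
        then have "eventually (\<lambda>n. indicator {0..\<tau> (xn n) (\<xi>n n)} r * g (\<pi> (xn n) (\<xi>n n) + r *\<^sub>R \<xi>n n, \<xi>n n) = 0) sequentially"
          by eventually_elim simp
        then show ?thesis using 2 by (simp add: tendsto_eventually)
      next
        case 3
        have eq: "\<pi> x \<xi> + r *\<^sub>R \<xi> = x - (\<tau> x \<xi> - r) *\<^sub>R \<xi>" by (simp add: entry_def algebra_simps)
        have lim: "(\<lambda>n. \<pi> (xn n) (\<xi>n n) + r *\<^sub>R \<xi>n n) \<longlonglongrightarrow> \<pi> x \<xi> + r *\<^sub>R \<xi>"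
          by (intro tendsto_intros P \<xi>)
        have "\<pi> x \<xi> + r *\<^sub>R \<xi> \<notin> frontier \<Omega>0"
          using r 3 unfolding eq by (auto simp: image_iff dest: spec[of _ "\<tau> x \<xi> - r"])
        moreover have "\<pi> x \<xi> + r *\<^sub>R \<xi> \<in> closure \<Omega>"
        proof (cases "r = 0")
          case True
          then show ?thesis using entry_frontier[OF D] by (simp add: frontier_closure)
        next
          case False
          then show ?thesis unfolding eq
            using back_path_interior[OF D, of "\<tau> x \<xi> - r"] 3 closure_subset by auto
        qed
        ultimately have in0: "\<pi> x \<xi> + r *\<^sub>R \<xi> \<in> \<Omega>0" by (auto simp: frontier_\<Omega>0_iff)
        have ev: "eventually (\<lambda>n. \<pi> (xn n) (\<xi>n n) + r *\<^sub>R \<xi>n n \<in> \<Omega>0) sequentially"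
          by (rule topological_tendstoD[OF lim open_\<Omega>0 in0])
        have "(\<lambda>n. g (\<pi> (xn n) (\<xi>n n) + r *\<^sub>R \<xi>n n, \<xi>n n)) \<longlonglongrightarrow> g (\<pi> x \<xi> + r *\<^sub>R \<xi>, \<xi>)"
        proof (rule continuous_on_tendsto_compose[of "\<Omega>0 \<times> sphere 0 1" g])
          show "continuous_on (\<Omega>0 \<times> sphere 0 1) g" using g by (simp add: source_def)
          show "(\<lambda>n. (\<pi> (xn n) (\<xi>n n) + r *\<^sub>R \<xi>n n, \<xi>n n)) \<longlonglongrightarrow> (\<pi> x \<xi> + r *\<^sub>R \<xi>, \<xi>)"
            by (intro tendsto_Pair lim \<xi>)
          show "eventually (\<lambda>n. (\<pi> (xn n) (\<xi>n n) + r *\<^sub>R \<xi>n n, \<xi>n n) \<in> \<Omega>0 \<times> sphere 0 1) sequentially"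
            using ev D_norm[OF Dn] by (auto elim: eventually_mono)
        qed (use in0 D_norm[OF D] in auto)
        moreover have "eventually (\<lambda>n. r < \<tau> (xn n) (\<xi>n n)) sequentially" using T 3(2) by (rule order_tendstoD)
        then have "eventually (\<lambda>n. indicator {0..\<tau> (xn n) (\<xi>n n)} r = (1::real)) sequentially"
          by eventually_elim (use 3 in simp)
        then have "(\<lambda>n. indicator {0..\<tau> (xn n) (\<xi>n n)} r :: real) \<longlonglongrightarrow> 1" by (rule tendsto_eventually)
        ultimately show ?thesis using 3 tendsto_mult by fastforce
      qed
    qed
  qed
  then show "(\<Lambda> g \<circ> z) \<longlonglongrightarrow> \<Lambda> g a"
    using \<Lambda>_lebesgue[OF g D] \<Lambda>_lebesgue[OF g Dn] by (simp add: a zn comp_def)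
qed

lemma \<Lambda>_\<Gamma>: "(y, \<xi>) \<in> \<Gamma> \<Longrightarrow> \<Lambda> g (y, \<xi>) = 0"
  by (simp add: \<Lambda>_def \<Gamma>_back_time)

lemma \<Lambda>_shift:
  "(y, \<xi>) \<in> \<Gamma> \<Longrightarrow> (y + u *\<^sub>R \<xi>, \<xi>) \<in> D \<Longrightarrow> 0 \<le> u \<Longrightarrow>
    \<Lambda> g (y + u *\<^sub>R \<xi>, \<xi>) = integral {0..u} (\<lambda>r. g (y + r *\<^sub>R \<xi>, \<xi>))"
  by (simp add: \<Lambda>_def back_time_\<Gamma>_shift entry_\<Gamma>_shift)

text \<open>The fundamental theorem of calculus at the upper limit
  \<open>u = \<tau> x \<xi>\<close>: near \<open>x\<close> the ray stays in the open set \<Omega>0,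
  where the integrand is continuous, and the entry point is the same for all nearby points of the
  ray.\<close>

lemma \<Lambda>_derivative:
  assumes g: "source g" and x: "x \<in> \<Omega>0" and \<xi>: "norm \<xi> = 1"
  shows "((\<lambda>s. \<Lambda> g (x + s *\<^sub>R \<xi>, \<xi>)) has_real_derivative g (x, \<xi>)) (at 0)"
proof -
  have D: "(x, \<xi>) \<in> D" using x \<Omega>0_subset \<xi> by (auto intro: D_interior)
  define y u where "y = \<pi> x \<xi>" and "u = \<tau> x \<xi>"
  have y: "(y, \<xi>) \<in> \<Gamma>" using entry_\<Gamma>[OF D] by (simp add: y_def)
  have x_eq: "y + u *\<^sub>R \<xi> = x" by (simp add: y_def u_def entry_def)
  have u: "0 < u" unfolding u_def using x \<Omega>0_subset \<xi> by (auto intro: back_time_pos)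
  obtain e where e: "0 < e" "\<And>s. \<bar>s\<bar> < e \<Longrightarrow> x + s *\<^sub>R \<xi> \<in> \<Omega>0"
    using open_line_nbhd[OF open_\<Omega>0 x] by blast
  define \<phi> where "\<phi> r = g (y + r *\<^sub>R \<xi>, \<xi>)" for r
  define e' where "e' = min e u / 2"
  have e': "0 < e'" "e' < e" "e' < u" using e(1) u by (auto simp: e'_def)
  have "\<phi> integrable_on {0..u + e'}"
    unfolding \<phi>_def by (intro set_borel_integral_eq_integral source_set_integrable g \<xi>)
  moreover have near: "x + s *\<^sub>R \<xi> = y + (u + s) *\<^sub>R \<xi>" for s
    by (simp add: x_eq[symmetric] algebra_simps)
  have cont: "continuous_on {u - e'..u + e'} \<phi>"
  proof -
    have "y + r *\<^sub>R \<xi> \<in> \<Omega>0" if "r \<in> {u - e'..u + e'}" for r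
      using e(2)[of "r - u"] near[of "r - u"] that e' by (auto simp: abs_less_iff)
    then have "(\<lambda>r. (y + r *\<^sub>R \<xi>, \<xi>)) ` {u - e'..u + e'} \<subseteq> \<Omega>0 \<times> sphere 0 1" using \<xi> by auto
    then show ?thesis unfolding \<phi>_def
      by (intro continuous_on_compose2[OF source_continuous[OF g]] continuous_intros)
  qed
  have "isCont \<phi> u"
    using e' by (intro continuous_on_interior[OF cont]) auto
  then have cu: "continuous (at u within {0..u + e'} - {}) \<phi>" by (rule continuous_at_imp_continuous_at_within)
  ultimately have "((\<lambda>v. integral {0..v} \<phi>) has_vector_derivative \<phi> u) (at u within ({0..u + e'} - {}))"
    using u e' by (intro integral_has_vector_derivative_continuous_at) auto
  moreover have "at u within ({0..u + e'} - {}) = at u"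
    using u e' by (intro at_within_interior) auto
  ultimately have der: "((\<lambda>v. integral {0..v} \<phi>) has_real_derivative \<phi> u) (at u)"
    by (simp add: has_real_derivative_iff_has_vector_derivative)
  have "((\<lambda>s. integral {0..u + s} \<phi>) has_real_derivative \<phi> u) (at 0)"
    using der DERIV_shift[of "\<lambda>v. integral {0..v} \<phi>" "\<phi> u" 0 u] by (simp add: add.commute)
  moreover have "eventually (\<lambda>s. \<bar>s\<bar> < e') (nhds 0)"
    using e' eventually_nhds_metric[of "\<lambda>s. \<bar>s\<bar> < e'" "0::real"] by (auto simp: dist_real_def)
  then have "eventually (\<lambda>s. \<Lambda> g (x + s *\<^sub>R \<xi>, \<xi>) = integral {0..u + s} \<phi>) (nhds 0)"
  proof eventually_elim
    case (elim s)
    then have "(y + (u + s) *\<^sub>R \<xi>, \<xi>) \<in> D"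
      unfolding near[symmetric] using e(2)[of s] e' \<Omega>0_subset \<xi> by (auto intro!: D_interior)
    then show ?case
      unfolding near \<phi>_def using elim e' by (intro \<Lambda>_shift[OF y]) auto
  qed
  ultimately show ?thesis
    using DERIV_cong_ev[of 0 0 "\<lambda>s. \<Lambda> g (x + s *\<^sub>R \<xi>, \<xi>)" "\<lambda>s. integral {0..u + s} \<phi>" "\<phi> u" "\<phi> u"]
    by (simp add: \<phi>_def x_eq)
qed

section \<open>Optical depth and the contraction estimate along a ray\<close>

lemma coeff_facts:
  shows \<mu>t_nonneg: "0 \<le> \<mu>t x" and \<mu>s_nonneg: "0 \<le> \<mu>s x" and \<mu>s_le_\<mu>t: "\<mu>s x \<le> \<mu>t x"
    and \<mu>_outside: "x \<notin> \<Omega>0 \<Longrightarrow> \<mu>t x = 0" "x \<notin> \<Omega>0 \<Longrightarrow> \<mu>s x = 0"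
    and bounded_\<mu>: "bounded (range \<mu>t)" "bounded (range \<mu>s)"
    and continuous_\<mu>: "continuous_on \<Omega>0 \<mu>t" "continuous_on \<Omega>0 \<mu>s"
proof -
  note c = coeff[unfolded admissible_coefficients_def]
  show "0 \<le> \<mu>t x" "0 \<le> \<mu>s x" "x \<notin> \<Omega>0 \<Longrightarrow> \<mu>t x = 0" "x \<notin> \<Omega>0 \<Longrightarrow> \<mu>s x = 0"
    "bounded (range \<mu>t)" "bounded (range \<mu>s)" "continuous_on \<Omega>0 \<mu>t" "continuous_on \<Omega>0 \<mu>s"
    using c by blast+
  show "\<mu>s x \<le> \<mu>t x" using c by (cases "x \<in> \<Omega>0") simp_all
qed

lemma source_\<mu>t: "source (\<lambda>(x, \<xi>). \<mu>t x)"
proof -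
  have "continuous_on (\<Omega>0 \<times> sphere 0 1) (\<lambda>z. \<mu>t (fst z))"
    by (rule continuous_on_compose2[OF continuous_\<mu>(1)]) (auto intro!: continuous_intros)
  moreover obtain K where "\<And>x. \<bar>\<mu>t x\<bar> \<le> K" using bounded_\<mu>(1) unfolding bounded_iff by auto
  ultimately show ?thesis using \<mu>_outside unfolding source_def case_prod_beta by fastforce
qed

definition B :: "'a \<times> 'a \<Rightarrow> real" where "B = \<Lambda> (\<lambda>(x, \<xi>). \<mu>t x)"

definition M :: real where "M = (SUP x. \<mu>t x)"

lemma \<mu>t_le_M: "\<mu>t x \<le> M"
  unfolding M_def by (intro cSUP_upper bounded_imp_bdd_above bounded_\<mu>) simp

lemma B_bound: "(x, \<xi>) \<in> D \<Longrightarrow> \<bar>B (x, \<xi>)\<bar> \<le> M * R"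
  unfolding B_def using \<mu>t_nonneg \<mu>t_le_M by (intro \<Lambda>_bound source_\<mu>t) auto

lemma continuous_B: "continuous_on D B"
  unfolding B_def by (rule continuous_\<Lambda>[OF source_\<mu>t])

lemma B_derivative:
  "x \<in> \<Omega>0 \<Longrightarrow> norm \<xi> = 1 \<Longrightarrow> ((\<lambda>s. B (x + s *\<^sub>R \<xi>, \<xi>)) has_real_derivative \<mu>t x) (at 0)"
  unfolding B_def using \<Lambda>_derivative[OF source_\<mu>t, of x \<xi>] by simp

definition q :: real where "q = 1 - exp (- (M * R))"

lemma q_nonneg: "0 \<le> q" and q_less_1: "q < 1"
  using order_trans[OF \<mu>t_nonneg \<mu>t_le_M] R_nonneg by (auto simp: q_def)

text \<open>Gronwall along a characteristic: \<open>exp B * (C - h)\<close> is nondecreasing.\<close>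

lemma contraction_one_sided:
  assumes y: "(y, \<xi>) \<in> \<Gamma>" and D: "(y + u *\<^sub>R \<xi>, \<xi>) \<in> D" and u: "0 \<le> u" and C: "0 \<le> C"
    and cont: "continuous_on {0..u} h" and h0: "h 0 = 0"
    and der: "\<And>s. 0 < s \<Longrightarrow> s < u \<Longrightarrow> y + s *\<^sub>R \<xi> \<in> \<Omega>0 \<Longrightarrow>
      \<exists>d. (h has_real_derivative d) (at s) \<and> d + \<mu>t (y + s *\<^sub>R \<xi>) * h s \<le> C * \<mu>t (y + s *\<^sub>R \<xi>)"
  shows "h u \<le> q * C"
proof -
  define b where "b s = B (y + s *\<^sub>R \<xi>, \<xi>)" for s
  define k where "k s = exp (b s) * (C - h s)" for s
  have \<xi>: "norm \<xi> = 1" using D by (rule D_norm)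
  have "(\<lambda>s. (y + s *\<^sub>R \<xi>, \<xi>)) ` {0..u} \<subseteq> D" using \<Gamma>_forward_D[OF y D] by auto
  then have "continuous_on {0..u} (\<lambda>s. B (y + s *\<^sub>R \<xi>, \<xi>))"
    by (intro continuous_on_compose2[OF continuous_B] continuous_intros)
  then have "continuous_on {0..u} b" by (simp add: b_def comp_def)
  then have ck: "continuous_on {0..u} k" unfolding k_def by (intro continuous_intros cont)
  have "k 0 \<le> k u"
  proof (rule mono_exceptional_finite[OF finite_forward_interfaces[OF y D] u ck])
    fix s assume s: "s \<in> {0<..<u} - {s. 0 \<le> s \<and> s \<le> u \<and> y + s *\<^sub>R \<xi> \<notin> \<Omega>0}"
    then have in0: "y + s *\<^sub>R \<xi> \<in> \<Omega>0" by auto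
    let ?m = "\<mu>t (y + s *\<^sub>R \<xi>)"
    obtain d where d: "(h has_real_derivative d) (at s)" "d + ?m * h s \<le> C * ?m"
      using der[of s] s in0 by auto
    have "((\<lambda>r. B ((y + s *\<^sub>R \<xi>) + r *\<^sub>R \<xi>, \<xi>)) has_real_derivative ?m) (at 0)"
      by (rule B_derivative[OF in0 \<xi>])
    then have "((\<lambda>r. b (r + s)) has_real_derivative ?m) (at 0)"
      by (simp add: b_def algebra_simps)
    then have b: "(b has_real_derivative ?m) (at s)" using DERIV_shift[of b ?m 0 s] by simp
    have "(k has_real_derivative exp (b s) * ?m * (C - h s) + exp (b s) * (0 - d)) (at s)"
      unfolding k_def by (auto intro!: derivative_eq_intros b d(1))
    moreover have "exp (b s) * ?m * (C - h s) + exp (b s) * (0 - d) = exp (b s) * (C * ?m - (d + ?m * h s))"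
      by (simp add: algebra_simps)
    moreover have "0 \<le> exp (b s) * (C * ?m - (d + ?m * h s))" using d(2) by simp
    ultimately show "\<exists>d\<ge>0. (k has_real_derivative d) (at s)" by metis
  qed
  \<comment> \<open>Depth and \<open>h\<close> both vanish at the entry point, so \<open>k\<close>
    starts at \<open>C\<close>. Dividing by \<open>exp (b u)\<close> leaves
    \<open>h u \<le> (1 - exp (- b u)) * C\<close>, and the depth \<open>b u\<close> is at most
    \<open>M * R\<close>.\<close>
  moreover have "k 0 = C" using h0 y by (simp add: k_def b_def B_def \<Lambda>_\<Gamma>)
  ultimately have "C \<le> exp (b u) * (C - h u)" by (simp add: k_def)
  then have 1: "exp (- b u) * C \<le> C - h u"
    using mult_left_mono[of C "exp (b u) * (C - h u)" "exp (- b u)"]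
    by (simp add: mult.assoc[symmetric] exp_add[symmetric])
  have "b u \<le> M * R" using B_bound[OF D] by (simp add: b_def abs_le_iff)
  then have "exp (- (M * R)) * C \<le> exp (- b u) * C" using C by (intro mult_right_mono) auto
  then show ?thesis using 1 by (simp add: q_def algebra_simps)
qed

lemma contraction_along_ray:
  assumes y: "(y, \<xi>) \<in> \<Gamma>" and D: "(y + u *\<^sub>R \<xi>, \<xi>) \<in> D" and u: "0 \<le> u" and C: "0 \<le> C"
    and cont: "continuous_on {0..u} h" and h0: "h 0 = 0"
    and der: "\<And>s. 0 < s \<Longrightarrow> s < u \<Longrightarrow> y + s *\<^sub>R \<xi> \<in> \<Omega>0 \<Longrightarrow>
      \<exists>d. (h has_real_derivative d) (at s) \<and> \<bar>d + \<mu>t (y + s *\<^sub>R \<xi>) * h s\<bar> \<le> C * \<mu>t (y + s *\<^sub>R \<xi>)"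
  shows "\<bar>h u\<bar> \<le> q * C"
proof -
  have "h u \<le> q * C"
    by (rule contraction_one_sided[OF y D u C cont h0]) (use der in \<open>fastforce simp: abs_le_iff\<close>)
  moreover have "- h u \<le> q * C"
  proof (rule contraction_one_sided[OF y D u C, of "\<lambda>s. - h s"])
    show "continuous_on {0..u} (\<lambda>s. - h s)" by (intro continuous_intros cont)
    fix s assume "0 < s" "s < u" "y + s *\<^sub>R \<xi> \<in> \<Omega>0"
    from der[OF this] obtain d where d: "(h has_real_derivative d) (at s)"
      "\<bar>d + \<mu>t (y + s *\<^sub>R \<xi>) * h s\<bar> \<le> C * \<mu>t (y + s *\<^sub>R \<xi>)" by blast
    then show "\<exists>d. ((\<lambda>s. - h s) has_real_derivative d) (at s) \<and> d + \<mu>t (y + s *\<^sub>R \<xi>) * - h s \<le> C * \<mu>t (y + s *\<^sub>R \<xi>)"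
      by (intro exI[of _ "- d"]) (auto intro!: derivative_eq_intros simp: abs_le_iff)
  qed (simp add: h0)
  ultimately show ?thesis by (simp add: abs_le_iff)
qed

end

section \<open>Integrals under almost measure-preserving maps\<close>

text \<open>The hypotheses say that \<psi> changes the measure by a factor between
  \<open>1 / c\<close> and \<open>c\<close>. The upper bound makes the composed function integrable;
  after that both bounds pass from \<open>ennreal\<close> to real integrals.\<close>

lemma integral_quasi_invariant:
  fixes h :: "'a \<Rightarrow> real"
  assumes \<psi>: "\<psi> \<in> measurable M M" and c: "0 < c"
    and le: "\<And>h. h \<in> borel_measurable M \<Longrightarrow> (\<integral>\<^sup>+x. h (\<psi> x) \<partial>M) \<le> ennreal c * (\<integral>\<^sup>+x. h x \<partial>M)"
    and ge: "\<And>h. h \<in> borel_measurable M \<Longrightarrow> (\<integral>\<^sup>+x. h x \<partial>M) \<le> ennreal c * (\<integral>\<^sup>+x. h (\<psi> x) \<partial>M)"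
    and h: "integrable M h" and nonneg: "\<And>x. x \<in> space M \<Longrightarrow> 0 \<le> h x"
  shows "integrable M (\<lambda>x. h (\<psi> x))"
    and "(\<integral>x. h (\<psi> x) \<partial>M) \<le> c * (\<integral>x. h x \<partial>M)"
    and "(\<integral>x. h x \<partial>M) \<le> c * (\<integral>x. h (\<psi> x) \<partial>M)"
proof -
  have hm: "h \<in> borel_measurable M" using h by auto
  have nn: "(\<integral>\<^sup>+x. ennreal (h x) \<partial>M) = ennreal (\<integral>x. h x \<partial>M)"
    using h nonneg by (intro nn_integral_eq_integral AE_I2) auto
  have nonneg': "0 \<le> h (\<psi> x)" if "x \<in> space M" for x
    using measurable_space[OF \<psi> that] nonneg by blast
  have m': "(\<lambda>x. h (\<psi> x)) \<in> borel_measurable M" using \<psi> hm by (rule measurable_compose)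
  have I0: "0 \<le> (\<integral>x. h x \<partial>M)" "0 \<le> (\<integral>x. h (\<psi> x) \<partial>M)"
    using nonneg nonneg' by (auto intro!: integral_nonneg_AE AE_I2)
  have le': "(\<integral>\<^sup>+x. ennreal (h (\<psi> x)) \<partial>M) \<le> ennreal (c * (\<integral>x. h x \<partial>M))"
    using le[of "\<lambda>x. ennreal (h x)"] hm c I0 unfolding nn by (simp add: ennreal_mult)
  show int: "integrable M (\<lambda>x. h (\<psi> x))"
  proof (rule integrableI_bounded[OF m'])
    have "(\<integral>\<^sup>+x. ennreal (norm (h (\<psi> x))) \<partial>M) = (\<integral>\<^sup>+x. ennreal (h (\<psi> x)) \<partial>M)"
      using nonneg' by (intro nn_integral_cong) simp
    also have "\<dots> < \<infinity>" using le' by (simp add: order_le_less_trans)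
    finally show "(\<integral>\<^sup>+x. ennreal (norm (h (\<psi> x))) \<partial>M) < \<infinity>" .
  qed
  have nn': "(\<integral>\<^sup>+x. ennreal (h (\<psi> x)) \<partial>M) = ennreal (\<integral>x. h (\<psi> x) \<partial>M)"
    using int nonneg' by (intro nn_integral_eq_integral AE_I2) auto
  show "(\<integral>x. h (\<psi> x) \<partial>M) \<le> c * (\<integral>x. h x \<partial>M)"
    using le' c I0 unfolding nn' by (simp add: ennreal_le_iff)
  have "ennreal (\<integral>x. h x \<partial>M) \<le> ennreal (c * (\<integral>x. h (\<psi> x) \<partial>M))"
    using ge[of "\<lambda>x. ennreal (h x)"] hm c I0 unfolding nn nn' by (simp add: ennreal_mult)
  then show "(\<integral>x. h x \<partial>M) \<le> c * (\<integral>x. h (\<psi> x) \<partial>M)"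
    using c I0 by (simp add: ennreal_le_iff)
qed

lemma tendsto_quasi_invariant:
  fixes a b c :: "nat \<Rightarrow> real"
  assumes a: "a \<longlonglongrightarrow> L" and c: "c \<longlonglongrightarrow> 1" "\<And>n. 0 < c n" and ab: "\<And>n. a n \<le> c n * b n" "\<And>n. b n \<le> c n * a n"
  shows "b \<longlonglongrightarrow> L"
proof (rule tendsto_sandwich)
  show "eventually (\<lambda>n. a n / c n \<le> b n) sequentially"
    using ab(1) c(2) by (intro always_eventually allI) (simp add: divide_le_eq mult.commute)
  show "eventually (\<lambda>n. b n \<le> c n * a n) sequentially" using ab(2) by simp
  show "(\<lambda>n. a n / c n) \<longlonglongrightarrow> L" using tendsto_divide[OF a c(1)] by simp
  show "(\<lambda>n. c n * a n) \<longlonglongrightarrow> L" using tendsto_mult[OF c(1) a] by simp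
qed

text \<open>No domination of the densities \<open>P n\<close> is needed: total mass one upgrades
  pointwise convergence to convergence in \<open>L\<^sup>1\<close> (Scheffe).\<close>

lemma integral_density_tendsto:
  fixes P F :: "nat \<Rightarrow> 'a \<Rightarrow> real"
  assumes P: "\<And>n. integrable M (P n)" "\<And>n x. x \<in> space M \<Longrightarrow> 0 \<le> P n x" "(\<lambda>n. \<integral>x. P n x \<partial>M) \<longlonglongrightarrow> (\<integral>x. P' x \<partial>M)"
    and P': "integrable M P'" "\<And>x. x \<in> space M \<Longrightarrow> 0 \<le> P' x"
    and F: "\<And>n. F n \<in> borel_measurable M" "F' \<in> borel_measurable M"
    and K: "\<And>n x. x \<in> space M \<Longrightarrow> \<bar>F n x\<bar> \<le> K" "\<And>x. x \<in> space M \<Longrightarrow> \<bar>F' x\<bar> \<le> K"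
    and lim: "AE x in M. (\<lambda>n. P n x) \<longlonglongrightarrow> P' x" "AE x in M. (\<lambda>n. F n x) \<longlonglongrightarrow> F' x"
  shows "(\<lambda>n. \<integral>x. P n x * F n x \<partial>M) \<longlonglongrightarrow> (\<integral>x. P' x * F' x \<partial>M)"
proof -
  have meas [measurable]: "\<And>n. P n \<in> borel_measurable M" "P' \<in> borel_measurable M"
    "\<And>n. F n \<in> borel_measurable M" "F' \<in> borel_measurable M" using P P' F by auto
  have bound: "integrable M (\<lambda>x. p x * f x)"
    if "integrable M p" "f \<in> borel_measurable M" "\<And>x. x \<in> space M \<Longrightarrow> \<bar>f x\<bar> \<le> K" for p f :: "'a \<Rightarrow> real"
  proof (rule Bochner_Integration.integrable_bound[of M "\<lambda>x. K * p x"])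
    show "AE x in M. norm (p x * f x) \<le> norm (K * p x)"
      using that(3) order_trans[OF that(3) abs_ge_self]
      by (intro AE_I2) (simp add: abs_mult mult.commute mult_right_mono)
  qed (use that in auto)
  have nn: "(\<integral>\<^sup>+x. ennreal (norm (p x)) \<partial>M) = ennreal (\<integral>x. p x \<partial>M)"
    if "integrable M p" "\<And>x. x \<in> space M \<Longrightarrow> 0 \<le> p x" for p :: "'a \<Rightarrow> real"
  proof -
    have "(\<integral>\<^sup>+x. ennreal (norm (p x)) \<partial>M) = (\<integral>\<^sup>+x. ennreal (p x) \<partial>M)"
      using that by (intro nn_integral_cong) simp
    also have "\<dots> = ennreal (\<integral>x. p x \<partial>M)" using that by (intro nn_integral_eq_integral AE_I2) auto
    finally show ?thesis .
  qed
  have "(\<lambda>n. \<integral>\<^sup>+x. ennreal (norm (P n x)) \<partial>M) \<longlonglongrightarrow> (\<integral>\<^sup>+x. ennreal (norm (P' x)) \<partial>M)"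
  proof -
    have "(\<integral>\<^sup>+x. ennreal (norm (P n x)) \<partial>M) = ennreal (\<integral>x. P n x \<partial>M)" for n
      by (rule nn[OF P(1) P(2)])
    moreover have "(\<integral>\<^sup>+x. ennreal (norm (P' x)) \<partial>M) = ennreal (\<integral>x. P' x \<partial>M)"
      by (rule nn[OF P'(1) P'(2)])
    ultimately show ?thesis using tendsto_ennrealI[OF P(3)] by presburger
  qed
  then have "limsup (\<lambda>n. \<integral>\<^sup>+x. ennreal (norm (P n x)) \<partial>M) \<le> (\<integral>\<^sup>+x. ennreal (norm (P' x)) \<partial>M)"
    by (simp add: lim_imp_Limsup)
  then have "(\<lambda>n. \<integral>\<^sup>+x. norm (P n x - P' x) \<partial>M) \<longlonglongrightarrow> 0"
    by (intro Scheffe_lemma1 P P' lim)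
  moreover have "(\<integral>\<^sup>+x. norm (P n x - P' x) \<partial>M) = ennreal (\<integral>x. \<bar>P n x - P' x\<bar> \<partial>M)" for n
    using P P' by (subst nn_integral_eq_integral) auto
  ultimately have L1: "(\<lambda>n. \<integral>x. \<bar>P n x - P' x\<bar> \<partial>M) \<longlonglongrightarrow> 0"
    by (simp add: ennreal_0[symmetric] tendsto_ennreal_iff del: ennreal_0)
  \<comment> \<open>\<open>P n * F n = (P n - P') * F n + P' * F n\<close>: the first term is small
    in \<open>L^1\<close>, the second is dominated by the fixed function
    \<open>K * P'\<close>.\<close>
  have 1: "(\<lambda>n. \<integral>x. (P n x - P' x) * F n x \<partial>M) \<longlonglongrightarrow> 0"
  proof (rule Lim_null_comparison)
    show "(\<lambda>n. K * (\<integral>x. \<bar>P n x - P' x\<bar> \<partial>M)) \<longlonglongrightarrow> 0"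
      using tendsto_mult_right_zero[OF L1] .
    show "eventually (\<lambda>n. norm (\<integral>x. (P n x - P' x) * F n x \<partial>M) \<le> K * (\<integral>x. \<bar>P n x - P' x\<bar> \<partial>M)) sequentially"
    proof (intro always_eventually allI)
      fix n
      have "norm (\<integral>x. (P n x - P' x) * F n x \<partial>M) \<le> (\<integral>x. norm ((P n x - P' x) * F n x) \<partial>M)"
        by (rule integral_norm_bound)
      also have "\<dots> \<le> (\<integral>x. K * \<bar>P n x - P' x\<bar> \<partial>M)"
      proof (rule integral_mono)
        show "integrable M (\<lambda>x. norm ((P n x - P' x) * F n x))"
          using bound[of "\<lambda>x. P n x - P' x" "F n"] P P' K by (intro integrable_norm) auto
        show "integrable M (\<lambda>x. K * \<bar>P n x - P' x\<bar>)" using P P' by auto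
        show "norm ((P n x - P' x) * F n x) \<le> K * \<bar>P n x - P' x\<bar>" if "x \<in> space M" for x
          using K(1)[OF that] by (simp add: abs_mult mult.commute mult_right_mono)
      qed
      finally show "norm (\<integral>x. (P n x - P' x) * F n x \<partial>M) \<le> K * (\<integral>x. \<bar>P n x - P' x\<bar> \<partial>M)" by simp
    qed
  qed
  have 2: "(\<lambda>n. \<integral>x. P' x * F n x \<partial>M) \<longlonglongrightarrow> (\<integral>x. P' x * F' x \<partial>M)"
  proof (rule integral_dominated_convergence[where w="\<lambda>x. K * P' x"])
    show "AE x in M. (\<lambda>n. P' x * F n x) \<longlonglongrightarrow> P' x * F' x"
      using lim(2) by eventually_elim (intro tendsto_intros)
    show "AE x in M. norm (P' x * F n x) \<le> K * P' x" for n
    proof (intro AE_I2)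
      fix x assume "x \<in> space M"
      then show "norm (P' x * F n x) \<le> K * P' x"
        using mult_right_mono[OF K(1)[of x n] P'(2)[of x]] P'(2)[of x] by (simp add: abs_mult mult.commute)
    qed
  qed (use P' in auto)
  have "(\<integral>x. P n x * F n x \<partial>M) = (\<integral>x. (P n x - P' x) * F n x \<partial>M) + (\<integral>x. P' x * F n x \<partial>M)" for n
    using bound[of "P n" "F n"] bound[of P' "F n"] P P' K by (simp add: left_diff_distrib)
  then show ?thesis using tendsto_add[OF 1 2] by simp
qed

text \<open>Convergence is required only after the substitution \<open>\<psi> n\<close>, which
  changes integrals by a factor tending to 1. As that comparison holds for nonnegative integrands,
  \<open>F n\<close> is shifted by \<open>K\<close>; since every density has mass one, the shift
  adds exactly \<open>K\<close> to each integral and can be removed again.\<close>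

lemma integral_perturbed_tendsto:
  fixes P F :: "nat \<Rightarrow> 'a \<Rightarrow> real"
  assumes \<psi>: "\<And>n. \<psi> n \<in> measurable M M" and c: "\<And>n. 0 < c n" "c \<longlonglongrightarrow> 1"
    and le: "\<And>n h. h \<in> borel_measurable M \<Longrightarrow> (\<integral>\<^sup>+x. h (\<psi> n x) \<partial>M) \<le> ennreal (c n) * (\<integral>\<^sup>+x. h x \<partial>M)"
    and ge: "\<And>n h. h \<in> borel_measurable M \<Longrightarrow> (\<integral>\<^sup>+x. h x \<partial>M) \<le> ennreal (c n) * (\<integral>\<^sup>+x. h (\<psi> n x) \<partial>M)"
    and P: "\<And>n. integrable M (P n)" "\<And>n x. x \<in> space M \<Longrightarrow> 0 \<le> P n x" "\<And>n. (\<integral>x. P n x \<partial>M) = 1"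
    and P': "integrable M P'" "\<And>x. x \<in> space M \<Longrightarrow> 0 \<le> P' x" "(\<integral>x. P' x \<partial>M) = 1"
    and F: "\<And>n. F n \<in> borel_measurable M" "F' \<in> borel_measurable M"
    and K: "\<And>n x. x \<in> space M \<Longrightarrow> \<bar>F n x\<bar> \<le> K" "\<And>x. x \<in> space M \<Longrightarrow> \<bar>F' x\<bar> \<le> K"
    and lim: "AE x in M. (\<lambda>n. P n (\<psi> n x)) \<longlonglongrightarrow> P' x" "AE x in M. (\<lambda>n. F n (\<psi> n x)) \<longlonglongrightarrow> F' x"
  shows "(\<lambda>n. \<integral>x. P n x * F n x \<partial>M) \<longlonglongrightarrow> (\<integral>x. P' x * F' x \<partial>M)"
proof -
  have q1: "integrable M (\<lambda>x. h (\<psi> n x))"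
    and q2: "(\<integral>x. h (\<psi> n x) \<partial>M) \<le> c n * (\<integral>x. h x \<partial>M)"
    and q3: "(\<integral>x. h x \<partial>M) \<le> c n * (\<integral>x. h (\<psi> n x) \<partial>M)"
    if "integrable M h" "\<And>x. x \<in> space M \<Longrightarrow> 0 \<le> h x" for h :: "'a \<Rightarrow> real" and n
    by (rule integral_quasi_invariant[of "\<psi> n" M "c n" h, OF \<psi> c(1) le[of _ n] ge[of _ n] that]; assumption)+
  have sp: "\<psi> n x \<in> space M" if "x \<in> space M" for n x using measurable_space[OF \<psi> that] .
  have K0: "0 \<le> F n x + K" "0 \<le> F' x + K" "\<bar>F n x + K\<bar> \<le> 2 * K" "\<bar>F' x + K\<bar> \<le> 2 * K" if "x \<in> space M" for n x
    using K(1)[OF that, of n] K(2)[OF that] by auto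
  have iH: "integrable M (\<lambda>x. p x * f x)"
    if "integrable M p" "f \<in> borel_measurable M" "\<And>x. x \<in> space M \<Longrightarrow> \<bar>f x\<bar> \<le> k" for p f :: "'a \<Rightarrow> real" and k
  proof (rule Bochner_Integration.integrable_bound[of M "\<lambda>x. k * p x"])
    show "AE x in M. norm (p x * f x) \<le> norm (k * p x)"
      using that(3) order_trans[OF that(3) abs_ge_self]
      by (intro AE_I2) (simp add: abs_mult mult.commute mult_right_mono)
  qed (use that in auto)
  have Fm: "(\<lambda>x. F n x + K) \<in> borel_measurable M" for n using F by simp
  have iP\<psi>: "integrable M (\<lambda>x. P n (\<psi> n x))" for n by (rule q1[OF P(1) P(2)])
  \<comment> \<open>The substituted densities need not have mass one, but squeezing between
    \<open>1 / c n\<close> and \<open>c n\<close> gives the limit that the density lemma asks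
    for.\<close>
  have mass: "(\<lambda>n. \<integral>x. P n (\<psi> n x) \<partial>M) \<longlonglongrightarrow> 1"
  proof (rule tendsto_quasi_invariant[OF tendsto_const c(2) c(1)])
    fix n
    show "1 \<le> c n * (\<integral>x. P n (\<psi> n x) \<partial>M)" "(\<integral>x. P n (\<psi> n x) \<partial>M) \<le> c n * 1"
      using q2[OF P(1)[of n] P(2)[of _ n], of n] q3[OF P(1)[of n] P(2)[of _ n], of n]
      unfolding P(3) by blast+
  qed
  have H: "(\<lambda>n. \<integral>x. P n (\<psi> n x) * (F n (\<psi> n x) + K) \<partial>M) \<longlonglongrightarrow> (\<integral>x. P' x * (F' x + K) \<partial>M)"
  proof (rule integral_density_tendsto[where K="2 * K"])
    show "(\<lambda>n. \<integral>x. P n (\<psi> n x) \<partial>M) \<longlonglongrightarrow> (\<integral>x. P' x \<partial>M)" using mass P'(3) by simp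
    show "(\<lambda>x. F n (\<psi> n x) + K) \<in> borel_measurable M" for n
      using measurable_compose[OF \<psi> Fm] .
    show "AE x in M. (\<lambda>n. F n (\<psi> n x) + K) \<longlonglongrightarrow> F' x + K"
      using lim(2) by eventually_elim (intro tendsto_intros)
  qed (use iP\<psi> P P' F K0 sp lim in auto)
  have "(\<lambda>n. \<integral>x. P n x * (F n x + K) \<partial>M) \<longlonglongrightarrow> (\<integral>x. P' x * (F' x + K) \<partial>M)"
  proof (rule tendsto_quasi_invariant[OF H c(2) c(1)])
    fix n
    have i: "integrable M (\<lambda>x. P n x * (F n x + K))" by (rule iH[OF P(1) Fm K0(3)])
    have nn: "0 \<le> P n x * (F n x + K)" if "x \<in> space M" for x using P(2)[OF that] K0(1)[OF that] by simp
    show "(\<integral>x. P n (\<psi> n x) * (F n (\<psi> n x) + K) \<partial>M) \<le> c n * (\<integral>x. P n x * (F n x + K) \<partial>M)"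
      "(\<integral>x. P n x * (F n x + K) \<partial>M) \<le> c n * (\<integral>x. P n (\<psi> n x) * (F n (\<psi> n x) + K) \<partial>M)"
      by (rule q2[OF i nn], assumption, rule q3[OF i nn], assumption)
  qed
  moreover have "(\<integral>x. P n x * (F n x + K) \<partial>M) = (\<integral>x. P n x * F n x \<partial>M) + K" for n
    using iH[OF P(1) F(1) K(1)] P by (simp add: distrib_left)
  moreover have "(\<integral>x. P' x * (F' x + K) \<partial>M) = (\<integral>x. P' x * F' x \<partial>M) + K"
    using iH[OF P'(1) F(2) K(2)] P' by (simp add: distrib_left)
  ultimately have "(\<lambda>n. (\<integral>x. P n x * F n x \<partial>M) + K - K) \<longlonglongrightarrow> (\<integral>x. P' x * F' x \<partial>M) + K - K"
    by (intro tendsto_diff tendsto_const) simp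
  then show ?thesis by simp
qed

subsection \<open>Surface measure on the unit sphere\<close>

text \<open>Only Borel sets are kept, so that bi-Lipschitz maps of the sphere are measurable.\<close>

definition sphere_measure :: "'a::euclidean_space measure" where
  "sphere_measure = distr (restrict_space surface_measure (sphere 0 1)) (restrict_space borel (sphere 0 1)) (\<lambda>x. x)"

lemma sets_sphere_measure [simp, measurable_cong]: "sets sphere_measure = sets (restrict_space borel (sphere 0 1))"
  and space_sphere_measure [simp]: "space sphere_measure = sphere 0 1"
  by (simp_all add: sphere_measure_def space_restrict_space)

context
  assumes dim: "2 \<le> DIM('a::euclidean_space)"
begin

lemma borel_subset_surface: "sets borel \<subseteq> sets (surface_measure :: 'a measure)"
  unfolding surface_measure_def using dim by (intro borel_subset_hausdorff) simp

lemma sphere_sets_surface: "sphere 0 1 \<in> sets (surface_measure :: 'a measure)"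
  using borel_subset_surface by (rule subsetD) simp

lemma id_measurable_sphere:
  "(\<lambda>x::'a. x) \<in> measurable (restrict_space surface_measure (sphere 0 1)) (restrict_space borel (sphere 0 1))"
proof (rule measurableI)
  fix A :: "'a set" assume "A \<in> sets (restrict_space borel (sphere 0 1))"
  then obtain A' where A': "A' \<in> sets borel" "A = A' \<inter> sphere 0 1"
    unfolding sets_restrict_space by auto
  then have "A \<in> sets surface_measure" using borel_subset_surface sphere_sets_surface by auto
  then show "(\<lambda>x. x) -` A \<inter> space (restrict_space surface_measure (sphere 0 1))
      \<in> sets (restrict_space surface_measure (sphere 0 1))"
    using A' sphere_sets_surface
    by (auto simp: sets_restrict_space_iff space_restrict_space surface_measure_def)
qed (auto simp: space_restrict_space)

lemma emeasure_sphere_measure: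
  assumes A: "A \<in> sets (sphere_measure :: 'a measure)"
  shows "emeasure sphere_measure A = hausdorff_outer (DIM('a) - 1) A"
proof -
  have A': "A \<in> sets surface_measure" "A \<subseteq> sphere 0 1"
    using A borel_subset_surface sphere_sets_surface by (auto simp: sets_restrict_space)
  have "emeasure sphere_measure A = emeasure (restrict_space surface_measure (sphere 0 1)) A"
    using A' A unfolding sphere_measure_def
    by (subst emeasure_distr[OF id_measurable_sphere])
       (auto simp: space_restrict_space surface_measure_def sphere_measure_def intro!: arg_cong2[of _ _ _ _ emeasure])
  also have "\<dots> = emeasure surface_measure A"
    using A' sphere_sets_surface by (intro emeasure_restrict_space) auto
  also have "\<dots> = hausdorff_outer (DIM('a) - 1) A"
    using A' dim unfolding surface_measure_def by (intro emeasure_hausdorff_measure) auto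
  finally show ?thesis .
qed

text \<open>\<open>A\<close> need not be Borel, so it is first enlarged to a Borel null set, which
  \<open>sphere_measure\<close> can see.\<close>

lemma AE_sphere_measure_not_in:
  assumes "hausdorff_outer (DIM('a) - 1) A = 0"
  shows "AE \<xi> in (sphere_measure :: 'a measure). \<xi> \<notin> A"
proof -
  obtain G where G: "G \<in> sets borel" "A \<subseteq> G" "hausdorff_outer (DIM('a) - 1) G = 0"
    using hausdorff_null_borel_cover[OF assms] .
  have meas: "G \<inter> sphere 0 1 \<in> sets (sphere_measure :: 'a measure)"
    using G by (auto simp: sets_restrict_space_iff)
  have "hausdorff_outer (DIM('a) - 1) (G \<inter> sphere 0 1) \<le> hausdorff_outer (DIM('a) - 1) G"
    by (rule hausdorff_outer_mono) simp
  then have "G \<inter> sphere 0 1 \<in> null_sets (sphere_measure :: 'a measure)"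
    using meas G(3) by (intro null_setsI) (auto simp: emeasure_sphere_measure)
  then show ?thesis by (rule AE_I') (use G(2) in auto)
qed

lemma hausdorff_outer_AE_surface:
  assumes "AE x in (surface_measure :: 'a measure). Q x"
  shows "hausdorff_outer (DIM('a) - 1) {x. \<not> Q x} = 0"
proof -
  obtain N where N: "{x \<in> space surface_measure. \<not> Q x} \<subseteq> N" "N \<in> null_sets (surface_measure :: 'a measure)"
    using assms by (auto elim!: AE_E simp: null_sets_def)
  have "hausdorff_outer (DIM('a) - 1) N = 0"
    using N(2) dim emeasure_hausdorff_measure[of "DIM('a) - 1" N]
    by (simp add: null_sets_def surface_measure_def)
  moreover have "{x. \<not> Q x} \<subseteq> N" using N(1) by (simp add: surface_measure_def)
  ultimately show ?thesis using hausdorff_outer_mono[of "{x. \<not> Q x}" N "DIM('a) - 1"] by simp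
qed

lemma
  fixes h :: "'a \<Rightarrow> real"
  assumes h: "h \<in> borel_measurable (restrict_space borel (sphere 0 1))"
  shows sphere_integrable_iff: "set_integrable surface_measure (sphere 0 1) h \<longleftrightarrow> integrable sphere_measure h"
    and sphere_integral_eq: "(LINT \<xi>:sphere 0 1|surface_measure. h \<xi>) = (\<integral>\<xi>. h \<xi> \<partial>sphere_measure)"
  using sphere_sets_surface
  unfolding sphere_measure_def set_integrable_def set_lebesgue_integral_def
  by (simp_all add: integrable_distr_eq[OF id_measurable_sphere h] integral_distr[OF id_measurable_sphere h]
      integrable_restrict_space integral_restrict_space)

lemma sphere_measure_lipschitz_le:
  fixes \<phi> :: "'a \<Rightarrow> 'a"
  assumes A: "A \<in> sets (sphere_measure :: 'a measure)" "\<phi> ` A \<in> sets (sphere_measure :: 'a measure)" and L: "0 < L"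
    and lip: "\<And>a b. norm a = 1 \<Longrightarrow> norm b = 1 \<Longrightarrow> dist (\<phi> a) (\<phi> b) \<le> L * dist a b"
  shows "emeasure sphere_measure (\<phi> ` A) \<le> ennreal (L ^ (DIM('a) - 1)) * emeasure sphere_measure A"
proof -
  have "A \<subseteq> sphere 0 1" using A by (auto simp: sets_restrict_space)
  then show ?thesis
    unfolding emeasure_sphere_measure[OF A(1)] emeasure_sphere_measure[OF A(2)]
    using dim L lip by (intro hausdorff_outer_lipschitz_image) (auto simp: subset_iff)
qed

text \<open>The \<psi>-preimage of a set is its \<phi>-image, so the Lipschitz bound of \<phi>
  controls the image measure from above; a set is the \<psi>-image of its own preimage, so the bound
  of \<psi> controls it from below. Each costs \<open>L\<close> to the power of the sphere's
  dimension. Comparison with a scaled measure passes from sets to integrals.\<close>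

lemma sphere_bilipschitz_quasi_invariant:
  fixes \<phi> \<psi> :: "'a \<Rightarrow> 'a"
  assumes L: "0 < L"
    and \<psi>: "\<And>a. norm a = 1 \<Longrightarrow> norm (\<psi> a) = 1 \<and> \<phi> (\<psi> a) = a"
    and \<phi>: "\<And>a. norm a = 1 \<Longrightarrow> norm (\<phi> a) = 1 \<and> \<psi> (\<phi> a) = a"
    and lip\<psi>: "\<And>a b. norm a = 1 \<Longrightarrow> norm b = 1 \<Longrightarrow> dist (\<psi> a) (\<psi> b) \<le> L * dist a b"
    and lip\<phi>: "\<And>a b. norm a = 1 \<Longrightarrow> norm b = 1 \<Longrightarrow> dist (\<phi> a) (\<phi> b) \<le> L * dist a b"
  shows "\<psi> \<in> measurable sphere_measure sphere_measure"
    and "h \<in> borel_measurable sphere_measure \<Longrightarrow>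
      (\<integral>\<^sup>+x. h (\<psi> x) \<partial>sphere_measure) \<le> ennreal (L ^ (DIM('a) - 1)) * (\<integral>\<^sup>+x. h x \<partial>sphere_measure)"
    and "h \<in> borel_measurable sphere_measure \<Longrightarrow>
      (\<integral>\<^sup>+x. h x \<partial>sphere_measure) \<le> ennreal (L ^ (DIM('a) - 1)) * (\<integral>\<^sup>+x. h (\<psi> x) \<partial>sphere_measure)"
proof -
  let ?S = "sphere_measure :: 'a measure" and ?c = "ennreal (L ^ (DIM('a) - 1))"
  have "continuous_on (sphere 0 1) \<psi>"
    using L lip\<psi> by (intro lipschitz_on_continuous_on[of L] lipschitz_onI) auto
  then have "\<psi> \<in> measurable (restrict_space borel (sphere 0 1)) (restrict_space borel (sphere 0 1))"
    using \<psi> by (intro measurable_restrict_space2 borel_measurable_continuous_on_restrict)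
       (auto simp: space_restrict_space)
  then show meas: "\<psi> \<in> measurable ?S ?S"
    by (simp cong: measurable_cong_sets)
  have vim: "\<psi> -` A \<inter> sphere 0 1 = \<phi> ` A" and im: "\<psi> ` (\<psi> -` A \<inter> sphere 0 1) = A" if "A \<in> sets ?S" for A
  proof -
    have sub: "A \<subseteq> sphere 0 1" using that by (auto simp: sets_restrict_space)
    show "\<psi> -` A \<inter> sphere 0 1 = \<phi> ` A"
    proof (intro set_eqI iffI)
      fix x assume "x \<in> \<psi> -` A \<inter> sphere 0 1"
      then show "x \<in> \<phi> ` A" using \<psi>[of x] by (auto intro!: image_eqI[of _ _ "\<psi> x"])
    next
      fix x assume "x \<in> \<phi> ` A"
      then show "x \<in> \<psi> -` A \<inter> sphere 0 1" using \<phi> sub by auto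
    qed
    show "\<psi> ` (\<psi> -` A \<inter> sphere 0 1) = A"
    proof (intro set_eqI iffI)
      fix x assume x: "x \<in> A"
      then have "norm x = 1" using sub by auto
      then show "x \<in> \<psi> ` (\<psi> -` A \<inter> sphere 0 1)"
        using \<phi>[of x] x by (intro image_eqI[of _ _ "\<phi> x"]) auto
    qed auto
  qed
  have pre: "\<psi> -` A \<inter> sphere 0 1 \<in> sets ?S" if "A \<in> sets ?S" for A
    using measurable_sets[OF meas that] by simp
  have em: "emeasure (distr ?S ?S \<psi>) A = emeasure ?S (\<psi> -` A \<inter> sphere 0 1)" if "A \<in> sets ?S" for A
    using emeasure_distr[OF meas that] by simp
  have 1: "emeasure (distr ?S ?S \<psi>) A \<le> ?c * emeasure ?S A" if "A \<in> sets ?S" for A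
    unfolding em[OF that] vim[OF that]
  proof (rule sphere_measure_lipschitz_le[OF that _ L])
    show "\<phi> ` A \<in> sets ?S" using pre[OF that] unfolding vim[OF that] .
  qed (rule lip\<phi>)
  have 2: "emeasure ?S A \<le> ?c * emeasure (distr ?S ?S \<psi>) A" if "A \<in> sets ?S" for A
  proof -
    have "emeasure ?S (\<psi> ` (\<psi> -` A \<inter> sphere 0 1)) \<le> ?c * emeasure ?S (\<psi> -` A \<inter> sphere 0 1)"
    proof (rule sphere_measure_lipschitz_le[OF pre[OF that] _ L])
      show "\<psi> ` (\<psi> -` A \<inter> sphere 0 1) \<in> sets ?S" unfolding im[OF that] by (rule that)
    qed (rule lip\<psi>)
    then show ?thesis unfolding im[OF that] em[OF that] .
  qed
  assume h: "h \<in> borel_measurable ?S"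
  have h': "h \<in> borel_measurable (distr ?S ?S \<psi>)" using h by simp
  have eq: "(\<integral>\<^sup>+x. h (\<psi> x) \<partial>?S) = (\<integral>\<^sup>+x. h x \<partial>distr ?S ?S \<psi>)"
    using nn_integral_distr[OF meas h'] by simp
  have "(\<integral>\<^sup>+x. h x \<partial>distr ?S ?S \<psi>) \<le> (\<integral>\<^sup>+x. h x \<partial>scale_measure ?c ?S)"
    using 1 by (intro nn_integral_mono_measure) (simp_all add: le_measure le_fun_def)
  then show "(\<integral>\<^sup>+x. h (\<psi> x) \<partial>?S) \<le> ?c * (\<integral>\<^sup>+x. h x \<partial>?S)"
    unfolding eq nn_integral_scale_measure[OF h] .
  have "(\<integral>\<^sup>+x. h x \<partial>?S) \<le> (\<integral>\<^sup>+x. h x \<partial>scale_measure ?c (distr ?S ?S \<psi>))"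
    using 2 by (intro nn_integral_mono_measure) (simp_all add: le_measure le_fun_def)
  then show "(\<integral>\<^sup>+x. h x \<partial>?S) \<le> ?c * (\<integral>\<^sup>+x. h (\<psi> x) \<partial>?S)"
    unfolding eq nn_integral_scale_measure[OF h'] .
qed

end

section \<open>Continuity of the scattering term\<close>

locale boundary_problem = transport \<Omega> \<Omega>0 N \<Omega>s l t \<mu>t \<mu>s p
  for \<Omega> \<Omega>0 :: "'a::euclidean_space set" and N \<Omega>s l t \<mu>t \<mu>s p +
  fixes f0 :: "'a \<times> 'a \<Rightarrow> real"
  assumes f0_bounded: "bounded (f0 ` Gamma_minus \<Omega>)"
    and f0_borel: "f0 \<in> borel_measurable (restrict_space borel (Gamma_minus \<Omega>))"
    and f0_continuous: "(AE x in surface_measure. x \<in> frontier \<Omega> \<longrightarrow>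
            continuous_on (Gamma_minus_pt \<Omega> x) (\<lambda>\<xi>. f0 (x, \<xi>))) \<or>
         (AE \<xi> in surface_measure. \<xi> \<in> sphere 0 1 \<longrightarrow>
            continuous_on (Gamma_minus_dir \<Omega> \<xi>) (\<lambda>x. f0 (x, \<xi>)))"
begin

definition G0 :: "'a \<times> 'a \<Rightarrow> real" where
  "G0 = (\<lambda>(x, \<xi>). f0 (\<pi> x \<xi>, \<xi>))"

text \<open>The shape shared by all iterates: attenuated transported data plus a bounded continuous
  correction. Averaging over directions turns exactly such functions into continuous ones
  below.\<close>

definition field :: "('a \<times> 'a \<Rightarrow> real) \<Rightarrow> bool" where
  "field F \<longleftrightarrow> (\<exists>b. continuous_on D b \<and> bounded (b ` D) \<and> (\<forall>z\<in>D. F z = exp (- B z) * G0 z + b z))"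

text \<open>Kept with \<open>surface_measure\<close>, as in the equation, so that it also applies to
  a competing solution, for which only integrability of the product with \<open>p\<close> is
  known.\<close>

definition S :: "('a \<times> 'a \<Rightarrow> real) \<Rightarrow> 'a \<times> 'a \<Rightarrow> real" where
  "S F = (\<lambda>(x, \<xi>). LINT \<xi>':sphere 0 1|surface_measure. p x \<xi> \<xi>' * F (x, \<xi>'))"

lemma phase_facts:
  assumes "x \<in> \<Omega>0" "norm \<xi> = 1"
  shows p_nonneg: "\<And>\<eta>. norm \<eta> = 1 \<Longrightarrow> 0 \<le> p x \<xi> \<eta>"
    and p_borel: "p x \<xi> \<in> borel_measurable (restrict_space borel (sphere 0 1))"
    and p_total: "(\<integral>\<eta>. p x \<xi> \<eta> \<partial>sphere_measure) = 1"
    and p_integrable: "integrable sphere_measure (p x \<xi>)"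
proof -
  note ph = phase[unfolded admissible_phase_function_def]
  have \<xi>: "\<xi> \<in> sphere 0 1" using assms by simp
  show "0 \<le> p x \<xi> \<eta>" if "norm \<eta> = 1" for \<eta>
  proof -
    have "\<eta> \<in> sphere 0 1" using that by simp
    then show ?thesis using ph \<xi> by blast
  qed
  have cont: "continuous_on (\<Omega>0 \<times> sphere 0 1 \<times> sphere 0 1) (\<lambda>(x, \<xi>, \<xi>'). p x \<xi> \<xi>')"
    using ph by blast
  have "continuous_on (sphere 0 1) (\<lambda>\<eta>. (\<lambda>(x, \<xi>, \<xi>'). p x \<xi> \<xi>') (x, \<xi>, \<eta>))"
    by (rule continuous_on_compose2[OF cont]) (use assms in \<open>auto intro!: continuous_intros\<close>)
  then show m: "p x \<xi> \<in> borel_measurable (restrict_space borel (sphere 0 1))"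
    by (intro borel_measurable_continuous_on_restrict) simp
  have "(LINT \<xi>':sphere 0 1|surface_measure. p x \<xi> \<xi>') = 1" using ph assms(1) \<xi> by blast
  then show 1: "(\<integral>\<eta>. p x \<xi> \<eta> \<partial>sphere_measure) = 1"
    by (simp add: sphere_integral_eq[OF dim m])
  \<comment> \<open>The Bochner integral of a non-integrable function is 0 by default, so the value
    1 already forces integrability.\<close>
  show "integrable sphere_measure (p x \<xi>)"
    using 1 not_integrable_integral_eq[of sphere_measure "p x \<xi>"] by auto
qed

lemma p_tendsto:
  assumes "x \<in> \<Omega>0" "norm \<xi> = 1" "norm \<eta> = 1"
    and "\<And>n. xn n \<in> \<Omega>0" "\<And>n. norm (\<xi>n n) = 1" "\<And>n. norm (\<eta>n n) = 1"
    and lim: "xn \<longlonglongrightarrow> x" "\<xi>n \<longlonglongrightarrow> \<xi>" "\<eta>n \<longlonglongrightarrow> \<eta>"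
  shows "(\<lambda>n. p (xn n) (\<xi>n n) (\<eta>n n)) \<longlonglongrightarrow> p x \<xi> \<eta>"
proof -
  have "continuous_on (\<Omega>0 \<times> sphere 0 1 \<times> sphere 0 1) (\<lambda>(x, \<xi>, \<xi>'). p x \<xi> \<xi>')"
    using phase unfolding admissible_phase_function_def by blast
  moreover have "(\<lambda>n. (xn n, \<xi>n n, \<eta>n n)) \<longlonglongrightarrow> (x, \<xi>, \<eta>)" by (intro tendsto_Pair lim)
  ultimately have "(\<lambda>n. (\<lambda>(x, \<xi>, \<xi>'). p x \<xi> \<xi>') (xn n, \<xi>n n, \<eta>n n)) \<longlonglongrightarrow> (\<lambda>(x, \<xi>, \<xi>'). p x \<xi> \<xi>') (x, \<xi>, \<eta>)"
    by (rule continuous_on_tendsto_compose) (use assms in auto)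
  then show ?thesis by simp
qed

lemma G0_bound: obtains K where "\<And>z. z \<in> D \<Longrightarrow> \<bar>G0 z\<bar> \<le> K"
proof -
  obtain K where K: "\<And>z. z \<in> \<Gamma> \<Longrightarrow> \<bar>f0 z\<bar> \<le> K"
    using f0_bounded unfolding bounded_iff by auto
  then have "\<bar>G0 z\<bar> \<le> K" if "z \<in> D" for z
    using entry_\<Gamma>[of "fst z" "snd z"] that by (auto simp: G0_def case_prod_beta)
  then show thesis by (rule that)
qed

lemma field_bound:
  assumes "field F"
  obtains K where "0 \<le> K" "\<And>z. z \<in> D \<Longrightarrow> \<bar>F z\<bar> \<le> K"
proof -
  obtain b where b: "bounded (b ` D)" "\<And>z. z \<in> D \<Longrightarrow> F z = exp (- B z) * G0 z + b z"
    using assms unfolding field_def by blast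
  obtain K1 where K1: "\<And>z. z \<in> D \<Longrightarrow> \<bar>b z\<bar> \<le> K1" using b(1) unfolding bounded_iff by auto
  obtain K2 where K2: "\<And>z. z \<in> D \<Longrightarrow> \<bar>G0 z\<bar> \<le> K2" by (rule G0_bound) blast
  show thesis
  proof (rule that)
    show "\<bar>F z\<bar> \<le> \<bar>exp (M * R) * K2 + K1\<bar>" if z: "z \<in> D" for z
    proof -
      have "\<bar>B z\<bar> \<le> M * R" using B_bound[of "fst z" "snd z"] z by simp
      then have "exp (- B z) \<le> exp (M * R)" by (simp add: abs_le_iff)
      then have "exp (- B z) * \<bar>G0 z\<bar> \<le> exp (M * R) * K2"
        using K2[OF z] by (intro mult_mono) auto
      moreover have "\<bar>F z\<bar> \<le> exp (- B z) * \<bar>G0 z\<bar> + \<bar>b z\<bar>"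
        unfolding b(2)[OF z] by (rule order_trans[OF abs_triangle_ineq]) (simp add: abs_mult)
      ultimately show ?thesis using K1[OF z] by linarith
    qed
  qed simp
qed

text \<open>Only the transported data need an argument: \<open>f0\<close> is Borel on \<Gamma>, and
  \<open>\<eta> \<mapsto> (\<pi> x \<eta>, \<eta>)\<close> is continuous from the sphere into
  \<Gamma>.\<close>

lemma field_borel:
  assumes F: "field F" and x: "x \<in> \<Omega>"
  shows "(\<lambda>\<eta>. F (x, \<eta>)) \<in> borel_measurable (restrict_space borel (sphere 0 1))"
proof -
  obtain b where b: "continuous_on D b" "\<And>z. z \<in> D \<Longrightarrow> F z = exp (- B z) * G0 z + b z"
    using F unfolding field_def by blast
  have D: "(x, \<eta>) \<in> D" if "\<eta> \<in> sphere 0 1" for \<eta> using D_interior[OF x, of \<eta>] that by simp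
  have slice: "(\<lambda>\<eta>. g (x, \<eta>)) \<in> borel_measurable (restrict_space borel (sphere 0 1))"
    if "continuous_on D g" for g :: "'a \<times> 'a \<Rightarrow> 'b::topological_space"
    by (intro borel_measurable_continuous_on_restrict continuous_on_compose2[OF that])
       (use D in \<open>auto intro!: continuous_intros\<close>)
  have [measurable]: "(\<lambda>\<eta>. B (x, \<eta>)) \<in> borel_measurable (restrict_space borel (sphere 0 1))"
    "(\<lambda>\<eta>. b (x, \<eta>)) \<in> borel_measurable (restrict_space borel (sphere 0 1))"
    by (intro slice continuous_B b)+
  have "(\<lambda>\<eta>. (\<pi> x \<eta>, \<eta>)) \<in> measurable (restrict_space borel (sphere 0 1)) (restrict_space borel \<Gamma>)"
  proof (rule measurable_restrict_space2)
    have "continuous_on D (\<lambda>z. (\<pi> (fst z) (snd z), snd z))"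
      by (intro continuous_intros continuous_entry)
    from slice[OF this] show "(\<lambda>\<eta>. (\<pi> x \<eta>, \<eta>)) \<in> borel_measurable (restrict_space borel (sphere 0 1))" by simp
  qed (use entry_\<Gamma> D in \<open>auto simp: space_restrict_space\<close>)
  from measurable_compose[OF this f0_borel]
  have [measurable]: "(\<lambda>\<eta>. G0 (x, \<eta>)) \<in> borel_measurable (restrict_space borel (sphere 0 1))"
    by (simp add: G0_def)
  have "(\<lambda>\<eta>. exp (- B (x, \<eta>)) * G0 (x, \<eta>) + b (x, \<eta>)) \<in> borel_measurable (restrict_space borel (sphere 0 1))"
    by measurable
  also have "?this \<longleftrightarrow> ?thesis"
    by (intro measurable_cong) (use b D in \<open>auto simp: space_restrict_space\<close>)
  finally show ?thesis .
qed

lemma phase_field_borel: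
  assumes F: "field F" and x: "x \<in> \<Omega>0" and \<xi>: "norm \<xi> = 1"
  shows "(\<lambda>\<eta>. p x \<xi> \<eta> * F (x, \<eta>)) \<in> borel_measurable (restrict_space borel (sphere 0 1))"
  using p_borel[OF x \<xi>] field_borel[OF F subsetD[OF \<Omega>0_subset x]] by measurable

lemma S_eq:
  assumes F: "field F" and x: "x \<in> \<Omega>0" and \<xi>: "norm \<xi> = 1"
  shows "S F (x, \<xi>) = (\<integral>\<eta>. p x \<xi> \<eta> * F (x, \<eta>) \<partial>sphere_measure)"
  unfolding S_def prod.case by (rule sphere_integral_eq[OF dim phase_field_borel[OF assms]])

lemma phase_field_integrable:
  assumes F: "field F" and x: "x \<in> \<Omega>0" and \<xi>: "norm \<xi> = 1"
  shows "integrable sphere_measure (\<lambda>\<eta>. p x \<xi> \<eta> * F (x, \<eta>))"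
proof -
  obtain K where K: "0 \<le> K" "\<And>z. z \<in> D \<Longrightarrow> \<bar>F z\<bar> \<le> K" by (rule field_bound[OF F]) blast
  show ?thesis
  proof (rule Bochner_Integration.integrable_bound[of sphere_measure "\<lambda>\<eta>. K * p x \<xi> \<eta>"])
    show "integrable sphere_measure (\<lambda>\<eta>. K * p x \<xi> \<eta>)"
      using p_integrable[OF x \<xi>] by simp
    show "(\<lambda>\<eta>. p x \<xi> \<eta> * F (x, \<eta>)) \<in> borel_measurable sphere_measure"
      using phase_field_borel[OF assms] by (simp cong: measurable_cong_sets)
    show "AE \<eta> in sphere_measure. norm (p x \<xi> \<eta> * F (x, \<eta>)) \<le> norm (K * p x \<xi> \<eta>)"
    proof (intro AE_I2)
      fix \<eta> :: 'a assume "\<eta> \<in> space sphere_measure"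
      then have "norm \<eta> = 1" by simp
      then have "\<bar>F (x, \<eta>)\<bar> \<le> K" "0 \<le> p x \<xi> \<eta>"
        using K(2) x \<Omega>0_subset by (auto intro: D_interior p_nonneg[OF x \<xi>])
      then show "norm (p x \<xi> \<eta> * F (x, \<eta>)) \<le> norm (K * p x \<xi> \<eta>)"
        using mult_right_mono[of "\<bar>F (x, \<eta>)\<bar>" K "p x \<xi> \<eta>"] K(1) by (simp add: abs_mult mult.commute)
    qed
  qed
qed

text \<open>The common core of the two boundary conditions: along \<open>xn n \<longlonglongrightarrow> x\<close> the integration variable
  may first be moved by bi-Lipschitz maps \<open>\<psi> n\<close> of the sphere with constants tending to 1.\<close>

lemma S_tendsto_perturbed:
  assumes F: "field F" and x: "x \<in> \<Omega>0" and \<xi>: "norm \<xi> = 1"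
    and xn: "\<And>n. xn n \<in> \<Omega>0" and \<xi>n: "\<And>n. norm (\<xi>n n) = 1"
    and lim: "xn \<longlonglongrightarrow> x" "\<xi>n \<longlonglongrightarrow> \<xi>"
    and L: "\<And>n. 0 < L n" "L \<longlonglongrightarrow> 1"
    and \<psi>: "\<And>n a. norm a = 1 \<Longrightarrow> norm (\<psi> n a) = 1 \<and> \<phi> n (\<psi> n a) = a"
    and \<phi>: "\<And>n a. norm a = 1 \<Longrightarrow> norm (\<phi> n a) = 1 \<and> \<psi> n (\<phi> n a) = a"
    and lip\<psi>: "\<And>n a b. norm a = 1 \<Longrightarrow> norm b = 1 \<Longrightarrow> dist (\<psi> n a) (\<psi> n b) \<le> L n * dist a b"
    and lip\<phi>: "\<And>n a b. norm a = 1 \<Longrightarrow> norm b = 1 \<Longrightarrow> dist (\<phi> n a) (\<phi> n b) \<le> L n * dist a b"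
    and near: "\<And>a. norm a = 1 \<Longrightarrow> (\<lambda>n. \<psi> n a) \<longlonglongrightarrow> a"
    and conv: "AE a in sphere_measure. (\<lambda>n. f0 (\<pi> (xn n) (\<psi> n a), \<psi> n a)) \<longlonglongrightarrow> f0 (\<pi> x a, a)"
  shows "(\<lambda>n. S F (xn n, \<xi>n n)) \<longlonglongrightarrow> S F (x, \<xi>)"
proof -
  obtain b where b: "continuous_on D b" "\<And>z. z \<in> D \<Longrightarrow> F z = exp (- B z) * G0 z + b z"
    using F unfolding field_def by blast
  obtain K where K: "0 \<le> K" "\<And>z. z \<in> D \<Longrightarrow> \<bar>F z\<bar> \<le> K" by (rule field_bound[OF F]) blast
  have D: "(x, a) \<in> D" "(xn n, a) \<in> D" if "norm a = 1" for a n
    using that x xn \<Omega>0_subset by (auto intro: D_interior)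
  have qi1: "\<psi> n \<in> measurable sphere_measure sphere_measure" for n
    by (rule sphere_bilipschitz_quasi_invariant(1)[where \<psi>="\<psi> n" and \<phi>="\<phi> n" and L="L n", OF dim L(1)],
          erule \<psi>, erule \<phi>, erule (1) lip\<psi>, erule (1) lip\<phi>)
  have qi2: "(\<integral>\<^sup>+x. h (\<psi> n x) \<partial>sphere_measure) \<le> ennreal (L n ^ (DIM('a) - 1)) * (\<integral>\<^sup>+x. h x \<partial>sphere_measure)"
    if h: "h \<in> borel_measurable sphere_measure" for n h
    by (rule sphere_bilipschitz_quasi_invariant(2)[where \<psi>="\<psi> n" and \<phi>="\<phi> n" and L="L n", OF dim L(1)],
          erule \<psi>, erule \<phi>, erule (1) lip\<psi>, erule (1) lip\<phi>, rule h)
  have qi3: "(\<integral>\<^sup>+x. h x \<partial>sphere_measure) \<le> ennreal (L n ^ (DIM('a) - 1)) * (\<integral>\<^sup>+x. h (\<psi> n x) \<partial>sphere_measure)"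
    if h: "h \<in> borel_measurable sphere_measure" for n h
    by (rule sphere_bilipschitz_quasi_invariant(3)[where \<psi>="\<psi> n" and \<phi>="\<phi> n" and L="L n", OF dim L(1)],
          erule \<psi>, erule \<phi>, erule (1) lip\<psi>, erule (1) lip\<phi>, rule h)
  have cm: "h \<in> borel_measurable sphere_measure \<longleftrightarrow> h \<in> borel_measurable (restrict_space borel (sphere 0 1))"
    for h :: "'a \<Rightarrow> real" by (simp cong: measurable_cong_sets)
  have "(\<lambda>n. \<integral>\<eta>. p (xn n) (\<xi>n n) \<eta> * F (xn n, \<eta>) \<partial>sphere_measure) \<longlonglongrightarrow> (\<integral>\<eta>. p x \<xi> \<eta> * F (x, \<eta>) \<partial>sphere_measure)"
  proof (rule integral_perturbed_tendsto[where \<psi>=\<psi> and c="\<lambda>n. L n ^ (DIM('a) - 1)" and K=K])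
    show "\<psi> n \<in> measurable sphere_measure sphere_measure" for n
      by (rule qi1)
    show "(\<integral>\<^sup>+x. h (\<psi> n x) \<partial>sphere_measure) \<le> ennreal (L n ^ (DIM('a) - 1)) * (\<integral>\<^sup>+x. h x \<partial>sphere_measure)"
      "(\<integral>\<^sup>+x. h x \<partial>sphere_measure) \<le> ennreal (L n ^ (DIM('a) - 1)) * (\<integral>\<^sup>+x. h (\<psi> n x) \<partial>sphere_measure)"
      if "h \<in> borel_measurable sphere_measure" for h n
      by (rule qi2[OF that], rule qi3[OF that])
    show "0 < L n ^ (DIM('a) - 1)" for n using L(1) by simp
    show "(\<lambda>n. L n ^ (DIM('a) - 1)) \<longlonglongrightarrow> 1" using tendsto_power[OF L(2), of "DIM('a) - 1"] by simp
    show "AE a in sphere_measure. (\<lambda>n. p (xn n) (\<xi>n n) (\<psi> n a)) \<longlonglongrightarrow> p x \<xi> a"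
      using \<psi> by (intro AE_I2 p_tendsto x \<xi> xn \<xi>n lim near) auto
    \<comment> \<open>The hypothesis \<open>conv\<close> is spent on the factor \<open>G0\<close>
      alone; \<open>B\<close> and \<open>b\<close> are continuous on \<open>D\<close>, so they
      converge along any sequence tending to \<open>(x, a)\<close>.\<close>
    from conv show "AE a in sphere_measure. (\<lambda>n. F (xn n, \<psi> n a)) \<longlonglongrightarrow> F (x, a)"
    proof (rule AE_mp, intro AE_I2 impI)
      fix a :: 'a assume "a \<in> space sphere_measure"
      then have a: "norm a = 1" by simp
      assume c: "(\<lambda>n. f0 (\<pi> (xn n) (\<psi> n a), \<psi> n a)) \<longlonglongrightarrow> f0 (\<pi> x a, a)"
      have D': "(xn n, \<psi> n a) \<in> D" for n using \<psi>[OF a] by (intro D) simp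
      have z: "(\<lambda>n. (xn n, \<psi> n a)) \<longlonglongrightarrow> (x, a)" by (intro tendsto_Pair lim near a)
      have cont: "(\<lambda>n. g (xn n, \<psi> n a)) \<longlonglongrightarrow> g (x, a)" if "continuous_on D g" for g :: "'a \<times> 'a \<Rightarrow> real"
        by (rule continuous_on_tendsto_compose[OF that z]) (use D' D a in auto)
      have "(\<lambda>n. exp (- B (xn n, \<psi> n a)) * G0 (xn n, \<psi> n a) + b (xn n, \<psi> n a))
          \<longlonglongrightarrow> exp (- B (x, a)) * G0 (x, a) + b (x, a)"
        using c by (intro tendsto_add[OF tendsto_mult[OF tendsto_exp[OF tendsto_minus[OF cont[OF continuous_B]]]] cont[OF b(1)]])
          (simp add: G0_def)
      then show "(\<lambda>n. F (xn n, \<psi> n a)) \<longlonglongrightarrow> F (x, a)"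
        unfolding b(2)[OF D'] b(2)[OF D(1)[OF a]] .
    qed
    show "\<bar>F (xn n, a)\<bar> \<le> K" "\<bar>F (x, a)\<bar> \<le> K" if "a \<in> space sphere_measure" for a n
      using that D by (auto intro!: K(2))
    show "(\<lambda>a. F (xn n, a)) \<in> borel_measurable sphere_measure" for n
      unfolding cm using xn \<Omega>0_subset by (intro field_borel F) auto
    show "(\<lambda>a. F (x, a)) \<in> borel_measurable sphere_measure"
      unfolding cm using x \<Omega>0_subset by (intro field_borel F) auto
    show "integrable sphere_measure (p x \<xi>)" "(\<integral>a. p x \<xi> a \<partial>sphere_measure) = 1"
      by (rule p_integrable[OF x \<xi>], rule p_total[OF x \<xi>])
    show "integrable sphere_measure (p (xn n) (\<xi>n n))" "(\<integral>a. p (xn n) (\<xi>n n) a \<partial>sphere_measure) = 1" for n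
      by (rule p_integrable[OF xn \<xi>n], rule p_total[OF xn \<xi>n])
    show "0 \<le> p x \<xi> a" "0 \<le> p (xn n) (\<xi>n n) a" if "a \<in> space sphere_measure" for a n
      using that p_nonneg[OF x \<xi>, of a] p_nonneg[OF xn \<xi>n, of a n n] by simp_all
  qed
  then show ?thesis using S_eq[OF F x \<xi>] S_eq[OF F xn \<xi>n] by simp
qed

text \<open>With data continuous in the position, directions stay fixed and the entry points
  converge. With data continuous in the direction, \<open>a\<close> is replaced by
  \<open>sgn (xn n - \<pi> x a)\<close>: seen from \<open>xn n\<close> in this direction, the entry
  point is \<open>\<pi> x a\<close> for every \<open>n\<close>, and only the direction
  varies.\<close>

lemma S_tendsto:
  assumes F: "field F" and x: "x \<in> \<Omega>0" and \<xi>: "norm \<xi> = 1"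
    and xn: "\<And>n. xn n \<in> \<Omega>0" and \<xi>n: "\<And>n. norm (\<xi>n n) = 1"
    and lim: "xn \<longlonglongrightarrow> x" "\<xi>n \<longlonglongrightarrow> \<xi>"
    and \<delta>: "0 < \<delta>" "cball x (2 * \<delta>) \<subseteq> \<Omega>" "\<And>n. dist (xn n) x < \<delta>"
  shows "(\<lambda>n. S F (xn n, \<xi>n n)) \<longlonglongrightarrow> S F (x, \<xi>)"
  using f0_continuous
proof
  assume ae: "AE \<xi> in surface_measure. \<xi> \<in> sphere 0 1 \<longrightarrow> continuous_on (Gamma_minus_dir \<Omega> \<xi>) (\<lambda>x. f0 (x, \<xi>))"
  show ?thesis
  proof (rule S_tendsto_perturbed[OF F x \<xi> xn \<xi>n lim, where \<psi>="\<lambda>n a. a" and \<phi>="\<lambda>n a. a" and L="\<lambda>n. 1"])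
    show "AE a in sphere_measure. (\<lambda>n. f0 (\<pi> (xn n) a, a)) \<longlonglongrightarrow> f0 (\<pi> x a, a)"
      using AE_sphere_measure_not_in[OF dim hausdorff_outer_AE_surface[OF dim ae]]
    proof (rule AE_mp, intro AE_I2 impI)
      fix a :: 'a
      assume "a \<in> space sphere_measure"
        and "a \<notin> {\<xi>. \<not> (\<xi> \<in> sphere 0 1 \<longrightarrow> continuous_on (Gamma_minus_dir \<Omega> \<xi>) (\<lambda>x. f0 (x, \<xi>)))}"
      then have a: "norm a = 1" and c: "continuous_on (Gamma_minus_dir \<Omega> a) (\<lambda>x. f0 (x, a))" by auto
      have D: "(x, a) \<in> D" "(xn n, a) \<in> D" for n
        using a x xn \<Omega>0_subset by (auto intro: D_interior)
      have "(\<lambda>n. \<pi> (fst (xn n, a)) (snd (xn n, a))) \<longlonglongrightarrow> \<pi> (fst (x, a)) (snd (x, a))"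
        by (rule continuous_on_tendsto_compose[OF continuous_entry]) (use D lim in \<open>auto intro!: tendsto_intros\<close>)
      then have "(\<lambda>n. \<pi> (xn n) a) \<longlonglongrightarrow> \<pi> x a" by simp
      then show "(\<lambda>n. f0 (\<pi> (xn n) a, a)) \<longlonglongrightarrow> f0 (\<pi> x a, a)"
        using entry_\<Gamma>[OF D(1)] entry_\<Gamma>[OF D(2)]
        by (intro continuous_on_tendsto_compose[OF c]) (auto simp: Gamma_minus_def Gamma_minus_dir_def)
    qed
  qed auto
next
  assume ae: "AE x in surface_measure. x \<in> frontier \<Omega> \<longrightarrow> continuous_on (Gamma_minus_pt \<Omega> x) (\<lambda>\<xi>. f0 (x, \<xi>))"
  define d where "d n = dist (xn n) x" for n
  have d0: "d \<longlonglongrightarrow> 0" unfolding d_def using lim(1) by (simp add: tendsto_dist_iff[symmetric])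
  have d: "d n < \<delta>" "0 \<le> d n" for n using \<delta>(3) by (auto simp: d_def)
  have in\<Omega>: "x \<in> \<Omega>" "xn n \<in> \<Omega>" for n using x xn \<Omega>0_subset by auto
  \<comment> \<open>The ball of radius \<open>2 * \<delta>\<close> contains balls of radius \<delta>
    around \<open>x\<close> and around every \<open>xn n\<close>, so the change of viewpoint and its
    inverse obey the same Lipschitz bound.\<close>
  have cb: "cball x \<delta> \<subseteq> closure \<Omega>" "cball (xn n) \<delta> \<subseteq> closure \<Omega>" for n
  proof -
    have "cball x \<delta> \<subseteq> cball x (2 * \<delta>)" using \<delta>(1) by (intro subset_cball) simp
    moreover have "cball (xn n) \<delta> \<subseteq> cball x (2 * \<delta>)" using \<delta>(3)[of n] by (intro cball_subset_cball_iff[THEN iffD2]) (auto simp: dist_commute)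
    ultimately show "cball x \<delta> \<subseteq> closure \<Omega>" "cball (xn n) \<delta> \<subseteq> closure \<Omega>" using \<delta>(2) closure_subset by blast+
  qed
  have fr: "\<pi> z a \<in> frontier \<Omega>" if "z \<in> \<Omega>" "norm a = 1" for z a
    using that by (intro entry_frontier D_interior)
  have swap: "norm (sgn (y - \<pi> z a)) = 1" "sgn (z - \<pi> y (sgn (y - \<pi> z a))) = a"
    if "y \<in> \<Omega>" "z \<in> \<Omega>" "norm a = 1" for y z a
  proof -
    have "y \<noteq> \<pi> z a" using frontier_disj[OF fr[OF that(2,3)]] that(1) by auto
    then show "norm (sgn (y - \<pi> z a)) = 1" by (simp add: norm_sgn)
    show "sgn (z - \<pi> y (sgn (y - \<pi> z a))) = a"
      unfolding entry_sgn(1)[OF that(1) fr[OF that(2,3)]] by (rule sgn_entry[OF that(2,3)])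
  qed
  show ?thesis
  proof (rule S_tendsto_perturbed[OF F x \<xi> xn \<xi>n lim,
        where \<psi>="\<lambda>n a. sgn (xn n - \<pi> x a)" and \<phi>="\<lambda>n a. sgn (x - \<pi> (xn n) a)" and L="\<lambda>n. (\<delta> + d n) / (\<delta> - d n)"])
    show "0 < (\<delta> + d n) / (\<delta> - d n)" for n using d[of n] by simp
    have "(\<lambda>n. (\<delta> + d n) / (\<delta> - d n)) \<longlonglongrightarrow> (\<delta> + 0) / (\<delta> - 0)"
      using \<delta>(1) by (intro tendsto_intros d0) auto
    then show "(\<lambda>n. (\<delta> + d n) / (\<delta> - d n)) \<longlonglongrightarrow> 1" using \<delta>(1) by simp
    show "norm (sgn (xn n - \<pi> x a)) = 1 \<and> sgn (x - \<pi> (xn n) (sgn (xn n - \<pi> x a))) = a"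
      "norm (sgn (x - \<pi> (xn n) a)) = 1 \<and> sgn (xn n - \<pi> x (sgn (x - \<pi> (xn n) a))) = a"
      if "norm a = 1" for a n
      using swap in\<Omega> that by blast+
    show "dist (sgn (xn n - \<pi> x a)) (sgn (xn n - \<pi> x b)) \<le> (\<delta> + d n) / (\<delta> - d n) * dist a b"
      if "norm a = 1" "norm b = 1" for a b n
      using change_viewpoint_lipschitz[OF cb(1) \<delta>(1) in\<Omega>(1) \<delta>(3) that] by (simp add: d_def)
    show "dist (sgn (x - \<pi> (xn n) a)) (sgn (x - \<pi> (xn n) b)) \<le> (\<delta> + d n) / (\<delta> - d n) * dist a b"
      if "norm a = 1" "norm b = 1" for a b n
      using change_viewpoint_lipschitz[OF cb(2) \<delta>(1) in\<Omega>(2) _ that, of x n] \<delta>(3)[of n]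
      by (simp add: d_def dist_commute)
    show near: "(\<lambda>n. sgn (xn n - \<pi> x a)) \<longlonglongrightarrow> a" if a: "norm a = 1" for a
    proof (subst tendsto_dist_iff, rule tendsto_sandwich[where f="\<lambda>_. 0" and h="\<lambda>n. d n / (\<delta> - d n)"])
      have "(\<lambda>n. d n / (\<delta> - d n)) \<longlonglongrightarrow> 0 / (\<delta> - 0)" using \<delta>(1) by (intro tendsto_intros d0) auto
      then show "(\<lambda>n. d n / (\<delta> - d n)) \<longlonglongrightarrow> 0" by simp
      show "eventually (\<lambda>n. dist (sgn (xn n - \<pi> x a)) a \<le> d n / (\<delta> - d n)) sequentially"
        using change_viewpoint_near[OF cb(1) \<delta>(1) in\<Omega>(1) \<delta>(3) a] by (simp add: d_def)
    qed auto
    \<comment> \<open>A direction \<open>a\<close> is harmful only if its entry point from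
      \<open>x\<close> is bad, that is, if \<open>a\<close> lies in the image of \<open>bad\<close>
      under \<open>\<lambda>y. sgn (x - y)\<close>; this image is null because the map is Lipschitz
      on the boundary.\<close>
    define bad where "bad = {y. \<not> (y \<in> frontier \<Omega> \<longrightarrow> continuous_on (Gamma_minus_pt \<Omega> y) (\<lambda>\<xi>. f0 (y, \<xi>)))}"
    have "hausdorff_outer (DIM('a) - 1) bad = 0"
      unfolding bad_def by (rule hausdorff_outer_AE_surface[OF dim ae])
    moreover have "hausdorff_outer (DIM('a) - 1) ((\<lambda>y. sgn (x - y)) ` bad)
        \<le> ennreal ((1 / \<delta>) ^ (DIM('a) - 1)) * hausdorff_outer (DIM('a) - 1) bad"
    proof (rule hausdorff_outer_lipschitz_image)
      have "cball x (2 * \<delta>) \<subseteq> \<Omega>" "ball x \<delta> \<subseteq> cball x (2 * \<delta>)" using \<delta> by auto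
      then have "ball x \<delta> \<subseteq> \<Omega>" by blast
      then show "dist (sgn (x - y)) (sgn (x - y')) \<le> (1 / \<delta>) * dist y y'" if "y \<in> bad" "y' \<in> bad" for y y'
        using that \<delta>(1) by (intro boundary_direction_lipschitz) (auto simp: bad_def)
    qed (use dim \<delta> in auto)
    ultimately have "hausdorff_outer (DIM('a) - 1) ((\<lambda>y. sgn (x - y)) ` bad) = 0" by simp
    from AE_sphere_measure_not_in[OF dim this]
    show "AE a in sphere_measure. (\<lambda>n. f0 (\<pi> (xn n) (sgn (xn n - \<pi> x a)), sgn (xn n - \<pi> x a))) \<longlonglongrightarrow> f0 (\<pi> x a, a)"
    proof (rule AE_mp, intro AE_I2 impI)
      fix a :: 'a
      assume "a \<in> space sphere_measure" and na: "a \<notin> (\<lambda>y. sgn (x - y)) ` bad"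
      then have a: "norm a = 1" by simp
      note y = fr[OF in\<Omega>(1) a]
      have "\<pi> x a \<notin> bad" using na sgn_entry[OF in\<Omega>(1) a] by (metis image_eqI)
      then have c: "continuous_on (Gamma_minus_pt \<Omega> (\<pi> x a)) (\<lambda>\<xi>. f0 (\<pi> x a, \<xi>))"
        using y by (simp add: bad_def)
      have "(\<lambda>n. f0 (\<pi> x a, sgn (xn n - \<pi> x a))) \<longlonglongrightarrow> f0 (\<pi> x a, a)"
        using entry_sgn(2)[OF in\<Omega>(2) y] entry_\<Gamma>[OF D_interior[OF in\<Omega>(1) a]]
        by (intro continuous_on_tendsto_compose[OF c near[OF a]]) (auto simp: Gamma_minus_def Gamma_minus_pt_def)
      then show "(\<lambda>n. f0 (\<pi> (xn n) (sgn (xn n - \<pi> x a)), sgn (xn n - \<pi> x a))) \<longlonglongrightarrow> f0 (\<pi> x a, a)"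
        unfolding entry_sgn(1)[OF in\<Omega>(2) y] .
    qed
  qed
qed

lemma continuous_S:
  assumes F: "field F"
  shows "continuous_on (\<Omega>0 \<times> sphere 0 1) (S F)"
  unfolding continuous_on_sequentially
proof (intro allI ballI impI)
  fix z :: "nat \<Rightarrow> 'a \<times> 'a" and w assume w: "w \<in> \<Omega>0 \<times> sphere 0 1" and "(\<forall>n. z n \<in> \<Omega>0 \<times> sphere 0 1) \<and> z \<longlonglongrightarrow> w"
  then have z: "\<And>n. z n \<in> \<Omega>0 \<times> sphere 0 1" "z \<longlonglongrightarrow> w" by auto
  obtain x \<xi> where w_eq: "w = (x, \<xi>)" by force
  have x: "x \<in> \<Omega>0" "norm \<xi> = 1" using w by (auto simp: w_eq)
  obtain e where e: "0 < e" "cball x e \<subseteq> \<Omega>"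
    using open_contains_cball[of \<Omega>] op x(1) \<Omega>0_subset by blast
  have lim: "(\<lambda>n. fst (z n)) \<longlonglongrightarrow> x" "(\<lambda>n. snd (z n)) \<longlonglongrightarrow> \<xi>"
    using tendsto_fst[OF z(2)] tendsto_snd[OF z(2)] by (simp_all add: w_eq)
  \<comment> \<open>Only a tail of the sequence stays within \<delta> = \<open>e / 2\<close> of
    \<open>x\<close>; an offset of \<open>k\<close> makes the bound hold for all indices.\<close>
  obtain k where k: "\<And>n. k \<le> n \<Longrightarrow> dist (fst (z n)) x < e / 2"
    using lim(1) e(1) unfolding lim_sequentially by (meson half_gt_zero)
  have zn: "fst (z n) \<in> \<Omega>0" "norm (snd (z n)) = 1" for n using z(1)[of n] by auto
  have "(\<lambda>n. S F (fst (z (n + k)), snd (z (n + k)))) \<longlonglongrightarrow> S F (x, \<xi>)"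
    by (rule S_tendsto[OF F x zn(1) zn(2), where \<delta>="e / 2"])
       (use lim e k in \<open>auto intro: LIMSEQ_ignore_initial_segment[where k=k]\<close>)
  then have "(\<lambda>n. (S F \<circ> z) (n + k)) \<longlonglongrightarrow> S F w" by (simp add: w_eq)
  then show "(S F \<circ> z) \<longlonglongrightarrow> S F w" by (rule LIMSEQ_offset)
qed

section \<open>Fixed point, uniqueness and discontinuities\<close>

text \<open>\<open>p x \<xi>\<close> is a probability density. Integrability is assumed for the
  product only and not derived from regularity of \<open>h\<close>, so the bound covers differences
  of iterates and of arbitrary solutions.\<close>

lemma phase_average_bound:
  assumes x: "x \<in> \<Omega>0" and \<xi>: "norm \<xi> = 1"
    and h: "set_integrable surface_measure (sphere 0 1) (\<lambda>\<eta>. p x \<xi> \<eta> * h \<eta>)"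
    and C: "\<And>\<eta>. norm \<eta> = 1 \<Longrightarrow> \<bar>h \<eta>\<bar> \<le> C"
  shows "\<bar>LINT \<eta>:sphere 0 1|surface_measure. p x \<xi> \<eta> * h \<eta>\<bar> \<le> C"
proof -
  have ip: "set_integrable surface_measure (sphere 0 1) (p x \<xi>)"
    using sphere_integrable_iff[OF dim p_borel[OF x \<xi>]] p_integrable[OF x \<xi>] by simp
  have le: "\<bar>p x \<xi> \<eta> * h \<eta>\<bar> \<le> C * p x \<xi> \<eta>" if "\<eta> \<in> sphere 0 1" for \<eta>
    using mult_right_mono[OF C[of \<eta>] p_nonneg[OF x \<xi>, of \<eta>]] p_nonneg[OF x \<xi>, of \<eta>] that
    by (simp add: abs_mult mult.commute)
  have "(LINT \<eta>:sphere 0 1|surface_measure. p x \<xi> \<eta> * h \<eta>) \<le> (LINT \<eta>:sphere 0 1|surface_measure. C * p x \<xi> \<eta>)"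
  proof (rule set_integral_mono[OF h set_integrable_mult_right[OF ip]])
    show "p x \<xi> \<eta> * h \<eta> \<le> C * p x \<xi> \<eta>" if "\<eta> \<in> sphere 0 1" for \<eta> using le[OF that] by linarith
  qed
  moreover have "(LINT \<eta>:sphere 0 1|surface_measure. - C * p x \<xi> \<eta>) \<le> (LINT \<eta>:sphere 0 1|surface_measure. p x \<xi> \<eta> * h \<eta>)"
  proof (rule set_integral_mono[OF set_integrable_mult_right[OF ip] h])
    show "- C * p x \<xi> \<eta> \<le> p x \<xi> \<eta> * h \<eta>" if "\<eta> \<in> sphere 0 1" for \<eta> using le[OF that] by linarith
  qed
  moreover have "(LINT \<eta>:sphere 0 1|surface_measure. p x \<xi> \<eta>) = 1"
    using sphere_integral_eq[OF dim p_borel[OF x \<xi>]] p_total[OF x \<xi>] by simp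
  ultimately show ?thesis unfolding set_integral_mult_right by (simp add: abs_le_iff)
qed

lemma phase_field_set_integrable:
  assumes "field F" "x \<in> \<Omega>0" "norm \<xi> = 1"
  shows "set_integrable surface_measure (sphere 0 1) (\<lambda>\<eta>. p x \<xi> \<eta> * F (x, \<eta>))"
  using sphere_integrable_iff[OF dim phase_field_borel[OF assms]] phase_field_integrable[OF assms] by simp

lemma interior_D: "x \<in> \<Omega>0 \<Longrightarrow> norm \<xi> = 1 \<Longrightarrow> (x, \<xi>) \<in> D"
  using \<Omega>0_subset by (auto intro: D_interior)

lemma S_bound:
  assumes F: "field F" and K: "\<And>z. z \<in> D \<Longrightarrow> \<bar>F z\<bar> \<le> K" and x: "x \<in> \<Omega>0" "norm \<xi> = 1"
  shows "\<bar>S F (x, \<xi>)\<bar> \<le> K"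
  unfolding S_def prod.case
  using x by (intro phase_average_bound phase_field_set_integrable F K interior_D)

text \<open>Scattering term times the integrating factor \<open>exp B\<close>. Thus
  \<open>exp (- B) * \<Lambda> (emission F)\<close> is the Duhamel term: everything scattered into
  the ray before the point, attenuated from there on.\<close>

definition emission :: "('a \<times> 'a \<Rightarrow> real) \<Rightarrow> 'a \<times> 'a \<Rightarrow> real" where
  "emission F = (\<lambda>(x, \<xi>). exp (B (x, \<xi>)) * (\<mu>s x * S F (x, \<xi>)))"

lemma source_emission:
  assumes F: "field F"
  shows "source (emission F)"
proof -
  obtain K where K: "0 \<le> K" "\<And>z. z \<in> D \<Longrightarrow> \<bar>F z\<bar> \<le> K" by (rule field_bound[OF F]) blast
  have "\<bar>emission F (x, \<xi>)\<bar> \<le> exp (M * R) * (M * K)" if \<xi>: "norm \<xi> = 1" for x \<xi>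
  proof (cases "x \<in> \<Omega>0")
    case True
    have "B (x, \<xi>) \<le> M * R" using B_bound[OF interior_D[OF True \<xi>]] by (simp add: abs_le_iff)
    moreover have "\<mu>s x \<le> M" using \<mu>s_le_\<mu>t \<mu>t_le_M by (rule order_trans)
    ultimately have "exp (B (x, \<xi>)) * (\<mu>s x * \<bar>S F (x, \<xi>)\<bar>) \<le> exp (M * R) * (M * K)"
      using S_bound[OF F K(2) True \<xi>] \<mu>s_nonneg[of x] by (intro mult_mono) auto
    then show ?thesis using \<mu>s_nonneg[of x] by (simp add: emission_def abs_mult)
  next
    case False
    have "0 \<le> M" using \<mu>t_nonneg \<mu>t_le_M by (rule order_trans)
    then show ?thesis using False K(1) by (simp add: emission_def \<mu>_outside)
  qed
  moreover have "continuous_on (\<Omega>0 \<times> sphere 0 1) (emission F)"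
  proof -
    have "continuous_on (\<Omega>0 \<times> sphere 0 1) B"
      using interior_D by (intro continuous_on_subset[OF continuous_B]) auto
    moreover have "continuous_on (\<Omega>0 \<times> sphere 0 1) (\<lambda>z. \<mu>s (fst z))"
      by (rule continuous_on_compose2[OF continuous_\<mu>(2)]) (auto intro!: continuous_intros)
    ultimately have "continuous_on (\<Omega>0 \<times> sphere 0 1) (\<lambda>z. exp (B z) * (\<mu>s (fst z) * S F z))"
      by (intro continuous_intros continuous_S F)
    then show ?thesis by (simp add: emission_def case_prod_beta)
  qed
  moreover have "emission F (x, \<xi>) = 0" if "x \<notin> \<Omega>0" for x \<xi> using that by (simp add: emission_def \<mu>_outside)
  ultimately show ?thesis unfolding source_def by blast
qed

definition H :: "('a \<times> 'a \<Rightarrow> real) \<Rightarrow> 'a \<times> 'a \<Rightarrow> real" where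
  "H F z = exp (- B z) * \<Lambda> (emission F) z"

lemma continuous_H: "field F \<Longrightarrow> continuous_on D (H F)"
  unfolding H_def by (intro continuous_intros continuous_B continuous_\<Lambda> source_emission)

lemma bounded_H:
  assumes F: "field F"
  shows "bounded (H F ` D)"
proof -
  obtain K where K: "\<And>x \<xi>. norm \<xi> = 1 \<Longrightarrow> \<bar>emission F (x, \<xi>)\<bar> \<le> K"
    using source_emission[OF F] unfolding source_def by auto
  have "\<bar>H F z\<bar> \<le> exp (M * R) * (K * R)" if z: "z \<in> D" for z
  proof -
    have "\<bar>B z\<bar> \<le> M * R" using B_bound[of "fst z" "snd z"] z by simp
    then have "exp (- B z) \<le> exp (M * R)" by (simp add: abs_le_iff)
    moreover have "\<bar>\<Lambda> (emission F) z\<bar> \<le> K * R"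
      using \<Lambda>_bound[OF source_emission[OF F] K, of "fst z" "snd z"] z by simp
    ultimately have "exp (- B z) * \<bar>\<Lambda> (emission F) z\<bar> \<le> exp (M * R) * (K * R)"
      by (intro mult_mono) auto
    then show ?thesis by (simp add: H_def abs_mult)
  qed
  then show ?thesis by (intro boundedI[of _ "exp (M * R) * (K * R)"]) auto
qed

lemma H_\<Gamma>: "z \<in> \<Gamma> \<Longrightarrow> H F z = 0"
  by (cases z) (simp add: H_def \<Lambda>_\<Gamma>)

lemma H_derivative:
  assumes F: "field F" and x: "x \<in> \<Omega>0" "norm \<xi> = 1"
  shows "((\<lambda>s. H F (x + s *\<^sub>R \<xi>, \<xi>)) has_real_derivative \<mu>s x * S F (x, \<xi>) - \<mu>t x * H F (x, \<xi>)) (at 0)"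
proof -
  note b = B_derivative[OF x] and l = \<Lambda>_derivative[OF source_emission[OF F] x]
  have "((\<lambda>s. exp (- B (x + s *\<^sub>R \<xi>, \<xi>)) * \<Lambda> (emission F) (x + s *\<^sub>R \<xi>, \<xi>)) has_real_derivative
      exp (- B (x + 0 *\<^sub>R \<xi>, \<xi>)) * - \<mu>t x * \<Lambda> (emission F) (x + 0 *\<^sub>R \<xi>, \<xi>) + emission F (x, \<xi>) * exp (- B (x + 0 *\<^sub>R \<xi>, \<xi>))) (at 0)"
    by (rule DERIV_mult[OF DERIV_fun_exp[OF DERIV_minus[OF b]] l])
  moreover have "exp (- B (x, \<xi>)) * emission F (x, \<xi>) = \<mu>s x * S F (x, \<xi>)"
    by (simp add: emission_def exp_minus)
  ultimately show ?thesis by (simp add: H_def algebra_simps)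
qed

lemma DERIV_along_shift:
  fixes \<phi> :: "'a \<times> 'a \<Rightarrow> real"
  assumes "((\<lambda>r. \<phi> ((y + s *\<^sub>R \<xi>) + r *\<^sub>R \<xi>, \<xi>)) has_real_derivative d) (at 0)"
  shows "((\<lambda>r. \<phi> (y + r *\<^sub>R \<xi>, \<xi>)) has_real_derivative d) (at s)"
proof -
  have "((\<lambda>r. \<phi> (y + (r + s) *\<^sub>R \<xi>, \<xi>)) has_real_derivative d) (at 0)"
    using assms by (simp add: algebra_simps)
  then show ?thesis using DERIV_shift[of "\<lambda>r. \<phi> (y + r *\<^sub>R \<xi>, \<xi>)" d 0 s] by simp
qed

lemma continuous_on_ray:
  fixes \<phi> :: "'a \<times> 'a \<Rightarrow> real"
  assumes y: "(y, \<xi>) \<in> \<Gamma>" and D: "(y + u *\<^sub>R \<xi>, \<xi>) \<in> D" and \<phi>: "continuous_on D \<phi>"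
  shows "continuous_on {0..u} (\<lambda>s. \<phi> (y + s *\<^sub>R \<xi>, \<xi>))"
  using \<Gamma>_forward_D[OF y D] by (intro continuous_on_compose2[OF \<phi>] continuous_intros) auto

text \<open>Along a ray the difference \<open>h\<close> satisfies
  \<open>h' + \<mu>t * h = \<mu>s * S (F1 - F2)\<close> and vanishes at the entry point; \<mu>s
  \<le> \<mu>t turns the bound \<open>\<mu>s * C\<close> of the right-hand side into the one the ray
  estimate expects.\<close>

lemma H_contraction:
  assumes F: "field F1" "field F2" and C: "\<And>z. z \<in> D \<Longrightarrow> \<bar>F1 z - F2 z\<bar> \<le> C" and D: "(x, \<xi>) \<in> D"
  shows "\<bar>H F1 (x, \<xi>) - H F2 (x, \<xi>)\<bar> \<le> q * C"
proof -
  define y u where "y = \<pi> x \<xi>" and "u = \<tau> x \<xi>"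
  have y: "(y, \<xi>) \<in> \<Gamma>" using entry_\<Gamma>[OF D] by (simp add: y_def)
  have x_eq: "y + u *\<^sub>R \<xi> = x" by (simp add: y_def u_def entry_def)
  have u: "0 \<le> u" using back_time_nonneg[OF D] by (simp add: u_def)
  have \<xi>: "norm \<xi> = 1" by (rule D_norm[OF D])
  have D': "(y + u *\<^sub>R \<xi>, \<xi>) \<in> D" using D by (simp add: x_eq)
  let ?h = "\<lambda>s. H F1 (y + s *\<^sub>R \<xi>, \<xi>) - H F2 (y + s *\<^sub>R \<xi>, \<xi>)"
  have "\<bar>?h u\<bar> \<le> q * C"
  proof (rule contraction_along_ray[OF y D' u])
    show "0 \<le> C" using order_trans[OF abs_ge_zero C[OF D]] .
    show "continuous_on {0..u} ?h" by (intro continuous_intros continuous_on_ray[OF y D'] continuous_H F)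
    show "?h 0 = 0" using y by (simp add: H_\<Gamma>)
    fix s assume in0: "y + s *\<^sub>R \<xi> \<in> \<Omega>0"
    let ?x = "y + s *\<^sub>R \<xi>"
    let ?d = "\<lambda>F. \<mu>s ?x * S F (?x, \<xi>) - \<mu>t ?x * H F (?x, \<xi>)"
    have "(?h has_real_derivative ?d F1 - ?d F2) (at s)"
      by (intro DERIV_diff DERIV_along_shift[where \<phi>="H F1", OF H_derivative[OF F(1) in0 \<xi>]]
          DERIV_along_shift[where \<phi>="H F2", OF H_derivative[OF F(2) in0 \<xi>]])
    moreover have "?d F1 - ?d F2 + \<mu>t ?x * ?h s = \<mu>s ?x * (S F1 (?x, \<xi>) - S F2 (?x, \<xi>))"
      by (simp add: algebra_simps)
    moreover have "\<bar>\<mu>s ?x * (S F1 (?x, \<xi>) - S F2 (?x, \<xi>))\<bar> \<le> C * \<mu>t ?x"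
    proof -
      note int = phase_field_set_integrable[OF F(1) in0 \<xi>] phase_field_set_integrable[OF F(2) in0 \<xi>]
      have "S F1 (?x, \<xi>) - S F2 (?x, \<xi>) = (LINT \<eta>:sphere 0 1|surface_measure. p ?x \<xi> \<eta> * (F1 (?x, \<eta>) - F2 (?x, \<eta>)))"
        unfolding S_def prod.case right_diff_distrib by (rule set_integral_diff(2)[OF int, symmetric])
      also have "\<bar>\<dots>\<bar> \<le> C"
      proof (rule phase_average_bound[OF in0 \<xi>])
        show "set_integrable surface_measure (sphere 0 1) (\<lambda>\<eta>. p ?x \<xi> \<eta> * (F1 (?x, \<eta>) - F2 (?x, \<eta>)))"
          unfolding right_diff_distrib by (rule set_integral_diff(1)[OF int])
      qed (intro C interior_D in0)
      finally have "\<mu>s ?x * \<bar>S F1 (?x, \<xi>) - S F2 (?x, \<xi>)\<bar> \<le> \<mu>t ?x * C"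
        by (intro mult_mono \<mu>s_le_\<mu>t \<mu>t_nonneg abs_ge_zero)
      then show ?thesis using \<mu>s_nonneg[of ?x] by (simp add: abs_mult mult.commute[of C])
    qed
    ultimately show "\<exists>d. (?h has_real_derivative d) (at s) \<and> \<bar>d + \<mu>t ?x * ?h s\<bar> \<le> C * \<mu>t ?x"
      by (intro exI[of _ "?d F1 - ?d F2"] conjI) (assumption, simp only:)
  qed
  then show ?thesis by (simp add: x_eq)
qed

definition F0 :: "'a \<times> 'a \<Rightarrow> real" where
  "F0 z = exp (- B z) * G0 z"

lemma field_F0_plus: "continuous_on D b \<Longrightarrow> bounded (b ` D) \<Longrightarrow> field (\<lambda>z. F0 z + b z)"
  unfolding field_def F0_def by blast

text \<open>Banach's iteration on bounded continuous functions on \<open>D\<close>: successive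
  iterates differ by at most \<open>q ^ n * C\<close>, so by the Weierstrass test the telescoping
  series converges uniformly, which preserves continuity and boundedness.\<close>

lemma fixed_point:
  obtains b where "continuous_on D b" "bounded (b ` D)" "\<And>z. z \<in> D \<Longrightarrow> b z = H (\<lambda>z. F0 z + b z) z"
proof -
  define T where "T b = H (\<lambda>z. F0 z + b z)" for b
  define b where "b n = (T ^^ n) (\<lambda>z. 0)" for n
  have b0: "b 0 = (\<lambda>z. 0)" and bSuc: "b (Suc n) = T (b n)" for n by (simp_all add: b_def)
  have good: "continuous_on D (b n) \<and> bounded (b n ` D)" for n
  proof (induction n)
    case 0
    have "bounded ((\<lambda>z. 0::real) ` D)" by (rule bounded_subset[of "{0}"]) auto
    then show ?case by (simp add: b0)
  next
    case (Suc n)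
    then show ?case unfolding bSuc T_def by (simp add: continuous_H bounded_H field_F0_plus)
  qed
  then have fld: "field (\<lambda>z. F0 z + b n z)" for n by (simp add: field_F0_plus)
  obtain C where C: "\<And>z. z \<in> D \<Longrightarrow> \<bar>b 1 z\<bar> \<le> C"
    using good[of 1] unfolding bounded_iff by auto
  have step: "\<bar>b (Suc n) z - b n z\<bar> \<le> q ^ n * C" if "z \<in> D" for n z
    using that
  proof (induction n arbitrary: z)
    case 0
    then show ?case using C by (simp add: b0)
  next
    case (Suc n)
    have "\<bar>b (Suc (Suc n)) (fst z, snd z) - b (Suc n) (fst z, snd z)\<bar> \<le> q * (q ^ n * C)"
      unfolding bSuc[of "Suc n"] bSuc[of n] T_def
    proof (rule H_contraction[OF _ fld])
      show "field (\<lambda>z. F0 z + H (\<lambda>z. F0 z + b n z) z)"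
        using fld[of "Suc n"] by (simp add: bSuc T_def)
      show "\<bar>F0 z + H (\<lambda>z. F0 z + b n z) z - (F0 z + b n z)\<bar> \<le> q ^ n * C" if "z \<in> D" for z
        using Suc.IH[OF that] by (simp add: bSuc T_def)
    qed (use Suc.prems in simp)
    then show ?case by simp
  qed
  define l where "l z = (\<Sum>i. b (Suc i) z - b i z)" for z
  have "summable (\<lambda>n. q ^ n * C)"
    using q_nonneg q_less_1 by (intro summable_mult2 summable_geometric) simp
  then have "uniform_limit D (\<lambda>n z. \<Sum>i<n. b (Suc i) z - b i z) l sequentially"
    unfolding l_def using step by (intro Weierstrass_m_test) auto
  moreover have "(\<Sum>i<n. b (Suc i) z - b i z) = b n z" for n z
    by (subst sum_lessThan_telescope) (simp add: b0)
  ultimately have lim: "uniform_limit D b l sequentially" by simp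
  have cl: "continuous_on D l"
    using good by (intro uniform_limit_theorem[OF _ lim]) auto
  have close: "eventually (\<lambda>n. \<forall>z\<in>D. \<bar>b n z - l z\<bar> < e) sequentially" if "0 < e" for e
    using uniform_limitD[OF lim that] by (simp add: dist_real_def)
  have bl: "bounded (l ` D)"
  proof -
    obtain n where n: "\<And>z. z \<in> D \<Longrightarrow> \<bar>b n z - l z\<bar> < 1"
      using eventually_happens'[OF sequentially_bot close[of 1]] by auto
    obtain K where "\<And>z. z \<in> D \<Longrightarrow> \<bar>b n z\<bar> \<le> K"
      using good[of n] unfolding bounded_iff by auto
    then have "\<bar>l z\<bar> \<le> K + 1" if "z \<in> D" for z using n[OF that] that by fastforce
    then show ?thesis by (intro boundedI[of _ "K + 1"]) auto
  qed
  have fl: "field (\<lambda>z. F0 z + l z)" by (rule field_F0_plus[OF cl bl])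
  show thesis
  proof (rule that[OF cl bl])
    fix z assume z: "z \<in> D"
    \<comment> \<open>\<open>b (Suc n)\<close> is the image of \<open>b n\<close>: half of
      \<open>e\<close> pays for its distance to the limit, and by contraction the other half pays
      for the distance of the images of \<open>b n\<close> and \<open>l\<close>.\<close>
    have "\<bar>l z - H (\<lambda>z. F0 z + l z) z\<bar> \<le> 0 + e" if e: "0 < e" for e
    proof -
      have "eventually (\<lambda>n. (\<forall>z\<in>D. \<bar>b n z - l z\<bar> < e / 2) \<and> (\<forall>z\<in>D. \<bar>b (Suc n) z - l z\<bar> < e / 2)) sequentially"
        using e close[of "e / 2"] eventually_sequentially_Suc[of "\<lambda>n. \<forall>z\<in>D. \<bar>b n z - l z\<bar> < e / 2"]
        by (intro eventually_conj) simp_all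
      then obtain n where n: "\<And>z. z \<in> D \<Longrightarrow> \<bar>b n z - l z\<bar> < e / 2" "\<And>z. z \<in> D \<Longrightarrow> \<bar>b (Suc n) z - l z\<bar> < e / 2"
        using eventually_happens'[OF sequentially_bot] by blast
      have "\<bar>H (\<lambda>z. F0 z + b n z) (fst z, snd z) - H (\<lambda>z. F0 z + l z) (fst z, snd z)\<bar> \<le> q * (e / 2)"
        using n(1) z by (intro H_contraction[OF fld fl]) (auto simp: less_imp_le)
      also have "\<dots> \<le> e / 2" using q_less_1 e by (simp add: mult_left_le_one_le q_nonneg)
      finally have "\<bar>b (Suc n) z - H (\<lambda>z. F0 z + l z) z\<bar> \<le> e / 2" by (simp add: bSuc T_def)
      then show ?thesis using n(2)[OF z] by linarith
    qed
    then have "\<bar>l z - H (\<lambda>z. F0 z + l z) z\<bar> \<le> 0" by (rule field_le_epsilon)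
    then show "l z = H (\<lambda>z. F0 z + l z) z" by simp
  qed
qed

section \<open>The fixed point solves the boundary value problem\<close>

lemma entry_const:
  assumes D: "(x, \<xi>) \<in> D" "(x + s *\<^sub>R \<xi>, \<xi>) \<in> D"
  shows "\<pi> (x + s *\<^sub>R \<xi>) \<xi> = \<pi> x \<xi>"
\<comment> \<open>The forward shift lemma needs a nonnegative time; if
  \<open>\<tau> x \<xi> + s\<close> is negative, the two points exchange roles.\<close>
proof (cases "0 \<le> \<tau> x \<xi> + s")
  case True
  have "x + s *\<^sub>R \<xi> = \<pi> x \<xi> + (\<tau> x \<xi> + s) *\<^sub>R \<xi>" by (simp add: entry_def algebra_simps)
  then show ?thesis using entry_\<Gamma>_shift[OF entry_\<Gamma>[OF D(1)], of "\<tau> x \<xi> + s"] True D(2) by simp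
next
  case False
  let ?x = "x + s *\<^sub>R \<xi>"
  have "x = \<pi> ?x \<xi> + (\<tau> ?x \<xi> - s) *\<^sub>R \<xi>" by (simp add: entry_def algebra_simps)
  moreover have "0 \<le> \<tau> ?x \<xi> - s"
    using False back_time_nonneg[OF D(1)] back_time_nonneg[OF D(2)] by linarith
  ultimately show ?thesis using entry_\<Gamma>_shift[OF entry_\<Gamma>[OF D(2)], of "\<tau> ?x \<xi> - s"] D(1) by simp
qed

text \<open>Near \<open>x\<close> the ray stays in \<Omega>0 and \<open>G0\<close> is constant on
  it, however irregular \<open>f0\<close> may be, so only the attenuation is differentiated.\<close>

lemma F0_derivative:
  assumes x: "x \<in> \<Omega>0" "norm \<xi> = 1"
  shows "((\<lambda>s. F0 (x + s *\<^sub>R \<xi>, \<xi>)) has_real_derivative - \<mu>t x * F0 (x, \<xi>)) (at 0)"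
proof -
  have "((\<lambda>s. exp (- B (x + s *\<^sub>R \<xi>, \<xi>)) * G0 (x, \<xi>)) has_real_derivative
      exp (- B (x + 0 *\<^sub>R \<xi>, \<xi>)) * - \<mu>t x * G0 (x, \<xi>)) (at 0)"
    by (rule DERIV_cmult_right[OF DERIV_fun_exp[OF DERIV_minus[OF B_derivative[OF x]]]])
  then have 1: "((\<lambda>s. exp (- B (x + s *\<^sub>R \<xi>, \<xi>)) * G0 (x, \<xi>)) has_real_derivative - \<mu>t x * F0 (x, \<xi>)) (at 0)"
    by (simp add: F0_def mult_ac)
  obtain e where e: "0 < e" "\<And>s. \<bar>s\<bar> < e \<Longrightarrow> x + s *\<^sub>R \<xi> \<in> \<Omega>0"
    using open_line_nbhd[OF open_\<Omega>0 x(1)] by blast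
  have "eventually (\<lambda>s. \<bar>s\<bar> < e) (nhds 0)"
    using e eventually_nhds_metric[of "\<lambda>s. \<bar>s\<bar> < e" "0::real"] by (auto simp: dist_real_def)
  then have ev: "eventually (\<lambda>s. F0 (x + s *\<^sub>R \<xi>, \<xi>) = exp (- B (x + s *\<^sub>R \<xi>, \<xi>)) * G0 (x, \<xi>)) (nhds 0)"
    by eventually_elim (use e x in \<open>simp add: F0_def G0_def entry_const interior_D\<close>)
  show ?thesis using DERIV_cong_ev[OF refl ev refl] 1 by blast
qed

text \<open>Strict monotonicity leaves no interface time between two consecutive ones, and the point
  at time \<open>t x \<xi> j\<close> is still in the closure, so the segment ends no later than the
  backward exit time.\<close>

lemma back_segment_interior:
  assumes x: "x \<in> \<Omega>0" "norm \<xi> = 1" and j: "j \<in> {1..l x \<xi>}" and s: "s \<in> {t x \<xi> (j - 1)<..<t x \<xi> j}"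
  shows "x - s *\<^sub>R \<xi> \<in> \<Omega>0"
proof -
  have x': "x \<in> \<Omega>" using x \<Omega>0_subset by blast
  have gc: "t x \<xi> 0 = 0" "0 \<le> t x \<xi> 1" and mono: "strict_mono_on {1..l x \<xi>} (t x \<xi>)"
    and iff: "\<And>s. 0 \<le> s \<Longrightarrow> x - s *\<^sub>R \<xi> \<in> frontier \<Omega>0 \<longleftrightarrow> (\<exists>j\<in>{1..l x \<xi>}. s = t x \<xi> j)"
    using gconvex x' x(2) unfolding generalized_convexity_def by auto
  have tj: "0 \<le> t x \<xi> i" if "i \<in> {1..l x \<xi>}" for i
    using gc(2) strict_mono_on_leD[OF mono, of 1 i] that by auto
  \<comment> \<open>For \<open>j = 1\<close> the lower end is \<open>t x \<xi> 0 = 0\<close>, a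
    convention that lies outside the index range of the strictly increasing times.\<close>
  have "0 \<le> t x \<xi> (j - 1)"
  proof (cases "j = 1")
    case False
    then have "j - 1 \<in> {1..l x \<xi>}" using j by (cases j) auto
    then show ?thesis by (rule tj)
  qed (simp add: gc(1))
  then have s0: "0 \<le> s" using s by simp
  have "x - t x \<xi> j *\<^sub>R \<xi> \<in> closure \<Omega>"
    using iff[of "t x \<xi> j"] tj[OF j] j by (auto simp: frontier_\<Omega>0_iff)
  then have "t x \<xi> j \<le> \<tau> x \<xi>" using tj[OF j] by (intro back_time_upper[OF interior_D[OF x]])
  then have "x - s *\<^sub>R \<xi> \<in> \<Omega>" using s s0 by (intro back_path_interior[OF interior_D[OF x]]) auto
  moreover have "x - s *\<^sub>R \<xi> \<notin> frontier \<Omega>0"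
  proof
    assume "x - s *\<^sub>R \<xi> \<in> frontier \<Omega>0"
    then obtain i where i: "i \<in> {1..l x \<xi>}" "s = t x \<xi> i" using iff[OF s0] by blast
    have "i < j" using s i j strict_mono_on_leD[OF mono, of j i] by force
    moreover have "\<not> i \<le> j - 1" using s i j strict_mono_on_leD[OF mono, of i "j - 1"] by force
    ultimately show False by simp
  qed
  ultimately show ?thesis using closure_subset by (auto simp: frontier_\<Omega>0_iff)
qed

lemma slice_D: "(x, \<xi>) \<in> D \<Longrightarrow> y \<in> \<Omega> \<union> Gamma_minus_dir \<Omega> \<xi> \<Longrightarrow> (y, \<xi>) \<in> D"
  by (auto simp: phase_domain_def Gamma_minus_def Gamma_minus_dir_def)

text \<open>\<open>f\<close> is written with \<open>H\<close> in place of \<open>b\<close>: the two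
  agree only on \<open>D\<close>, and \<open>H_derivative\<close> then applies along the whole line
  without first confining it to \<open>D\<close>.\<close>

lemma is_solutionI:
  assumes b: "continuous_on D b" "bounded (b ` D)" and f: "f = (\<lambda>z. F0 z + H (\<lambda>z. F0 z + b z) z)"
    and fp: "\<And>z. z \<in> D \<Longrightarrow> b z = H (\<lambda>z. F0 z + b z) z"
  shows "is_solution \<Omega> \<Omega>0 l t \<mu>t \<mu>s p f0 f"
proof -
  let ?F = "\<lambda>z. F0 z + b z"
  have F: "field ?F" by (rule field_F0_plus[OF b])
  have fF: "f z = ?F z" if "z \<in> D" for z using fp[OF that] by (simp add: f)
  have ff: "field f" unfolding f by (intro field_F0_plus continuous_H bounded_H F)
  have Sf: "S ?F (x, \<xi>) = S f (x, \<xi>)" if "x \<in> \<Omega>0" for x \<xi>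
    unfolding S_def prod.case using fF interior_D[OF that]
    by (intro set_lebesgue_integral_cong) (auto simp: sphere_sets_surface[OF dim])
  have der: "(along f x \<xi> has_real_derivative \<mu>s x * S f (x, \<xi>) - \<mu>t x * f (x, \<xi>)) (at 0)"
    if x: "x \<in> \<Omega>0" "norm \<xi> = 1" for x \<xi>
    using DERIV_add[OF F0_derivative[OF x] H_derivative[OF F x]] Sf[OF x(1), of \<xi>]
    by (simp add: along_def f algebra_simps)
  have dd: "dir_deriv f x \<xi> = \<mu>s x * S f (x, \<xi>) - \<mu>t x * f (x, \<xi>)"
    if x: "x \<in> \<Omega>0" "norm \<xi> = 1" for x \<xi>
    using DERIV_imp_deriv[OF der[OF x]] by (simp add: dir_deriv_def)
  have line: "continuous_on ({x + s *\<^sub>R \<xi> | s. True} \<inter> (\<Omega> \<union> Gamma_minus_dir \<Omega> \<xi>)) (\<lambda>y. f (y, \<xi>))"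
    (is "continuous_on ?L _") if D: "(x, \<xi>) \<in> D" for x \<xi>
  proof -
    have LD: "(y, \<xi>) \<in> D" if "y \<in> ?L" for y using slice_D[OF D] that by blast
    have slice: "continuous_on ?L (\<lambda>y. g (y, \<xi>))" if "continuous_on D g" for g :: "'a \<times> 'a \<Rightarrow> real"
      using LD by (intro continuous_on_compose2[OF that] continuous_intros) auto
    \<comment> \<open>On one line the transported datum is the constant
      \<open>G0 (x, \<xi>)\<close>, so \<open>f\<close> is continuous along the line even where it
      jumps across neighbouring lines.\<close>
    have "continuous_on ?L (\<lambda>y. exp (- B (y, \<xi>)) * G0 (x, \<xi>) + H ?F (y, \<xi>))"
      by (intro continuous_intros slice continuous_B continuous_H F)
    moreover have "exp (- B (y, \<xi>)) * G0 (x, \<xi>) + H ?F (y, \<xi>) = f (y, \<xi>)" if y: "y \<in> ?L" for y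
    proof -
      obtain s where "y = x + s *\<^sub>R \<xi>" using y by blast
      then have "\<pi> y \<xi> = \<pi> x \<xi>" using entry_const[OF D, of s] LD[OF y] by simp
      then show ?thesis by (simp add: f F0_def G0_def)
    qed
    ultimately show ?thesis by (rule continuous_on_eq)
  qed
  obtain K where K: "\<And>z. z \<in> D \<Longrightarrow> \<bar>f z\<bar> \<le> K" by (rule field_bound[OF ff]) blast
  show ?thesis
    unfolding is_solution_def
  proof (intro conjI ballI)
    show "bounded (f ` D)" using K by (intro boundedI[of _ K]) auto
  next
    fix x \<xi> :: 'a assume "x \<in> \<Omega>0" "\<xi> \<in> sphere 0 1"
    then have x: "x \<in> \<Omega>0" "norm \<xi> = 1" by auto
    show "set_integrable surface_measure (sphere 0 1) (\<lambda>\<xi>'. p x \<xi> \<xi>' * f (x, \<xi>'))"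
      by (rule phase_field_set_integrable[OF ff x])
    show "along f x \<xi> field_differentiable at 0"
      using der[OF x] by (auto simp: field_differentiable_def)
    show "dir_deriv f x \<xi> + \<mu>t x * f (x, \<xi>) = \<mu>s x * (LINT \<xi>':sphere 0 1|surface_measure. p x \<xi> \<xi>' * f (x, \<xi>'))"
      by (simp add: dd[OF x] S_def)
    fix j assume j: "j \<in> {1..l x \<xi>}"
    let ?I = "{x - s *\<^sub>R \<xi> | s. s \<in> {t x \<xi> (j - 1)<..<t x \<xi> j}}"
    have I: "?I \<subseteq> \<Omega>0" using back_segment_interior[OF x j] by blast
    have "?I \<subseteq> {x + s *\<^sub>R \<xi> | s. True} \<inter> (\<Omega> \<union> Gamma_minus_dir \<Omega> \<xi>)"
    proof
      fix y assume y: "y \<in> ?I"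
      then obtain s where "y = x - s *\<^sub>R \<xi>" by blast
      then have "y = x + (- s) *\<^sub>R \<xi>" by simp
      then show "y \<in> {x + s *\<^sub>R \<xi> | s. True} \<inter> (\<Omega> \<union> Gamma_minus_dir \<Omega> \<xi>)"
        using I y \<Omega>0_subset by blast
    qed
    then have "continuous_on ?I (\<lambda>y. f (y, \<xi>))"
      by (rule continuous_on_subset[OF line[OF interior_D[OF x]]])
    moreover have "continuous_on ?I (\<lambda>y. S f (y, \<xi>))"
      using I x by (intro continuous_on_compose2[OF continuous_S[OF ff]] continuous_intros) auto
    ultimately have "continuous_on ?I (\<lambda>y. \<mu>s y * S f (y, \<xi>) - \<mu>t y * f (y, \<xi>))"
      by (intro continuous_intros continuous_on_subset[OF continuous_\<mu>(1) I] continuous_on_subset[OF continuous_\<mu>(2) I])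
    then show "continuous_on ?I (\<lambda>y. dir_deriv f y \<xi>)"
      by (rule continuous_on_eq) (use dd I x in auto)
  next
    fix z assume z: "z \<in> \<Gamma>"
    then show "f z = f0 z"
      by (cases z) (simp add: f H_\<Gamma> F0_def G0_def \<Gamma>_entry B_def \<Lambda>_\<Gamma>)
  next
    fix z assume "z \<in> D"
    then show "case z of (x, \<xi>) \<Rightarrow> continuous_on ({x + s *\<^sub>R \<xi> | s. True} \<inter> (\<Omega> \<union> Gamma_minus_dir \<Omega> \<xi>)) (\<lambda>y. f (y, \<xi>))"
      using line by (cases z) simp
  qed
qed

section \<open>Uniqueness\<close>

lemma solution_facts:
  assumes sol: "is_solution \<Omega> \<Omega>0 l t \<mu>t \<mu>s p f0 f"
  shows "bounded (f ` D)" "\<And>z. z \<in> \<Gamma> \<Longrightarrow> f z = f0 z"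
    and "\<And>x \<xi>. x \<in> \<Omega>0 \<Longrightarrow> norm \<xi> = 1 \<Longrightarrow> set_integrable surface_measure (sphere 0 1) (\<lambda>\<xi>'. p x \<xi> \<xi>' * f (x, \<xi>'))"
    and "\<And>x \<xi>. x \<in> \<Omega>0 \<Longrightarrow> norm \<xi> = 1 \<Longrightarrow>
      ((\<lambda>s. f (x + s *\<^sub>R \<xi>, \<xi>)) has_real_derivative \<mu>s x * S f (x, \<xi>) - \<mu>t x * f (x, \<xi>)) (at 0)"
    and "\<And>y \<xi> u. (y, \<xi>) \<in> \<Gamma> \<Longrightarrow> (y + u *\<^sub>R \<xi>, \<xi>) \<in> D \<Longrightarrow> continuous_on {0..u} (\<lambda>s. f (y + s *\<^sub>R \<xi>, \<xi>))"
proof -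
  note s = sol[unfolded is_solution_def]
  show "bounded (f ` D)" using s by blast
  show "f z = f0 z" if "z \<in> \<Gamma>" for z using s that by blast
  fix x \<xi> :: 'a assume x: "x \<in> \<Omega>0" "norm \<xi> = 1"
  then have \<xi>: "\<xi> \<in> sphere 0 1" by simp
  show "set_integrable surface_measure (sphere 0 1) (\<lambda>\<xi>'. p x \<xi> \<xi>' * f (x, \<xi>'))"
    using s x(1) \<xi> by blast
  have "along f x \<xi> field_differentiable at 0" using s x(1) \<xi> by blast
  then have "(along f x \<xi> has_real_derivative dir_deriv f x \<xi>) (at 0)"
    unfolding dir_deriv_def by (simp add: DERIV_deriv_iff_field_differentiable)
  moreover have "dir_deriv f x \<xi> + \<mu>t x * f (x, \<xi>) = \<mu>s x * S f (x, \<xi>)"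
    unfolding S_def prod.case using s x(1) \<xi> by blast
  then have "dir_deriv f x \<xi> = \<mu>s x * S f (x, \<xi>) - \<mu>t x * f (x, \<xi>)" by simp
  ultimately show "((\<lambda>s. f (x + s *\<^sub>R \<xi>, \<xi>)) has_real_derivative \<mu>s x * S f (x, \<xi>) - \<mu>t x * f (x, \<xi>)) (at 0)"
    by (simp add: along_def)
next
  fix y \<xi> u assume y: "(y, \<xi>) \<in> \<Gamma>" and D: "(y + u *\<^sub>R \<xi>, \<xi>) \<in> D"
  have "\<forall>(x, \<xi>)\<in>D. continuous_on ({x + s *\<^sub>R \<xi> | s. True} \<inter> (\<Omega> \<union> Gamma_minus_dir \<Omega> \<xi>)) (\<lambda>y. f (y, \<xi>))"
    using sol unfolding is_solution_def by blast
  then have c: "continuous_on ({y + s *\<^sub>R \<xi> | s. True} \<inter> (\<Omega> \<union> Gamma_minus_dir \<Omega> \<xi>)) (\<lambda>y. f (y, \<xi>))"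
    using subsetD[OF \<Gamma>_subset_D y] by blast
  have "y + s *\<^sub>R \<xi> \<in> \<Omega> \<union> Gamma_minus_dir \<Omega> \<xi>" if "s \<in> {0..u}" for s
    using D_cases[OF \<Gamma>_forward_D[OF y D, of s]] that by (auto simp: Gamma_minus_def Gamma_minus_dir_def)
  then have "(\<lambda>s. y + s *\<^sub>R \<xi>) ` {0..u} \<subseteq> {y + s *\<^sub>R \<xi> | s. True} \<inter> (\<Omega> \<union> Gamma_minus_dir \<Omega> \<xi>)"
    by blast
  then show "continuous_on {0..u} (\<lambda>s. f (y + s *\<^sub>R \<xi>, \<xi>))"
    by (intro continuous_on_compose2[OF c] continuous_intros)
qed

text \<open>The same ray inequality as for two iterates, but derived from the differential equation
  itself: a competing solution is not known to be a \<open>field\<close> or to satisfy an integral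
  formula.\<close>

lemma solution_contraction:
  assumes sol: "is_solution \<Omega> \<Omega>0 l t \<mu>t \<mu>s p f0 f" "is_solution \<Omega> \<Omega>0 l t \<mu>t \<mu>s p f0 g"
    and C: "\<And>z. z \<in> D \<Longrightarrow> \<bar>f z - g z\<bar> \<le> C" and D: "(x, \<xi>) \<in> D"
  shows "\<bar>f (x, \<xi>) - g (x, \<xi>)\<bar> \<le> q * C"
proof -
  note f = solution_facts[OF sol(1)] and g = solution_facts[OF sol(2)]
  define y u where "y = \<pi> x \<xi>" and "u = \<tau> x \<xi>"
  have y: "(y, \<xi>) \<in> \<Gamma>" using entry_\<Gamma>[OF D] by (simp add: y_def)
  have x_eq: "y + u *\<^sub>R \<xi> = x" by (simp add: y_def u_def entry_def)
  have u: "0 \<le> u" using back_time_nonneg[OF D] by (simp add: u_def)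
  have \<xi>: "norm \<xi> = 1" by (rule D_norm[OF D])
  have D': "(y + u *\<^sub>R \<xi>, \<xi>) \<in> D" using D by (simp add: x_eq)
  let ?h = "\<lambda>s. f (y + s *\<^sub>R \<xi>, \<xi>) - g (y + s *\<^sub>R \<xi>, \<xi>)"
  have "\<bar>?h u\<bar> \<le> q * C"
  proof (rule contraction_along_ray[OF y D' u])
    show "0 \<le> C" using order_trans[OF abs_ge_zero C[OF D]] .
    show "continuous_on {0..u} ?h" by (intro continuous_intros f(5) g(5) y D')
    show "?h 0 = 0" using f(2)[OF y] g(2)[OF y] by simp
    fix s assume in0: "y + s *\<^sub>R \<xi> \<in> \<Omega>0"
    let ?x = "y + s *\<^sub>R \<xi>"
    let ?d = "\<lambda>F. \<mu>s ?x * S F (?x, \<xi>) - \<mu>t ?x * F (?x, \<xi>)"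
    have "(?h has_real_derivative ?d f - ?d g) (at s)"
      by (intro DERIV_diff DERIV_along_shift[where \<phi>=f, OF f(4)[OF in0 \<xi>]]
          DERIV_along_shift[where \<phi>=g, OF g(4)[OF in0 \<xi>]])
    moreover have "?d f - ?d g + \<mu>t ?x * ?h s = \<mu>s ?x * (S f (?x, \<xi>) - S g (?x, \<xi>))"
      by (simp add: algebra_simps)
    moreover have "\<bar>\<mu>s ?x * (S f (?x, \<xi>) - S g (?x, \<xi>))\<bar> \<le> C * \<mu>t ?x"
    proof -
      note int = f(3)[OF in0 \<xi>] g(3)[OF in0 \<xi>]
      have "S f (?x, \<xi>) - S g (?x, \<xi>) = (LINT \<eta>:sphere 0 1|surface_measure. p ?x \<xi> \<eta> * (f (?x, \<eta>) - g (?x, \<eta>)))"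
        unfolding S_def prod.case right_diff_distrib by (rule set_integral_diff(2)[OF int, symmetric])
      also have "\<bar>\<dots>\<bar> \<le> C"
      proof (rule phase_average_bound[OF in0 \<xi>])
        show "set_integrable surface_measure (sphere 0 1) (\<lambda>\<eta>. p ?x \<xi> \<eta> * (f (?x, \<eta>) - g (?x, \<eta>)))"
          unfolding right_diff_distrib by (rule set_integral_diff(1)[OF int])
      qed (intro C interior_D in0)
      finally have "\<mu>s ?x * \<bar>S f (?x, \<xi>) - S g (?x, \<xi>)\<bar> \<le> \<mu>t ?x * C"
        by (intro mult_mono \<mu>s_le_\<mu>t \<mu>t_nonneg abs_ge_zero)
      then show ?thesis using \<mu>s_nonneg[of ?x] by (simp add: abs_mult mult.commute[of C])
    qed
    ultimately show "\<exists>d. (?h has_real_derivative d) (at s) \<and> \<bar>d + \<mu>t ?x * ?h s\<bar> \<le> C * \<mu>t ?x"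
      by (intro exI[of _ "?d f - ?d g"] conjI) (assumption, simp only:)
  qed
  then show ?thesis by (simp add: x_eq)
qed

text \<open>The supremum \<open>C\<close> of the difference is finite, as solutions are bounded, and
  satisfies \<open>C \<le> q * C\<close> with \<open>q < 1\<close>.\<close>

lemma solution_unique:
  assumes sol: "is_solution \<Omega> \<Omega>0 l t \<mu>t \<mu>s p f0 f" "is_solution \<Omega> \<Omega>0 l t \<mu>t \<mu>s p f0 g" and z: "z \<in> D"
  shows "f z = g z"
proof -
  obtain K1 where K1: "\<And>z. z \<in> D \<Longrightarrow> \<bar>f z\<bar> \<le> K1"
    using solution_facts(1)[OF sol(1)] unfolding bounded_iff by auto
  obtain K2 where K2: "\<And>z. z \<in> D \<Longrightarrow> \<bar>g z\<bar> \<le> K2"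
    using solution_facts(1)[OF sol(2)] unfolding bounded_iff by auto
  define C where "C = (SUP z\<in>D. \<bar>f z - g z\<bar>)"
  have "bdd_above ((\<lambda>z. \<bar>f z - g z\<bar>) ` D)"
  proof (rule bdd_aboveI2)
    show "\<bar>f z - g z\<bar> \<le> K1 + K2" if "z \<in> D" for z using K1[OF that] K2[OF that] by linarith
  qed
  then have C: "\<bar>f z - g z\<bar> \<le> C" if "z \<in> D" for z unfolding C_def using that by (intro cSUP_upper)
  have "\<bar>f z - g z\<bar> \<le> q * C" if "z \<in> D" for z
    using solution_contraction[OF sol C, of "fst z" "snd z"] that by simp
  then have "C \<le> q * C" unfolding C_def using z by (intro cSUP_least) auto
  then have "C * (1 - q) \<le> 0" by (simp add: algebra_simps)
  then have "C \<le> 0" using q_less_1 by (simp add: mult_le_0_iff)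
  then show ?thesis using C[OF z] by simp
qed

text \<open>Continuity of the entry point gives the direction from \<open>f0\<close> to
  \<open>G0\<close>. Conversely, inflow points near \<open>(\<pi> x \<xi>, \<xi>)\<close> are pushed
  forward by the fixed time \<open>\<tau> x \<xi>\<close>; the resulting points tend to
  \<open>(x, \<xi>)\<close>, and \<open>G0\<close> there recovers \<open>f0\<close> at the inflow
  points.\<close>

lemma continuous_G0_iff:
  assumes D: "(x, \<xi>) \<in> D"
  shows "continuous (at (x, \<xi>) within D) G0 \<longleftrightarrow> continuous (at (\<pi> x \<xi>, \<xi>) within \<Gamma>) f0"
proof
  assume c: "continuous (at (x, \<xi>) within D) G0"
  show "continuous (at (\<pi> x \<xi>, \<xi>) within \<Gamma>) f0"
    unfolding continuous_within_sequentially
  proof (intro allI impI)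
    fix X assume X: "(\<forall>n. X n \<in> \<Gamma>) \<and> X \<longlonglongrightarrow> (\<pi> x \<xi>, \<xi>)"
    let ?u = "\<tau> x \<xi>"
    define Y where "Y n = (fst (X n) + ?u *\<^sub>R snd (X n), snd (X n))" for n
    have "Y \<longlonglongrightarrow> (fst (\<pi> x \<xi>, \<xi>) + ?u *\<^sub>R snd (\<pi> x \<xi>, \<xi>), snd (\<pi> x \<xi>, \<xi>))"
      unfolding Y_def by (intro tendsto_intros X[THEN conjunct2])
    then have Y: "Y \<longlonglongrightarrow> (x, \<xi>)" by (simp add: entry_def)
    have ev: "eventually (\<lambda>n. Y n \<in> D) sequentially"
    \<comment> \<open>With time 0 nothing is moved and inflow points are in \<open>D\<close> anyway;
      otherwise \<open>x\<close> is interior, and openness puts the pushed points into \<Omega>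
      eventually.\<close>
    proof (cases "?u = 0")
      case True
      then have "Y n = X n" for n by (simp add: Y_def)
      then show ?thesis using X subsetD[OF \<Gamma>_subset_D] by (intro always_eventually allI) simp
    next
      case False
      then have "x \<in> \<Omega>" using D_cases[OF D] \<Gamma>_back_time by blast
      then have "eventually (\<lambda>n. fst (Y n) \<in> \<Omega>) sequentially"
        using topological_tendstoD[OF tendsto_fst[OF Y] op] by simp
      then show ?thesis
      proof eventually_elim
        case (elim n)
        have "(fst (X n), snd (X n)) \<in> D" using X \<Gamma>_subset_D by auto
        then have "norm (snd (X n)) = 1" by (rule D_norm)
        then show ?case using elim by (auto simp: Y_def intro: D_interior)
      qed
    qed
    have "(\<lambda>n. G0 (Y n)) \<longlonglongrightarrow> G0 (x, \<xi>)"
      by (rule continuous_within_tendsto_compose[OF c ev Y])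
    moreover have "eventually (\<lambda>n. G0 (Y n) = f0 (X n)) sequentially"
      using ev
    proof eventually_elim
      case (elim n)
      have "(fst (X n), snd (X n)) \<in> \<Gamma>" using X by simp
      then show ?case
        using entry_\<Gamma>_shift[of "fst (X n)" "snd (X n)" ?u] elim back_time_nonneg[OF D]
        by (simp add: G0_def Y_def)
    qed
    ultimately show "(f0 \<circ> X) \<longlonglongrightarrow> f0 (\<pi> x \<xi>, \<xi>)"
      by (auto simp: G0_def comp_def elim: Lim_transform_eventually)
  qed
next
  assume c: "continuous (at (\<pi> x \<xi>, \<xi>) within \<Gamma>) f0"
  show "continuous (at (x, \<xi>) within D) G0"
    unfolding continuous_within_sequentially
  proof (intro allI impI)
    fix X assume X: "(\<forall>n. X n \<in> D) \<and> X \<longlonglongrightarrow> (x, \<xi>)"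
    have "(\<lambda>n. \<pi> (fst (X n)) (snd (X n))) \<longlonglongrightarrow> \<pi> (fst (x, \<xi>)) (snd (x, \<xi>))"
      by (rule continuous_on_tendsto_compose[OF continuous_entry X[THEN conjunct2] D]) (use X in simp)
    moreover have "(\<lambda>n. snd (X n)) \<longlonglongrightarrow> \<xi>" using tendsto_snd[OF X[THEN conjunct2]] by simp
    ultimately have "(\<lambda>n. (\<pi> (fst (X n)) (snd (X n)), snd (X n))) \<longlonglongrightarrow> (\<pi> x \<xi>, \<xi>)"
      by (intro tendsto_Pair) simp_all
    moreover have "eventually (\<lambda>n. (\<pi> (fst (X n)) (snd (X n)), snd (X n)) \<in> \<Gamma>) sequentially"
      using X by (intro always_eventually allI entry_\<Gamma>) simp
    ultimately have "(\<lambda>n. f0 (\<pi> (fst (X n)) (snd (X n)), snd (X n))) \<longlonglongrightarrow> f0 (\<pi> x \<xi>, \<xi>)"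
      by (intro continuous_within_tendsto_compose[OF c])
    then show "(G0 \<circ> X) \<longlonglongrightarrow> G0 (x, \<xi>)" by (simp add: G0_def comp_def case_prod_beta)
  qed
qed

text \<open>\<open>f\<close> is obtained from \<open>G0\<close> by a nonvanishing continuous factor
  and a continuous summand, both of which can be undone, so the two jump at the same points. Such a
  point lies on the forward chord of a discontinuity of \<open>f0\<close>, and
  \<open>tau_plus_iff\<close> says how far that chord reaches.\<close>

lemma disc_solution:
  assumes b: "continuous_on D b" and f: "f = (\<lambda>z. F0 z + b z)"
  shows "disc D f = {(x + s *\<^sub>R \<xi>, \<xi>) | x \<xi> s. (x, \<xi>) \<in> disc \<Gamma> f0 \<and> 0 \<le> s \<and> s < tau_plus \<Omega> x \<xi>}"
proof -
  have iff: "continuous (at z within D) f \<longleftrightarrow> continuous (at z within D) G0" if z: "z \<in> D" for z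
  proof
    have bz: "continuous (at z within D) b" "continuous (at z within D) B"
      using b continuous_B z by (auto simp: continuous_on_eq_continuous_within)
    assume "continuous (at z within D) G0"
    then show "continuous (at z within D) f" unfolding f F0_def by (intro continuous_intros bz)
  next
    have bz: "continuous (at z within D) b" "continuous (at z within D) B"
      using b continuous_B z by (auto simp: continuous_on_eq_continuous_within)
    assume "continuous (at z within D) f"
    then have "continuous (at z within D) (\<lambda>z. exp (B z) * (f z - b z))" by (intro continuous_intros bz)
    also have "(\<lambda>z. exp (B z) * (f z - b z)) = G0" by (simp add: f F0_def exp_minus fun_eq_iff)
    finally show "continuous (at z within D) G0" .
  qed
  have disc_iff: "(x, \<xi>) \<in> disc D f \<longleftrightarrow> (\<pi> x \<xi>, \<xi>) \<in> disc \<Gamma> f0" if "(x, \<xi>) \<in> D" for x \<xi>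
    using iff[OF that] continuous_G0_iff[OF that] entry_\<Gamma>[OF that] that by (simp add: disc_def)
  show ?thesis
  proof (intro set_eqI iffI)
    fix z assume z: "z \<in> disc D f"
    obtain x \<xi> where z_eq: "z = (x, \<xi>)" by force
    have D: "(x, \<xi>) \<in> D" using z by (simp add: z_eq disc_def)
    have "(\<pi> x \<xi>, \<xi>) \<in> disc \<Gamma> f0" using disc_iff[OF D] z by (simp add: z_eq)
    moreover have "\<tau> x \<xi> < tau_plus \<Omega> (\<pi> x \<xi>) \<xi>"
      using tau_plus_iff[OF entry_\<Gamma>[OF D] back_time_nonneg[OF D]] D entry_plus[of x \<xi>] by simp
    ultimately show "z \<in> {(x + s *\<^sub>R \<xi>, \<xi>) | x \<xi> s. (x, \<xi>) \<in> disc \<Gamma> f0 \<and> 0 \<le> s \<and> s < tau_plus \<Omega> x \<xi>}"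
      using back_time_nonneg[OF D] entry_plus[of x \<xi>] unfolding z_eq by blast
  next
    fix z assume "z \<in> {(x + s *\<^sub>R \<xi>, \<xi>) | x \<xi> s. (x, \<xi>) \<in> disc \<Gamma> f0 \<and> 0 \<le> s \<and> s < tau_plus \<Omega> x \<xi>}"
    then obtain y \<xi> s where z: "z = (y + s *\<^sub>R \<xi>, \<xi>)" and d: "(y, \<xi>) \<in> disc \<Gamma> f0" and s: "0 \<le> s" "s < tau_plus \<Omega> y \<xi>"
      by blast
    have y: "(y, \<xi>) \<in> \<Gamma>" using d by (simp add: disc_def)
    have D: "(y + s *\<^sub>R \<xi>, \<xi>) \<in> D" using tau_plus_iff[OF y s(1)] s(2) by simp
    show "z \<in> disc D f" unfolding z disc_iff[OF D] entry_\<Gamma>_shift[OF y D s(1)] by (rule d)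
  qed
qed

theorem well_posed:
  "\<exists>f. is_solution \<Omega> \<Omega>0 l t \<mu>t \<mu>s p f0 f \<and>
     (\<forall>g. is_solution \<Omega> \<Omega>0 l t \<mu>t \<mu>s p f0 g \<longrightarrow> (\<forall>z\<in>D. g z = f z)) \<and>
     disc D f = {(x + s *\<^sub>R \<xi>, \<xi>) | x \<xi> s. (x, \<xi>) \<in> disc \<Gamma> f0 \<and> 0 \<le> s \<and> s < tau_plus \<Omega> x \<xi>}"
proof -
  obtain b where b: "continuous_on D b" "bounded (b ` D)" "\<And>z. z \<in> D \<Longrightarrow> b z = H (\<lambda>z. F0 z + b z) z"
    by (rule fixed_point) blast
  define f where "f = (\<lambda>z. F0 z + H (\<lambda>z. F0 z + b z) z)"
  have sol: "is_solution \<Omega> \<Omega>0 l t \<mu>t \<mu>s p f0 f" by (rule is_solutionI[OF b(1,2) f_def b(3)])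
  moreover have "\<forall>z\<in>D. g z = f z" if "is_solution \<Omega> \<Omega>0 l t \<mu>t \<mu>s p f0 g" for g
    using solution_unique[OF that sol] by blast
  moreover have "disc D f = {(x + s *\<^sub>R \<xi>, \<xi>) | x \<xi> s. (x, \<xi>) \<in> disc \<Gamma> f0 \<and> 0 \<le> s \<and> s < tau_plus \<Omega> x \<xi>}"
    by (rule disc_solution[OF continuous_H[OF field_F0_plus[OF b(1,2)]] f_def])
  ultimately show ?thesis by blast
qed

end

theorem theorem1:
  fixes \<Omega> \<Omega>0 :: "'a::euclidean_space set"
    and N :: nat
    and \<Omega>s :: "nat \<Rightarrow> 'a set"
    and l :: "'a \<Rightarrow> 'a \<Rightarrow> nat"
    and t :: "'a \<Rightarrow> 'a \<Rightarrow> nat \<Rightarrow> real"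
    and \<mu>t \<mu>s :: "'a \<Rightarrow> real"
    and p :: "'a \<Rightarrow> 'a \<Rightarrow> 'a \<Rightarrow> real"
    and f0 :: "'a \<times> 'a \<Rightarrow> real"
  assumes "DIM('a) \<in> {2, 3}"
    and "convex_C1_domain \<Omega>"
    and "domain_decomposition \<Omega> N \<Omega>s"
    and "\<Omega>0 = (\<Union>j\<in>{1..N}. \<Omega>s j)"
    and "generalized_convexity \<Omega> \<Omega>0 l t"
    and "admissible_coefficients \<Omega>0 \<mu>t \<mu>s"
    and "admissible_phase_function \<Omega>0 p"
    and "bounded (f0 ` Gamma_minus \<Omega>)"
    and "f0 \<in> borel_measurable (restrict_space borel (Gamma_minus \<Omega>))"
    and "(AE x in surface_measure. x \<in> frontier \<Omega> \<longrightarrow>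
            continuous_on (Gamma_minus_pt \<Omega> x) (\<lambda>\<xi>. f0 (x, \<xi>))) \<or>
         (AE \<xi> in surface_measure. \<xi> \<in> sphere 0 1 \<longrightarrow>
            continuous_on (Gamma_minus_dir \<Omega> \<xi>) (\<lambda>x. f0 (x, \<xi>)))"
  shows "\<exists>f. is_solution \<Omega> \<Omega>0 l t \<mu>t \<mu>s p f0 f \<and>
           (\<forall>g. is_solution \<Omega> \<Omega>0 l t \<mu>t \<mu>s p f0 g \<longrightarrow> (\<forall>z\<in>phase_domain \<Omega>. g z = f z)) \<and>
           disc (phase_domain \<Omega>) f =
             {(x + s *\<^sub>R \<xi>, \<xi>) | x \<xi> s.
                (x, \<xi>) \<in> disc (Gamma_minus \<Omega>) f0 \<and> 0 \<le> s \<and> s < tau_plus \<Omega> x \<xi>}"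
proof -
  interpret boundary_problem \<Omega> \<Omega>0 N \<Omega>s l t \<mu>t \<mu>s p f0
    using assms by unfold_locales auto
  show ?thesis by (rule well_posed)
qed

end
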